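(* Any nonsingular toric Fano surface is F-equivalent to the projective plane $\mathbf P^2$, and any nonsingular toric weak Fano surface is weakly-F-equivalent to $\mathbf P^2$. In particular, any nonsingular toric Fano surface is either pseudo-symmetric or F-equivalent to $\mathbf P^2$.
   Context: A nonsingular toric Fano $d$-fold is a nonsingular complete $d$-dimensional toric variety $X$ with $-K_X$ ample. A nonsingular toric weak Fano $d$-fold is a nonsingular projective $d$-dimensional toric variety $X$ with $-K_X$ nef and big. Varieties are considered up to isomorphism. Equivariant blow-ups are blow-ups along torus-invariant irreducible closed subvarieties. Finite successions may be empty. F-equivalence: two nonsingular toric Fano $d$-folds $X_1,X_2$ are F-equivalent if there exist nonsingular toric Fano $d$-folds $Y_0=X_1,Y_1,\dots,Y_{2l}=X_2$ together with, for each odd $1\le j\le 2l-1$, morphisms $Y_j\to Y_{j-1}$ and $Y_j\to Y_{j+1}$, each a finite succession of equivariant blow-ups in which all intermediate varieties are nonsingular toric Fano $d$-folds. Pseudo-symmetric: a nonsingular toric Fano $d$-fold with fan $\Sigma$ is pseudo-symmetric if there are two $d$-dimensional cones $\sigma,\sigma'\in\Sigma$ with $\sigma=-\sigma'$. Flop: let $N$ be a free abelian group of rank $d$ and let $X=T_N\mathrm{emb}(\Sigma)$ be a nonsingular projective toric $d$-fold. $\mathrm{G}(\Sigma)$ is the set of primitive generators of rays of $\Sigma$. A primitive collection is a nonempty $P\subset\mathrm{G}(\Sigma)$ that does not generate a cone of $\Sigma$ while every $P\setminus\{y\}$, $y\in P$, does; its primitive relation is $\sum_{p\in P}p=\sum_j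 a_jy_j$, where the $y_j$ are the ray generators of the unique cone $\sigma(P)\in\Sigma$ whose relative interior contains $\sum_{p\in P}p$ and $a_j\in\mathbf Z_{>0}$. $r(P)$ is the numerical class of $1$-cycles, viewed as an element of $\{(a_g)\in\mathbf Z^{\mathrm{G}(\Sigma)}\mid\sum_g a_gg=0\}\cong A_1(X)$, given by the primitive relation (coefficient $1$ on elements of $P$, $-a_j$ on $y_j$, $0$ otherwise). Suppose $P=\{x_1,\dots,x_l\}$ has primitive relation $x_1+\cdots+x_l=y_1+\cdots+y_l$ and $r(P)$ lies in an extremal ray of the Mori cone $\mathbf{NE}(X)$. Blow up $X$ along the invariant subvariety of $\mathrm{Cone}(y_1,\dots,y_l)$, getting a fan with new ray generator $z=x_1+\cdots+x_l$, and then blow down with respect to the primitive relation $x_1+\cdots+x_l=z$ (i.e. remove the ray of $z$, the blow-down being inverse to the blow-up along the subvariety of $\mathrm{Cone}(x_1,\dots,x_l)$). This operation, producing a toric variety $X^+$ whose fan has a primitive relation $y_1+\cdots+y_l=x_1+\cdots+x_l$, is called a flop. Weak F-equivalence: two nonsingular toric weak Fano $d$-folds $X_1,X_2$ are weakly-F-equivalent if there exist nonsingular toric weak Fano $d$-folds $Y_0=X_1,Y_1,\dots,Y_{3l}=X_2$ together with, for each $1\le j\le l$, finite successions $Y_{3j-2}\to Y_{3j-3}$ and $Y_{3j-2}\to Y_{3j-1}$ of equivariant blow-ups, and, for each $1\le k\le l$, finite successions $Y_{3k-1}\leftrightarrow Y_{3k}$ of flops, all through nonsingular toric weak Fano $d$-folds.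 *)

theory Defs
  imports "HOL-Analysis.Analysis"
begin

text \<open>
  Toric varieties of dimension \<open>d = CARD('n)\<close> are represented by their fans in
  \<open>N\<^sub>R = real ^ 'n\<close>, where \<open>N\<close> is the standard lattice.  The inner product identifies the dual
  lattice \<open>M\<close> with \<open>N\<close>, so both are written \<open>lattice\<close>.
  Isomorphism of varieties is isomorphism of fans: abstractly isomorphic complete toric varieties
  are isomorphic as toric varieties.
\<close>

section \<open>Fans\<close>

definition lattice :: "(real ^ 'n) set" where
  "lattice = {x. \<forall>i. x $ i \<in> \<int>}"

abbreviation Cone :: "(real ^ 'n) set \<Rightarrow> (real ^ 'n) set" where
  "Cone S \<equiv> convex_cone hull S"

definition rational_polyhedral_cone :: "(real ^ 'n) set \<Rightarrow> bool" where
  "rational_polyhedral_cone \<sigma> \<longleftrightarrow> (\<exists>S. finite S \<and> S \<subseteq> lattice \<and> \<sigma> = Cone S)"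

definition strongly_convex_cone :: "(real ^ 'n) set \<Rightarrow> bool" where
  "strongly_convex_cone \<sigma> \<longleftrightarrow> \<sigma> \<inter> uminus ` \<sigma> = {0}"

text \<open>The condition \<open>\<tau> \<noteq> {}\<close> is needed because the empty set is a face for \<open>face_of\<close>.\<close>

definition fan :: "(real ^ 'n) set set \<Rightarrow> bool" where
  "fan \<Delta> \<longleftrightarrow>
     finite \<Delta> \<and> \<Delta> \<noteq> {} \<and>
     (\<forall>\<sigma>\<in>\<Delta>. rational_polyhedral_cone \<sigma> \<and> strongly_convex_cone \<sigma>) \<and>
     (\<forall>\<sigma>\<in>\<Delta>. \<forall>\<tau>. \<tau> face_of \<sigma> \<and> \<tau> \<noteq> {} \<longrightarrow> \<tau> \<in> \<Delta>) \<and>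
     (\<forall>\<sigma>\<in>\<Delta>. \<forall>\<sigma>'\<in>\<Delta>. \<sigma> \<inter> \<sigma>' face_of \<sigma> \<and> \<sigma> \<inter> \<sigma>' face_of \<sigma>')"

definition lattice_basis :: "(real ^ 'n) set \<Rightarrow> bool" where
  "lattice_basis B \<longleftrightarrow>
     independent B \<and> lattice = {\<Sum>b\<in>B. of_int (c b) *\<^sub>R b | c :: real ^ 'n \<Rightarrow> int. True}"

definition nonsingular_fan :: "(real ^ 'n) set set \<Rightarrow> bool" where
  "nonsingular_fan \<Delta> \<longleftrightarrow> fan \<Delta> \<and> (\<forall>\<sigma>\<in>\<Delta>. \<exists>B A. lattice_basis B \<and> A \<subseteq> B \<and> \<sigma> = Cone A)"

definition complete_fan :: "(real ^ 'n) set set \<Rightarrow> bool" where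
  "complete_fan \<Delta> \<longleftrightarrow> fan \<Delta> \<and> \<Union>\<Delta> = UNIV"

definition primitive_vector :: "real ^ 'n \<Rightarrow> bool" where
  "primitive_vector x \<longleftrightarrow>
     x \<in> lattice \<and> x \<noteq> 0 \<and> (\<forall>y\<in>lattice. \<forall>k::nat. x = real k *\<^sub>R y \<longrightarrow> k = 1)"

text \<open>The set \<open>G(\<Delta>)\<close> of primitive generators of rays.\<close>

definition gens :: "(real ^ 'n) set set \<Rightarrow> (real ^ 'n) set" where
  "gens \<Delta> = {x. primitive_vector x \<and> Cone {x} \<in> \<Delta>}"

definition fan_iso :: "(real ^ 'n) set set \<Rightarrow> (real ^ 'n) set set \<Rightarrow> bool" where
  "fan_iso \<Delta> \<Delta>' \<longleftrightarrow>
     (\<exists>f :: real ^ 'n \<Rightarrow> real ^ 'n. linear f \<and> f ` lattice = lattice \<and> \<Delta>' = (\<lambda>\<sigma>. f ` \<sigma>) ` \<Delta>)"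

definition projective_space_fan :: "(real ^ 'n) set set" where
  "projective_space_fan =
     {Cone A | A. A \<subset> insert (- (\<Sum>i\<in>UNIV. axis i 1)) (range (\<lambda>i. axis i 1))}"

section \<open>Torus-invariant divisors and positivity\<close>

text \<open>
  A torus-invariant divisor \<open>\<Sum>\<^sub>g a\<^sub>g D\<^sub>g\<close> is given by its coefficients on \<open>gens \<Delta>\<close>.
  Its global sections have as basis the characters \<open>\<chi>\<^sup>m\<close> with \<open>m \<in> sections \<Delta> a\<close>.
\<close>

definition sections :: "(real ^ 'n) set set \<Rightarrow> (real ^ 'n \<Rightarrow> int) \<Rightarrow> (real ^ 'n) set" where
  "sections \<Delta> a = {m \<in> lattice. \<forall>g\<in>gens \<Delta>. m \<bullet> g \<ge> - of_int (a g)}"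

text \<open>
  On the affine chart \<open>Spec C[\<sigma>\<^sup>\<or> \<inter> M]\<close> of a maximal cone \<open>\<sigma>\<close> the sheaf \<open>O(D)\<close> is generated by
  \<open>\<chi>\<^sup>m\<close>, where \<open>m\<close> is the linear form with value \<open>-a\<^sub>g\<close> on the generators \<open>g\<close> of \<open>\<sigma>\<close>.  The complete
  linear system is a closed embedding iff for every such chart this \<open>\<chi>\<^sup>m\<close> is a global section and
  the quotients \<open>\<chi>\<^sup>u / \<chi>\<^sup>m\<close>, for \<open>\<chi>\<^sup>u\<close> a global section, generate the coordinate ring, i.e. the
  monoid \<open>\<sigma>\<^sup>\<or> \<inter> M\<close>.
\<close>

definition very_ample :: "(real ^ 'n) set set \<Rightarrow> (real ^ 'n \<Rightarrow> int) \<Rightarrow> bool" where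
  "very_ample \<Delta> a \<longleftrightarrow>
     (\<forall>\<sigma>\<in>\<Delta>. dim \<sigma> = CARD('n) \<longrightarrow>
        (\<exists>m\<in>sections \<Delta> a.
           (\<forall>g\<in>gens \<Delta> \<inter> \<sigma>. m \<bullet> g = - of_int (a g)) \<and>
           {sum_list us | us. set us \<subseteq> (\<lambda>u. u - m) ` sections \<Delta> a}
             = {u \<in> lattice. \<forall>x\<in>\<sigma>. u \<bullet> x \<ge> 0}))"

definition ample :: "(real ^ 'n) set set \<Rightarrow> (real ^ 'n \<Rightarrow> int) \<Rightarrow> bool" where
  "ample \<Delta> a \<longleftrightarrow> (\<exists>k::nat. k \<ge> 1 \<and> very_ample \<Delta> (\<lambda>g. int k * a g))"

text \<open>The condition is \<open>h\<^sup>0(kD) \<ge> C k\<^sup>d\<close> for some \<open>C > 0\<close> and all sufficiently large \<open>k\<close>.\<close>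

definition big :: "(real ^ 'n) set set \<Rightarrow> (real ^ 'n \<Rightarrow> int) \<Rightarrow> bool" where
  "big \<Delta> a \<longleftrightarrow>
     (\<exists>C::real. C > 0 \<and>
        (\<forall>\<^sub>F k in sequentially.
           real (card (sections \<Delta> (\<lambda>g. int k * a g))) \<ge> C * real k ^ CARD('n)))"

text \<open>
  A numerical class of 1-cycles is represented by the intersection numbers \<open>c g\<close> with the divisors
  \<open>D\<^sub>g\<close>, extended by zero.  The invariant curve of a cone \<open>\<tau>\<close> of dimension \<open>d - 1\<close>, lying between
  \<open>Cone (insert x \<tau>)\<close> and \<open>Cone (insert x' \<tau>)\<close>, meets \<open>D\<^sub>x\<close> and \<open>D\<^sub>x\<^sub>'\<close> in one point each, is
  disjoint from every divisor outside \<open>\<tau> \<union> {x, x'}\<close>, and the remaining intersection numbers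
  are determined by the relation \<open>\<Sum>\<^sub>g (D\<^sub>g \<cdot> C) g = 0\<close>.
\<close>

definition invariant_curve_class ::
    "(real ^ 'n) set set \<Rightarrow> (real ^ 'n \<Rightarrow> real) \<Rightarrow> bool" where
  "invariant_curve_class \<Delta> c \<longleftrightarrow>
     (\<exists>\<tau>\<in>\<Delta>. \<exists>x\<in>gens \<Delta> - \<tau>. \<exists>x'\<in>gens \<Delta> - \<tau>.
        dim \<tau> = CARD('n) - 1 \<and> x \<noteq> x' \<and>
        Cone (insert x \<tau>) \<in> \<Delta> \<and> Cone (insert x' \<tau>) \<in> \<Delta> \<and>
        c x = 1 \<and> c x' = 1 \<and> (\<forall>g. g \<notin> (gens \<Delta> \<inter> \<tau>) \<union> {x, x'} \<longrightarrow> c g = 0) \<and>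
        (\<Sum>g\<in>gens \<Delta>. c g *\<^sub>R g) = 0)"

text \<open>
  Every effective 1-cycle on a complete toric variety is rationally equivalent to an effective
  torus-invariant one, so the invariant curves span the Mori cone; there are finitely many of them.
\<close>

definition NE :: "(real ^ 'n) set set \<Rightarrow> (real ^ 'n \<Rightarrow> real) set" where
  "NE \<Delta> = {\<lambda>g. \<Sum>c\<in>F. w c * c g | F w.
             finite F \<and> (\<forall>c\<in>F. invariant_curve_class \<Delta> c \<and> w c \<ge> 0)}"

definition nef :: "(real ^ 'n) set set \<Rightarrow> (real ^ 'n \<Rightarrow> int) \<Rightarrow> bool" where
  "nef \<Delta> a \<longleftrightarrow> (\<forall>c\<in>NE \<Delta>. (\<Sum>g\<in>gens \<Delta>. of_int (a g) * c g) \<ge> 0)"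

text \<open>On a toric variety \<open>-K\<close> is the sum of all the \<open>D\<^sub>g\<close>.\<close>

definition anticanonical :: "real ^ 'n \<Rightarrow> int" where
  "anticanonical = (\<lambda>g. 1)"

definition projective_fan :: "(real ^ 'n) set set \<Rightarrow> bool" where
  "projective_fan \<Delta> \<longleftrightarrow> complete_fan \<Delta> \<and> (\<exists>a. ample \<Delta> a)"

definition toric_Fano :: "(real ^ 'n) set set \<Rightarrow> bool" where
  "toric_Fano \<Delta> \<longleftrightarrow> nonsingular_fan \<Delta> \<and> complete_fan \<Delta> \<and> ample \<Delta> anticanonical"

definition toric_weak_Fano :: "(real ^ 'n) set set \<Rightarrow> bool" where
  "toric_weak_Fano \<Delta> \<longleftrightarrow>
     nonsingular_fan \<Delta> \<and> projective_fan \<Delta> \<and> nef \<Delta> anticanonical \<and> big \<Delta> anticanonical"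

definition pseudo_symmetric :: "(real ^ 'n) set set \<Rightarrow> bool" where
  "pseudo_symmetric \<Delta> \<longleftrightarrow>
     toric_Fano \<Delta> \<and>
     (\<exists>\<sigma>\<in>\<Delta>. \<exists>\<sigma>'\<in>\<Delta>. dim \<sigma> = CARD('n) \<and> dim \<sigma>' = CARD('n) \<and> \<sigma> = uminus ` \<sigma>')"

section \<open>Equivariant blow-ups and F-equivalence\<close>

text \<open>The fan of the blow-up along the orbit closure of \<open>\<tau>\<close>; the new ray generator is \<open>z\<close>.\<close>

definition star_subdivision ::
    "(real ^ 'n) set set \<Rightarrow> (real ^ 'n) set \<Rightarrow> (real ^ 'n) set set" where
  "star_subdivision \<Delta> \<tau> =
     (let z = \<Sum>(gens \<Delta> \<inter> \<tau>) in
        {\<sigma>\<in>\<Delta>. \<not> \<tau> \<subseteq> \<sigma>} \<union>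
        {Cone (insert z \<rho>) | \<rho>. \<rho> \<in> \<Delta> \<and> \<not> \<tau> \<subseteq> \<rho> \<and> (\<exists>\<sigma>\<in>\<Delta>. \<tau> \<subseteq> \<sigma> \<and> \<rho> \<subseteq> \<sigma>)})"

text \<open>\<open>equivariant_blowup \<Delta>' \<Delta>\<close>: the variety of \<open>\<Delta>'\<close> is a blow-up of the variety of \<open>\<Delta>\<close>.\<close>

definition equivariant_blowup :: "(real ^ 'n) set set \<Rightarrow> (real ^ 'n) set set \<Rightarrow> bool" where
  "equivariant_blowup \<Delta>' \<Delta> \<longleftrightarrow> (\<exists>\<tau>\<in>\<Delta>. \<tau> \<noteq> {0} \<and> fan_iso (star_subdivision \<Delta> \<tau>) \<Delta>')"

text \<open>Finite successions of blow-ups all of whose members lie in the class \<open>K\<close>.\<close>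

definition blowups ::
    "((real ^ 'n) set set \<Rightarrow> bool) \<Rightarrow> (real ^ 'n) set set \<Rightarrow> (real ^ 'n) set set \<Rightarrow> bool" where
  "blowups K = (\<lambda>\<Delta>' \<Delta>. K \<Delta>' \<and> K \<Delta> \<and> equivariant_blowup \<Delta>' \<Delta>)\<^sup>*\<^sup>*"

definition F_equivalent :: "(real ^ 'n) set set \<Rightarrow> (real ^ 'n) set set \<Rightarrow> bool" where
  "F_equivalent \<Delta>1 \<Delta>2 \<longleftrightarrow>
     (\<exists>(l::nat) Y. fan_iso \<Delta>1 (Y 0) \<and> fan_iso (Y (2 * l)) \<Delta>2 \<and>
        (\<forall>j\<le>2 * l. toric_Fano (Y j)) \<and>
        (\<forall>j<2 * l. odd j \<longrightarrow>
           blowups toric_Fano (Y j) (Y (j - 1)) \<and> blowups toric_Fano (Y j) (Y (j + 1))))"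

section \<open>Flops and weak F-equivalence\<close>

definition primitive_collection :: "(real ^ 'n) set set \<Rightarrow> (real ^ 'n) set \<Rightarrow> bool" where
  "primitive_collection \<Delta> P \<longleftrightarrow>
     P \<noteq> {} \<and> P \<subseteq> gens \<Delta> \<and> Cone P \<notin> \<Delta> \<and> (\<forall>y\<in>P. Cone (P - {y}) \<in> \<Delta>)"

text \<open>
  The relation \<open>\<Sum>P = \<Sum>\<^sub>y a\<^sub>y y\<close>, where \<open>y\<close> runs through the generators of \<open>\<sigma> = \<sigma>(P)\<close>.
\<close>

definition primitive_relation ::
    "(real ^ 'n) set set \<Rightarrow> (real ^ 'n) set \<Rightarrow> (real ^ 'n) set \<Rightarrow> (real ^ 'n \<Rightarrow> nat) \<Rightarrow> bool" where
  "primitive_relation \<Delta> P \<sigma> a \<longleftrightarrow>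
     primitive_collection \<Delta> P \<and> \<sigma> \<in> \<Delta> \<and> \<Sum>P \<in> rel_interior \<sigma> \<and>
     (\<forall>y\<in>gens \<Delta> \<inter> \<sigma>. a y > 0) \<and> \<Sum>P = (\<Sum>y\<in>gens \<Delta> \<inter> \<sigma>. real (a y) *\<^sub>R y)"

definition relation_class ::
    "(real ^ 'n) set set \<Rightarrow> (real ^ 'n) set \<Rightarrow> (real ^ 'n) set \<Rightarrow> (real ^ 'n \<Rightarrow> nat) \<Rightarrow>
     real ^ 'n \<Rightarrow> real" where
  "relation_class \<Delta> P \<sigma> a =
     (\<lambda>g. (if g \<in> P then 1 else 0) - (if g \<in> gens \<Delta> \<inter> \<sigma> then real (a g) else 0))"

text \<open>The half-line spanned by \<open>r\<close> is a one-dimensional face of \<open>NE \<Delta>\<close>.\<close>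

definition spans_extremal_ray :: "(real ^ 'n) set set \<Rightarrow> (real ^ 'n \<Rightarrow> real) \<Rightarrow> bool" where
  "spans_extremal_ray \<Delta> r \<longleftrightarrow>
     (let R = {\<lambda>g. s * r g | s. s \<ge> 0} in
        r \<noteq> (\<lambda>g. 0) \<and> R \<subseteq> NE \<Delta> \<and>
        (\<forall>b\<in>NE \<Delta>. \<forall>c\<in>NE \<Delta>. (\<lambda>g. b g + c g) \<in> R \<longrightarrow> b \<in> R \<and> c \<in> R))"

text \<open>
  Blowing down with respect to \<open>x\<^sub>1 + \<dots> + x\<^sub>l = z\<close> means that the blown-up fan is also the
  star subdivision of the new fan \<open>\<Delta>''\<close> along \<open>Cone {x\<^sub>1, \<dots>, x\<^sub>l}\<close>.
\<close>

definition flop :: "(real ^ 'n) set set \<Rightarrow> (real ^ 'n) set set \<Rightarrow> bool" where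
  "flop \<Delta> \<Delta>' \<longleftrightarrow>
     nonsingular_fan \<Delta> \<and> projective_fan \<Delta> \<and>
     (\<exists>P \<sigma> \<Delta>''.
        primitive_relation \<Delta> P \<sigma> (\<lambda>_. 1) \<and> card (gens \<Delta> \<inter> \<sigma>) = card P \<and>
        spans_extremal_ray \<Delta> (relation_class \<Delta> P \<sigma> (\<lambda>_. 1)) \<and>
        nonsingular_fan \<Delta>'' \<and> complete_fan \<Delta>'' \<and> Cone P \<in> \<Delta>'' \<and>
        star_subdivision \<Delta>'' (Cone P) = star_subdivision \<Delta> \<sigma> \<and>
        fan_iso \<Delta>'' \<Delta>')"

definition flops ::
    "((real ^ 'n) set set \<Rightarrow> bool) \<Rightarrow> (real ^ 'n) set set \<Rightarrow> (real ^ 'n) set set \<Rightarrow> bool" where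
  "flops K = (\<lambda>\<Delta> \<Delta>'. K \<Delta> \<and> K \<Delta>' \<and> flop \<Delta> \<Delta>')\<^sup>*\<^sup>*"

definition weakly_F_equivalent :: "(real ^ 'n) set set \<Rightarrow> (real ^ 'n) set set \<Rightarrow> bool" where
  "weakly_F_equivalent \<Delta>1 \<Delta>2 \<longleftrightarrow>
     (\<exists>(l::nat) Y. fan_iso \<Delta>1 (Y 0) \<and> fan_iso (Y (3 * l)) \<Delta>2 \<and>
        (\<forall>j\<le>3 * l. toric_weak_Fano (Y j)) \<and>
        (\<forall>j\<in>{1..l}.
           blowups toric_weak_Fano (Y (3 * j - 2)) (Y (3 * j - 3)) \<and>
           blowups toric_weak_Fano (Y (3 * j - 2)) (Y (3 * j - 1))) \<and>
        (\<forall>k\<in>{1..l}. flops toric_weak_Fano (Y (3 * k - 1)) (Y (3 * k))))"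

end

theory Submission
  imports Defs
begin

text \<open>
  The fan of a nonsingular complete toric surface is determined by its set \<open>G\<close> of ray generators:
  in cyclic order, consecutive generators have determinant 1, and three consecutive ones satisfy
  \<open>p + s = a v\<close> with \<open>a = det (p, s)\<close>.  The curve of the ray of \<open>v\<close> has self-intersection \<open>-a\<close>
  and anticanonical degree \<open>2 - a\<close>.  Accordingly the surface is Fano iff \<open>a \<le> 1\<close> at every ray
  (\<open>toric_Fano_iff\<close>) and weak Fano iff \<open>a \<le> 2\<close> at every ray (\<open>toric_weak_Fano_iff\<close>).  The hard
  half of the former is that local convexity at each ray gives global sections; projectivity in
  the latter comes from the same argument applied to a large multiple of the Euclidean norm, and
  bigness from the polygon of \<open>-K\<close> being a neighbourhood of the origin.

  A ray with \<open>a = 1\<close> is the exceptional ray of a blow-up.  Removing it lowers \<open>a\<close> by 1 at its two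
  neighbours and changes nothing elsewhere, so the bounds, and with them the Fano and the weak Fano
  property, survive every contraction (\<open>wall_bound_remove\<close>).  Contracting as long as possible ends
  at the projective plane or at a Hirzebruch surface with rays \<open>x, v, -x, k x - v\<close>
  (\<open>ray_system_trichotomy\<close>): a generator of maximal Euclidean norm has \<open>a \<in> {-1, 0, 1}\<close>, and in
  the cases \<open>a = -1\<close> and \<open>a = 0\<close> any further ray produces a contractible one; the main
  case is that of a ray on which a suitable linear form is maximal (\<open>peak_contractible\<close>).

  The bounds leave \<open>k = 0\<close>, and in the weak Fano case \<open>k = 2\<close>, up to the symmetry \<open>k \<mapsto> -k\<close>; the
  surfaces with \<open>k = 1\<close> and \<open>k = -1\<close> are blow-ups of the plane.  The surface with the additional
  ray \<open>(k - 1) x - v\<close> contracts both to parameter \<open>k\<close> and to parameter \<open>k - 1\<close>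
  (\<open>elementary_transformation\<close>), and for \<open>k \<ge> 0\<close> it satisfies the bounds whenever they allow the
  parameter \<open>k\<close>.  Hence every surface of the class is joined to the projective plane by a chain
  \<open>\<Delta> \<rightarrow> A \<leftarrow> B \<rightarrow> C\<close> of successions of blow-ups inside the class.
\<close>

section \<open>The determinant of two plane vectors and the lattice\<close>

definition wedge :: "real ^ 2 \<Rightarrow> real ^ 2 \<Rightarrow> real" where
  "wedge x y = x $ 1 * y $ 2 - x $ 2 * y $ 1"

lemma wedge_simps [simp]:
  "wedge (x + y) z = wedge x z + wedge y z"
  "wedge z (x + y) = wedge z x + wedge z y"
  "wedge (x - y) z = wedge x z - wedge y z"
  "wedge z (x - y) = wedge z x - wedge z y"
  "wedge (c *\<^sub>R x) z = c * wedge x z"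
  "wedge z (c *\<^sub>R x) = c * wedge z x"
  "wedge (- x) z = - wedge x z"
  "wedge z (- x) = - wedge z x"
  "wedge 0 z = 0" "wedge z 0 = 0" "wedge x x = 0"
  by (simp_all add: wedge_def algebra_simps)

lemma wedge_swap: "wedge y x = - wedge x y"
  by (simp add: wedge_def)

lemma wedge_expand_general: "wedge x y *\<^sub>R v = wedge v y *\<^sub>R x + wedge x v *\<^sub>R y"
  by (simp add: vec_eq_iff forall_2 wedge_def algebra_simps)

lemma wedge_expand:
  assumes "wedge x y = 1"
  shows "v = wedge v y *\<^sub>R x + wedge x v *\<^sub>R y"
  using wedge_expand_general [of x y v] assms by simp

lemma wedge_plucker:
  "wedge x y * wedge v w = wedge v y * wedge x w + wedge x v * wedge y w"
  by (simp add: wedge_def algebra_simps)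

lemma wedge_eqI:
  assumes "wedge x y = 1" "wedge x u = wedge x v" "wedge u y = wedge v y"
  shows "u = v"
  using wedge_expand [OF assms(1), of u] wedge_expand [OF assms(1), of v] assms(2,3) by simp

lemma wedge_inner: "wedge x v = vector [- (x $ 2), x $ 1] \<bullet> v"
  by (simp add: wedge_def inner_vec_def sum_2)

lemma lattice_add: "x \<in> lattice \<Longrightarrow> y \<in> lattice \<Longrightarrow> x + y \<in> lattice"
  and lattice_minus: "x \<in> lattice \<Longrightarrow> - x \<in> lattice"
  and lattice_diff: "x \<in> lattice \<Longrightarrow> y \<in> lattice \<Longrightarrow> x - y \<in> lattice"
  and lattice_scale: "x \<in> lattice \<Longrightarrow> c \<in> \<int> \<Longrightarrow> c *\<^sub>R x \<in> lattice"
  and lattice_zero: "0 \<in> lattice"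
  by (auto simp: lattice_def)

lemma wedge_lattice: "x \<in> lattice \<Longrightarrow> y \<in> lattice \<Longrightarrow> wedge x y \<in> \<int>"
  by (auto simp: lattice_def wedge_def)

lemma Ints_pos: "(r::real) \<in> \<int> \<Longrightarrow> 0 < r \<Longrightarrow> 1 \<le> r"
  by (auto elim!: Ints_cases)

lemma primitive_of_wedge_one:
  assumes x: "x \<in> lattice" and y: "y \<in> lattice" and xy: "\<bar>wedge x y\<bar> = 1"
  shows "primitive_vector x"
  unfolding primitive_vector_def
proof (intro conjI ballI allI impI)
  show "x \<in> lattice" by fact
  show "x \<noteq> 0" using xy by auto
  fix w and k :: nat assume w: "w \<in> lattice" and k: "x = real k *\<^sub>R w"
  obtain n where n: "wedge w y = of_int n" using wedge_lattice [OF w y] Ints_cases by blast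
  have "real_of_int \<bar>int k * n\<bar> = of_int 1"
    using xy unfolding k by (simp add: n)
  then have "\<bar>int k * n\<bar> = 1"
    by (simp only: of_int_eq_iff)
  then have "int k dvd 1"
    by (metis abs_dvd_iff dvd_triv_left dvd_abs_iff)
  then show "k = 1" by simp
qed

text \<open>
  With \<open>wedge u v = 1\<close> the vector \<open>u\<close> is part of a lattice basis, and the factor is the coordinate of
  \<open>g\<close> along \<open>u\<close>.
\<close>

lemma parallel_primitive:
  assumes "u \<in> lattice" "v \<in> lattice" "g \<in> lattice" "wedge u v = 1" "wedge u g = 0"
  shows "\<exists>c\<in>\<int>. g = c *\<^sub>R u"
  using wedge_expand [of u v g] assms wedge_lattice [of g v] by auto

section \<open>Plane cones and their faces\<close>

lemma Cone_single: "Cone {x} = {c *\<^sub>R x | c. 0 \<le> c}"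
  by (auto simp: convex_cone_hull_convex_hull_nonempty)

lemma Cone_insert_Cone: "Cone (insert v (Cone A)) = Cone (insert v A)"
proof
  have "Cone A \<subseteq> Cone (insert v A)" by (rule hull_mono) blast
  moreover have "v \<in> Cone (insert v A)" by (rule hull_inc) blast
  ultimately show "Cone (insert v (Cone A)) \<subseteq> Cone (insert v A)"
    by (intro hull_minimal convex_cone_convex_cone_hull) blast
  show "Cone (insert v A) \<subseteq> Cone (insert v (Cone A))"
    by (intro hull_mono insert_mono hull_subset)
qed

lemma Cone_pair:
  assumes "wedge x y = 1"
  shows "Cone {x, y} = {v. 0 \<le> wedge x v \<and> 0 \<le> wedge v y}"
proof
  have "convex_cone {v. 0 \<le> wedge x v \<and> 0 \<le> wedge v y}"
    by (auto simp: convex_cone_iff)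
  then show "Cone {x, y} \<subseteq> {v. 0 \<le> wedge x v \<and> 0 \<le> wedge v y}"
    using assms by (intro hull_minimal) auto
next
  show "{v. 0 \<le> wedge x v \<and> 0 \<le> wedge v y} \<subseteq> Cone {x, y}"
  proof
    fix v assume "v \<in> {v. 0 \<le> wedge x v \<and> 0 \<le> wedge v y}"
    then have "wedge v y *\<^sub>R x + wedge x v *\<^sub>R y \<in> Cone {x, y}"
      by (intro convex_cone_hull_add convex_cone_hull_mul) (auto simp: hull_inc)
    then show "v \<in> Cone {x, y}" using wedge_expand [OF assms, of v] by simp
  qed
qed

lemma Cone_left:
  assumes "wedge x y = 1"
  shows "Cone {x} = {v. wedge x v = 0 \<and> 0 \<le> wedge v y}"
proof -
  have "v \<in> Cone {x}" if "wedge x v = 0" "0 \<le> wedge v y" for v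
    using wedge_expand [OF assms, of v] that by (auto simp: Cone_single)
  then show ?thesis using assms by (auto simp: Cone_single)
qed

lemma Cone_right:
  assumes "wedge x y = 1"
  shows "Cone {y} = {v. 0 \<le> wedge x v \<and> wedge v y = 0}"
proof -
  have "v \<in> Cone {y}" if "wedge v y = 0" "0 \<le> wedge x v" for v
    using wedge_expand [OF assms, of v] that by (auto simp: Cone_single)
  then show ?thesis using assms by (auto simp: Cone_single)
qed

lemma Cone_ray_face:
  assumes "wedge x y = 1"
  shows "Cone {x} face_of Cone {x, y}" "Cone {y} face_of Cone {x, y}"
proof -
  have *: "Cone {x, y} \<inter> {v. vector [- (x $ 2), x $ 1] \<bullet> v = 0} face_of Cone {x, y}"
    by (rule face_of_Int_supporting_hyperplane_ge [OF convex_convex_cone_hull])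
       (auto simp: Cone_pair [OF assms] wedge_inner [symmetric])
  show "Cone {x} face_of Cone {x, y}"
    using * unfolding wedge_inner [symmetric]
    by (rule back_subst) (auto simp: Cone_pair [OF assms] Cone_left [OF assms])
  have swap: "wedge y v = - wedge v y" for v by (rule wedge_swap)
  have *: "Cone {x, y} \<inter> {v. vector [- (y $ 2), y $ 1] \<bullet> v = 0} face_of Cone {x, y}"
    by (rule face_of_Int_supporting_hyperplane_le [OF convex_convex_cone_hull])
       (auto simp: Cone_pair [OF assms] wedge_inner [symmetric] swap)
  show "Cone {y} face_of Cone {x, y}"
    using * unfolding wedge_inner [symmetric]
    by (rule back_subst) (auto simp: Cone_pair [OF assms] Cone_right [OF assms] swap)
qed

lemma zero_face:
  assumes "wedge x y = 1"
  shows "{0} face_of Cone {x, y}"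
proof -
  have "Cone {x} \<inter> Cone {y} = {0}"
    using assms wedge_eqI [OF assms, of _ 0]
    by (auto simp: Cone_left [OF assms] Cone_right [OF assms])
  then show ?thesis using face_of_Int [OF Cone_ray_face [OF assms]] by simp
qed

text \<open>
  A convex cone inside the plane cone on \<open>x\<close> and \<open>y\<close> that meets both rays outside the origin contains
  an interior point, by addition; so one that misses the interior lies on a single ray.
\<close>

lemma boundary_subcone:
  assumes xy: "wedge x y = 1" and S: "convex_cone S"
    and bd: "\<And>v. v \<in> S \<Longrightarrow> 0 \<le> wedge x v \<and> 0 \<le> wedge v y \<and> \<not> (0 < wedge x v \<and> 0 < wedge v y)"
  shows "S \<in> {{0}, Cone {x}, Cone {y}}"
proof -
  have ray: "Cone {v} \<subseteq> S" if "v \<in> S" for v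
    using that S by (auto simp: hull_minimal)
  have scale: "u \<in> S" if "v \<in> S" "v = c *\<^sub>R u" "0 < c" for u v c
    using convex_cone_scaleR [OF S, of "1/c" v] that by auto
  consider (x) v where "v \<in> S" "0 < wedge v y" | (y) v where "v \<in> S" "0 < wedge x v"
    | (z) "\<And>v. v \<in> S \<Longrightarrow> wedge x v = 0 \<and> wedge v y = 0"
    using bd by fastforce
  then show ?thesis
  proof cases
    case x
    then have "wedge x v = 0" using bd by force
    then have "x \<in> S"
      using wedge_expand [OF xy, of v] x scale [of v "wedge v y" x] by simp
    moreover have "wedge x w = 0" if "w \<in> S" for w
      using bd [OF that] bd [OF convex_cone_add [OF S that \<open>x \<in> S\<close>]] xy by auto
    ultimately have "S = Cone {x}"
      using bd ray [OF \<open>x \<in> S\<close>] by (intro subset_antisym) (auto simp: Cone_left [OF xy])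
    then show ?thesis by simp
  next
    case y
    then have "wedge v y = 0" using bd by force
    then have "y \<in> S"
      using wedge_expand [OF xy, of v] y scale [of v "wedge x v" y] by simp
    moreover have "wedge w y = 0" if "w \<in> S" for w
      using bd [OF that] bd [OF convex_cone_add [OF S that \<open>y \<in> S\<close>]] xy by auto
    ultimately have "S = Cone {y}"
      using bd ray [OF \<open>y \<in> S\<close>]
      by (intro subset_antisym) (auto simp: Cone_right [OF xy])
    then show ?thesis by simp
  next
    case z
    then have "S \<subseteq> {0}" using wedge_eqI [OF xy, of _ 0] by auto
    then show ?thesis using convex_cone_contains_0 [OF S] by auto
  qed
qed

text \<open>
  An interior point \<open>v\<close> is the midpoint of a multiple of \<open>x\<close> and a multiple of \<open>y\<close>, so a face
  containing \<open>v\<close> is the whole cone; any other face is a convex cone in the boundary.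
\<close>

lemma face_of_Cone_pair:
  assumes xy: "wedge x y = 1"
  shows "\<tau> face_of Cone {x, y} \<and> \<tau> \<noteq> {} \<longleftrightarrow> \<tau> \<in> {{0}, Cone {x}, Cone {y}, Cone {x, y}}"
proof
  assume "\<tau> \<in> {{0}, Cone {x}, Cone {y}, Cone {x, y}}"
  then show "\<tau> face_of Cone {x, y} \<and> \<tau> \<noteq> {}"
    using Cone_ray_face [OF xy] zero_face [OF xy] face_of_refl [OF convex_convex_cone_hull]
      convex_cone_hull_nonempty by auto
next
  assume "\<tau> face_of Cone {x, y} \<and> \<tau> \<noteq> {}"
  then have f: "\<tau> face_of Cone {x, y}" and ne: "\<tau> \<noteq> {}" by auto
  have sub: "\<tau> \<subseteq> Cone {x, y}" using f by (rule face_of_imp_subset)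
  have cc: "convex_cone \<tau>"
    using face_of_conic [OF conic_convex_cone_hull f] face_of_imp_convex [OF f] ne
    by (simp add: convex_cone_def)
  show "\<tau> \<in> {{0}, Cone {x}, Cone {y}, Cone {x, y}}"
  proof (cases "\<exists>v\<in>\<tau>. 0 < wedge x v \<and> 0 < wedge v y")
    case True
    then obtain v where v: "v \<in> \<tau>" "0 < wedge x v" "0 < wedge v y" by blast
    let ?a = "(2 * wedge v y) *\<^sub>R x" and ?b = "(2 * wedge x v) *\<^sub>R y"
    have ne: "?a \<noteq> ?b"
    proof
      assume "?a = ?b"
      then have "wedge ?a y = wedge ?b y" by (simp only:)
      then show False using v xy by simp
    qed
    have mid: "v = midpoint ?a ?b"
      using wedge_expand [OF xy, of v] by (simp add: midpoint_def scaleR_add_right)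
    have "midpoint ?a ?b \<in> open_segment ?a ?b" using ne by simp
    then have "v \<in> open_segment ?a ?b" using mid by (rule back_subst [OF _ sym])
    moreover have "?a \<in> Cone {x, y}" "?b \<in> Cone {x, y}"
      using v by (simp_all add: convex_cone_hull_mul hull_inc)
    ultimately have ab: "?a \<in> \<tau>" "?b \<in> \<tau>" using face_ofD [OF f] v(1) by blast+
    have "x \<in> \<tau>" using convex_cone_scaleR [OF cc _ ab(1), of "1 / (2 * wedge v y)"] v by simp
    moreover have "y \<in> \<tau>" using convex_cone_scaleR [OF cc _ ab(2), of "1 / (2 * wedge x v)"] v
      by simp
    ultimately have "Cone {x, y} \<subseteq> \<tau>" using cc by (auto simp: hull_minimal)
    then show ?thesis using sub by auto
  next
    case False
    then show ?thesis
      using boundary_subcone [OF xy cc] sub Cone_pair [OF xy] by blast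
  qed
qed

section \<open>Complete unimodular systems of rays\<close>

text \<open>
  The pairs that span a maximal cone: \<open>y\<close> is the counterclockwise neighbour of \<open>x\<close>.  The condition
  \<open>0 \<le> wedge x g \<and> 0 \<le> wedge g y\<close> is membership of \<open>g\<close> in \<open>Cone {x, y}\<close>, see \<open>Cone_pair\<close>.
\<close>

definition adj :: "(real ^ 2) set \<Rightarrow> real ^ 2 \<Rightarrow> real ^ 2 \<Rightarrow> bool" where
  "adj G x y \<longleftrightarrow> x \<in> G \<and> y \<in> G \<and> wedge x y = 1 \<and>
     (\<forall>g\<in>G. 0 \<le> wedge x g \<and> 0 \<le> wedge g y \<longrightarrow> g = x \<or> g = y)"

definition complete_rays :: "(real ^ 2) set \<Rightarrow> bool" where
  "complete_rays G \<longleftrightarrow> finite G \<and> G \<subseteq> lattice \<and>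
     (\<forall>v. \<exists>x y. adj G x y \<and> 0 \<le> wedge x v \<and> 0 \<le> wedge v y)"

text \<open>
  Defining the cones as the faces of the maximal ones makes the fan closed under taking faces, and
  reduces the intersection axiom to pairs of maximal cones.
\<close>

definition fan_of :: "(real ^ 2) set \<Rightarrow> (real ^ 2) set set" where
  "fan_of G = {\<tau>. \<exists>x y. adj G x y \<and> \<tau> face_of Cone {x, y} \<and> \<tau> \<noteq> {}}"

lemma adjD:
  assumes "adj G x y"
  shows "x \<in> G" "y \<in> G" "wedge x y = 1" "wedge y x = -1"
    "g \<in> G \<Longrightarrow> 0 \<le> wedge x g \<Longrightarrow> 0 \<le> wedge g y \<Longrightarrow> g = x \<or> g = y"
  using assms wedge_swap [of y x] by (auto simp: adj_def)

lemma complete_raysD: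
  assumes "complete_rays G"
  shows "finite G" "g \<in> G \<Longrightarrow> g \<in> lattice"
    "\<exists>x y. adj G x y \<and> 0 \<le> wedge x v \<and> 0 \<le> wedge v y"
  using assms by (auto simp: complete_rays_def)

text \<open>
  Suppose \<open>x' \<noteq> x\<close>.  As the first cone contains no further generator, \<open>x'\<close> lies beyond the ray of \<open>x\<close>,
  seen from \<open>v\<close>.  The second cone does not contain \<open>x\<close>, so \<open>y'\<close> lies beyond this ray as well, but then
  the second cone could not contain \<open>v\<close>.  The argument for \<open>y'\<close> is similar.  The proof works in the coordinates
  \<open>p, q\<close> of \<open>x'\<close> and \<open>r, s\<close> of \<open>y'\<close> with respect to the basis \<open>x, y\<close>.
\<close>

lemma adj_unique:
  assumes xy: "adj G x y" and xy': "adj G x' y'"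
    and v: "0 < wedge x v" "0 < wedge v y" "0 \<le> wedge x' v" "0 \<le> wedge v y'"
  shows "x' = x \<and> y' = y"
proof -
  define al be p q r s where defs: "al = wedge v y" "be = wedge x v" "p = wedge x' y" "q = wedge x x'"
    "r = wedge y' y" "s = wedge x y'"
  have xy1: "wedge x y = 1" using adjD(3) [OF xy] .
  have ev: "v = al *\<^sub>R x + be *\<^sub>R y" and ex': "x' = p *\<^sub>R x + q *\<^sub>R y" and ey': "y' = r *\<^sub>R x + s *\<^sub>R y"
    unfolding defs by (rule wedge_expand [OF xy1])+
  note yx = adjD(4) [OF xy]
  have pos: "0 < al" "0 < be" using v by (auto simp: defs)
  have 1: "0 \<le> p * be - q * al"
    using v(3) unfolding ev ex' by (simp add: xy1 yx algebra_simps)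
  have 2: "0 \<le> al * s - be * r"
    using v(4) unfolding ev ey' by (simp add: xy1 yx algebra_simps)
  have 3: "p * s - q * r = 1"
    using adjD(3) [OF xy'] unfolding ex' ey' by (simp add: xy1 yx algebra_simps)
  \<comment> \<open>If \<open>x'\<close> and \<open>y'\<close> both leave the first cone across the ray of \<open>x\<close>, then comparing their slopes
    with that of \<open>v\<close> makes \<open>wedge x' y'\<close> nonpositive.\<close>
  have neg: "p * s \<le> q * r" if "q < 0" "s < 0"
  proof -
    have "be * (p * s) \<le> al * (q * s)"
      using mult_right_mono_neg [of "q * al" "p * be" s] 1 that by (simp add: algebra_simps)
    also have "\<dots> \<le> be * (q * r)"
      using mult_right_mono_neg [of "be * r" "al * s" q] 2 that by (simp add: algebra_simps)
    finally show ?thesis using pos by simp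
  qed
  have x'y: "x' \<noteq> y" and y'x: "y' \<noteq> x"
    using v yx pos wedge_swap [of y v] wedge_swap [of x v] by (auto simp: defs)
  have q: "x' = x \<or> q < 0"
  proof (rule ccontr)
    assume "\<not> (x' = x \<or> q < 0)"
    then have "0 \<le> q" "p < 0"
      using adjD(5) [OF xy adjD(1) [OF xy']] x'y
      by (simp_all add: defs) (meson not_le)
    then show False using 1 pos mult_neg_pos [of p be] mult_nonneg_nonneg [of q al] by linarith
  qed
  have r: "y' = y \<or> r < 0"
  proof (rule ccontr)
    assume "\<not> (y' = y \<or> r < 0)"
    then have "0 \<le> r" "s < 0"
      using adjD(5) [OF xy adjD(2) [OF xy']] y'x
      by (simp_all add: defs) (meson not_le)
    then show False using 2 pos mult_pos_neg [of al s] mult_nonneg_nonneg [of be r] by linarith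
  qed
  have x: "x' = x"
  proof (rule ccontr)
    assume ne: "x' \<noteq> x"
    then have "q < 0" using q by blast
    moreover have "s < 0"
      using adjD(5) [OF xy' adjD(1) [OF xy]] ne y'x \<open>q < 0\<close> wedge_swap [of x' x]
      by (force simp: defs)
    ultimately show False using neg 3 by linarith
  qed
  moreover have "y' = y"
  proof (rule ccontr)
    assume ne: "y' \<noteq> y"
    then have "r < 0" using r by blast
    then have "y = x' \<or> y = y'"
      using adjD(5) [OF xy' adjD(2) [OF xy]] x xy1 wedge_swap [of y y'] by (auto simp: defs)
    then show False using ne x'y by blast
  qed
  ultimately show ?thesis by blast
qed

text \<open>
  For large \<open>N\<close> the vector \<open>N x + y'\<close> is interior to the first cone and lies in the second.
\<close>

lemma adj_succ_unique:
  assumes "adj G x y" "adj G x y'"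
  shows "y' = y"
proof -
  define N where "N = \<bar>wedge y y'\<bar> + 1"
  have "0 < wedge (N *\<^sub>R x + y') y" "0 < wedge x (N *\<^sub>R x + y')"
    using adjD(3) [OF assms(1)] adjD(3) [OF assms(2)] wedge_swap [of y' y] by (auto simp: N_def)
  moreover have "0 \<le> wedge x (N *\<^sub>R x + y')" "0 \<le> wedge (N *\<^sub>R x + y') y'"
    using adjD(3) [OF assms(2)] by (auto simp: N_def)
  ultimately show ?thesis using adj_unique [OF assms] by blast
qed

lemma adj_pred_unique:
  assumes "adj G x y" "adj G x' y"
  shows "x' = x"
proof -
  define N where "N = \<bar>wedge x x'\<bar> + 1"
  have "0 < wedge (N *\<^sub>R y + x') y" "0 < wedge x (N *\<^sub>R y + x')"
    using adjD(3) [OF assms(1)] adjD(3) [OF assms(2)] by (auto simp: N_def)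
  moreover have "0 \<le> wedge x' (N *\<^sub>R y + x')" "0 \<le> wedge (N *\<^sub>R y + x') y"
    using adjD(3) [OF assms(2)] by (auto simp: N_def)
  ultimately show ?thesis using adj_unique [OF assms] by blast
qed

text \<open>
  The vector \<open>N g + w\<close> with \<open>N\<close> large lies in a cone that contains \<open>g\<close>.  Taking for \<open>w\<close> the negative
  of a known neighbour forces this cone to be on the other side of \<open>g\<close>.
\<close>

lemma adj_exists:
  assumes G: "complete_rays G" and g: "g \<in> G"
  shows "\<exists>p s. adj G p g \<and> adj G g s"
proof -
  have in_ray: "g = x \<or> g = y" if "adj G x y" "0 \<le> wedge x g" "0 \<le> wedge g y" for x y
    using adjD(5) [OF that(1) g] that by blast
  have near: "\<exists>x y. adj G x y \<and> (g = x \<or> g = y) \<and> 0 \<le> wedge x (N *\<^sub>R g + w) \<and> 0 \<le> wedge (N *\<^sub>R g + w) y"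
    if N: "N = (\<Sum>h\<in>G. \<bar>wedge h w\<bar>) + 1" for w N
  proof -
    obtain x y where xy: "adj G x y" and c: "0 \<le> wedge x (N *\<^sub>R g + w)" "0 \<le> wedge (N *\<^sub>R g + w) y"
      using complete_raysD(3) [OF G] by blast
    have small: "\<bar>wedge h w\<bar> < N" if "h \<in> G" for h
      using member_le_sum [OF that, of "\<lambda>h. \<bar>wedge h w\<bar>"] complete_raysD(1) [OF G]
      by (simp add: N)
    then have "0 < N" using g abs_ge_zero order_le_less_trans by blast
    \<comment> \<open>Since \<open>a\<close> is an integer, a negative value contributes at most \<open>-N\<close>, which \<open>b\<close> cannot offset.\<close>
    have nonneg: "0 \<le> a" if "a \<in> \<int>" "0 \<le> N * a + b" "\<bar>b\<bar> < N" for a b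
    proof (rule ccontr)
      assume "\<not> 0 \<le> a"
      then have "a \<le> -1" using Ints_pos [of "- a"] that(1) by simp
      then have "N * a \<le> N * -1" using \<open>0 < N\<close> by (intro mult_left_mono) auto
      then show False using that by linarith
    qed
    have "0 \<le> wedge x g" "0 \<le> wedge g y"
      using nonneg [of "wedge x g" "wedge x w"] nonneg [of "wedge g y" "wedge w y"] c small
        adjD(1,2) [OF xy] wedge_lattice complete_raysD(2) [OF G] g wedge_swap [of w y]
      by auto
    then show ?thesis using xy c in_ray by blast
  qed
  obtain x y where xy: "adj G x y" "g = x \<or> g = y"
    using complete_raysD(3) [OF G, of g] in_ray by blast
  from xy(2) show ?thesis
  proof
    assume "g = x"
    define N where "N = (\<Sum>h\<in>G. \<bar>wedge h (- y)\<bar>) + 1"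
    obtain x' y' where x'y': "adj G x' y'" "g = x' \<or> g = y'" "0 \<le> wedge x' (N *\<^sub>R g + - y)"
      using near [OF N_def] by blast
    then show ?thesis using xy \<open>g = x\<close> adjD(3) [OF xy(1)] by auto
  next
    assume "g = y"
    define N where "N = (\<Sum>h\<in>G. \<bar>wedge h (- x)\<bar>) + 1"
    obtain x' y' where x'y': "adj G x' y'" "g = x' \<or> g = y'" "0 \<le> wedge (N *\<^sub>R g + - x) y'"
      using near [OF N_def] by blast
    then show ?thesis using xy \<open>g = y\<close> adjD(3) [OF xy(1)] by auto
  qed
qed

text \<open>
  The coefficient \<open>wedge p s\<close> is minus the self-intersection number of the curve of the ray of \<open>v\<close>.
\<close>

lemma adj_sum:
  assumes "adj G p v" "adj G v s"
  shows "p + s = wedge p s *\<^sub>R v"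
  using wedge_expand [OF adjD(3) [OF assms(1)], of s] adjD(4) [OF assms(2)]
  by (simp add: eq_diff_eq add.commute)

lemma adj_primitive:
  assumes "complete_rays G" "g \<in> G"
  shows "primitive_vector g"
proof -
  obtain s where "adj G g s" using adj_exists [OF assms] by blast
  then show ?thesis
    using primitive_of_wedge_one [of g s] adjD complete_raysD(2) [OF assms(1)] by auto
qed

section \<open>Complete ray systems and complete nonsingular fans\<close>

lemma lattice_basis_pair:
  assumes "x \<in> lattice" "y \<in> lattice" "wedge x y = 1"
  shows "lattice_basis {x, y}"
  unfolding lattice_basis_def
proof
  have ne: "x \<noteq> y" using assms(3) by auto
  have "x \<notin> span {y}"
    using assms(3) by (auto simp: span_singleton)
  moreover have "y \<noteq> 0" using assms(3) by auto
  ultimately show "independent {x, y}" using ne by (simp add: independent_insert)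
  show "lattice = {\<Sum>b\<in>{x, y}. of_int (c b) *\<^sub>R b | c :: real ^ 2 \<Rightarrow> int. True}"
  proof (intro subset_antisym subsetI)
    fix v :: "real ^ 2" assume v: "v \<in> lattice"
    obtain i j where ij: "wedge v y = of_int i" "wedge x v = of_int j"
      using wedge_lattice [OF v assms(2)] wedge_lattice [OF assms(1) v] by (auto elim!: Ints_cases)
    define c where "c b = (if b = x then i else j)" for b
    have "v = (\<Sum>b\<in>{x, y}. of_int (c b) *\<^sub>R b)"
      using wedge_expand [OF assms(3), of v] ne ij by (simp add: c_def)
    then show "v \<in> {\<Sum>b\<in>{x, y}. of_int (c b) *\<^sub>R b | c :: real ^ 2 \<Rightarrow> int. True}" by blast
  next
    fix v assume "v \<in> {\<Sum>b\<in>{x, y}. of_int (c b) *\<^sub>R b | c :: real ^ 2 \<Rightarrow> int. True}"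
    then show "v \<in> lattice"
      using assms(1,2) ne by (auto intro!: lattice_add lattice_scale)
  qed
qed

lemma dim_Cone_pair:
  assumes "wedge x y = 1" shows "dim (Cone {x, y}) = 2"
proof -
  have "v \<in> span (Cone {x, y})" for v
    using wedge_expand [OF assms, of v]
    by (metis hull_inc insertI1 insertI2 span_add span_base span_scale)
  then have "span (Cone {x, y}) = UNIV" by auto
  then have "dim (Cone {x, y}) = dim (UNIV :: (real ^ 2) set)" by (metis dim_span)
  then show ?thesis by simp
qed

lemma dim_Cone_single:
  assumes "x \<noteq> 0" shows "dim (Cone {x}) = 1"
proof -
  have "Cone {x} \<subseteq> span {x}"
    by (auto simp: Cone_single span_singleton)
  moreover have "{x} \<subseteq> span (Cone {x})"
    by (simp add: span_base hull_inc)
  ultimately have "span (Cone {x}) = span {x}"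
    by (simp add: span_eq)
  then show ?thesis using assms by (metis dim_span dim_singleton)
qed

lemma Cone_pair_inject:
  assumes "adj G x y" "adj G x' y'" "Cone {x, y} \<subseteq> Cone {x', y'}"
  shows "x' = x \<and> y' = y"
proof -
  have "x + y \<in> Cone {x, y}" by (intro convex_cone_hull_add hull_inc) auto
  then have "x + y \<in> Cone {x', y'}" using assms(3) by (rule subsetD [rotated])
  then have "0 \<le> wedge x' (x + y)" "0 \<le> wedge (x + y) y'"
    unfolding Cone_pair [OF adjD(3) [OF assms(2)]] by simp_all
  moreover have "0 < wedge x (x + y)" "0 < wedge (x + y) y"
    using adjD(3) [OF assms(1)] by simp_all
  ultimately show ?thesis by (intro adj_unique [OF assms(1,2)])
qed

text \<open>
  By \<open>adj_unique\<close> two different maximal cones meet in the boundary of the first, where the only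
  convex cones are faces.
\<close>

lemma adj_cone_Int_face:
  assumes xy: "adj G x y" and x'y': "adj G x' y'"
  shows "Cone {x, y} \<inter> Cone {x', y'} face_of Cone {x, y}"
proof (cases "x' = x \<and> y' = y")
  case True
  then show ?thesis by (simp add: face_of_refl convex_convex_cone_hull)
next
  case False
  note C = Cone_pair [OF adjD(3) [OF xy]] and C' = Cone_pair [OF adjD(3) [OF x'y']]
  have "convex_cone (\<Inter>{Cone {x, y}, Cone {x', y'}})"
    by (rule convex_cone_Inter) (auto simp: convex_cone_convex_cone_hull)
  then have "convex_cone (Cone {x, y} \<inter> Cone {x', y'})" by simp
  moreover have "\<not> (0 < wedge x v \<and> 0 < wedge v y)" if "v \<in> Cone {x, y} \<inter> Cone {x', y'}" for v
    using adj_unique [OF xy x'y', of v] that False unfolding C' by blast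
  moreover have "0 \<le> wedge x v \<and> 0 \<le> wedge v y" if "v \<in> Cone {x, y} \<inter> Cone {x', y'}" for v
    using that unfolding C by blast
  ultimately have "Cone {x, y} \<inter> Cone {x', y'} \<in> {{0}, Cone {x}, Cone {y}}"
    by (intro boundary_subcone [OF adjD(3) [OF xy]]) blast+
  then have "Cone {x, y} \<inter> Cone {x', y'} \<in> {{0}, Cone {x}, Cone {y}, Cone {x, y}}" by auto
  then show ?thesis
    by (rule face_of_Cone_pair [OF adjD(3) [OF xy], THEN iffD2, THEN conjunct1])
qed

lemma fan_of_explicit:
  "\<tau> \<in> fan_of G \<longleftrightarrow> (\<exists>x y. adj G x y \<and> \<tau> \<in> {{0}, Cone {x}, Cone {y}, Cone {x, y}})"
  unfolding fan_of_def mem_Collect_eq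
  by (intro ex_cong1 conj_cong refl face_of_Cone_pair) (rule adjD(3))

lemma fan_ofI: "adj G x y \<Longrightarrow> \<tau> \<in> {{0}, Cone {x}, Cone {y}, Cone {x, y}} \<Longrightarrow> \<tau> \<in> fan_of G"
  unfolding fan_of_explicit by (intro exI conjI)

text \<open>
  For faces \<open>\<sigma>\<close> of \<open>M\<close> and \<open>\<sigma>'\<close> of \<open>M'\<close> one has \<open>\<sigma> \<inter> \<sigma>' = \<sigma> \<inter> (\<sigma>' \<inter> (M' \<inter> M))\<close>, and the inner
  intersection is a face of \<open>M' \<inter> M\<close>, hence of \<open>M\<close>.
\<close>

lemma fan_of_Int_face:
  assumes "\<sigma> \<in> fan_of G" "\<sigma>' \<in> fan_of G"
  shows "\<sigma> \<inter> \<sigma>' face_of \<sigma>"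
proof -
  obtain x y where xy: "adj G x y" "\<sigma> face_of Cone {x, y}" using assms(1)
    by (auto simp: fan_of_def)
  obtain x' y' where x'y': "adj G x' y'" "\<sigma>' face_of Cone {x', y'}" using assms(2)
    by (auto simp: fan_of_def)
  let ?M = "Cone {x, y}" and ?M' = "Cone {x', y'}"
  have "\<sigma>' \<inter> (?M' \<inter> ?M) face_of ?M'"
    using face_of_Int [OF x'y'(2) adj_cone_Int_face [OF x'y'(1) xy(1)]] .
  then have "\<sigma>' \<inter> (?M' \<inter> ?M) face_of (?M \<inter> ?M')"
    by (rule face_of_subset) auto
  also have "?M \<inter> ?M' face_of ?M" by (rule adj_cone_Int_face) fact+
  finally have "\<sigma> \<inter> (\<sigma>' \<inter> (?M' \<inter> ?M)) face_of ?M"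
    using face_of_Int [OF xy(2)] by blast
  moreover have "\<sigma> \<inter> (\<sigma>' \<inter> (?M' \<inter> ?M)) = \<sigma> \<inter> \<sigma>'"
    using face_of_imp_subset [OF xy(2)] face_of_imp_subset [OF x'y'(2)] by blast
  ultimately have "\<sigma> \<inter> \<sigma>' face_of ?M" by simp
  then show ?thesis
    by (rule face_of_subset) (use face_of_imp_subset [OF xy(2)] in auto)
qed

lemma fan_of_cone_shape:
  assumes "complete_rays G" "\<sigma> \<in> fan_of G"
  shows "\<exists>B A. lattice_basis B \<and> finite A \<and> A \<subseteq> lattice \<and> A \<subseteq> B \<and> \<sigma> = Cone A"
proof -
  obtain x y where xy: "adj G x y" and \<sigma>: "\<sigma> \<in> {{0}, Cone {x}, Cone {y}, Cone {x, y}}"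
    using assms(2) by (auto simp: fan_of_explicit)
  have "\<exists>A\<subseteq>{x, y}. \<sigma> = Cone A"
    using \<sigma>
  proof (elim insertE emptyE)
    assume "\<sigma> = {0}"
    then show ?thesis by (intro exI [of _ "{}"]) (simp add: convex_cone_hull_empty)
  qed (rule exI, rule conjI [rotated], assumption, simp)+
  then obtain A where A: "A \<subseteq> {x, y}" "\<sigma> = Cone A" by blast
  have l: "x \<in> lattice" "y \<in> lattice" using adjD(1,2) [OF xy] complete_raysD(2) [OF assms(1)]
    by auto
  then have "A \<subseteq> lattice" "finite A" using A(1) by (auto intro: finite_subset)
  then show ?thesis
    using lattice_basis_pair [OF l adjD(3) [OF xy]] A by (intro exI conjI)
qed

lemma fan_of_strongly_convex:
  assumes "\<sigma> \<in> fan_of G"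
  shows "strongly_convex_cone \<sigma>"
proof -
  obtain x y where xy: "adj G x y" and \<sigma>: "\<sigma> face_of Cone {x, y}" "\<sigma> \<noteq> {}"
    using assms by (auto simp: fan_of_def)
  have "0 \<in> \<sigma>"
    using \<sigma> face_of_Cone_pair [OF adjD(3) [OF xy], of \<sigma>] convex_cone_hull_contains_0
    by auto
  moreover have "v = 0" if "v \<in> \<sigma>" "- v \<in> \<sigma>" for v
    using that face_of_imp_subset [OF \<sigma>(1)] Cone_pair [OF adjD(3) [OF xy]]
    by (intro wedge_eqI [OF adjD(3) [OF xy]]) force+
  ultimately show ?thesis unfolding strongly_convex_cone_def by force
qed

lemma finite_fan_of:
  assumes "finite G" shows "finite (fan_of G)"
proof -
  have "fan_of G \<subseteq> (\<lambda>A. Cone A) ` Pow G"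
  proof
    fix \<tau> assume "\<tau> \<in> fan_of G"
    then obtain x y where "adj G x y" "\<tau> \<in> {{0}, Cone {x}, Cone {y}, Cone {x, y}}"
      by (auto simp: fan_of_explicit)
    then have "{} \<in> Pow G" "{x} \<in> Pow G" "{y} \<in> Pow G" "{x, y} \<in> Pow G" and
      "\<tau> \<in> {Cone {}, Cone {x}, Cone {y}, Cone {x, y}}" by (auto dest: adjD)
    then show "\<tau> \<in> (\<lambda>A. Cone A) ` Pow G" by blast
  qed
  then show ?thesis using assms finite_subset by blast
qed

lemma fan_fan_of:
  assumes G: "complete_rays G"
  shows "fan (fan_of G)"
  unfolding fan_def
proof (intro conjI ballI allI impI)
  show "finite (fan_of G)" using finite_fan_of complete_raysD(1) [OF G] by blast
  obtain x y where "adj G x y" using complete_raysD(3) [OF G] by blast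
  then have "{0} \<in> fan_of G" by (auto simp: fan_of_explicit)
  then show "fan_of G \<noteq> {}" by blast
  fix \<sigma> assume \<sigma>: "\<sigma> \<in> fan_of G"
  show "rational_polyhedral_cone \<sigma>"
    using fan_of_cone_shape [OF G \<sigma>] by (auto simp: rational_polyhedral_cone_def)
  show "strongly_convex_cone \<sigma>" by (rule fan_of_strongly_convex) fact
  show "\<tau> \<in> fan_of G" if "\<tau> face_of \<sigma> \<and> \<tau> \<noteq> {}" for \<tau>
    using \<sigma> that unfolding fan_of_def by (blast intro: face_of_trans)
  fix \<sigma>' assume \<sigma>': "\<sigma>' \<in> fan_of G"
  show "\<sigma> \<inter> \<sigma>' face_of \<sigma>" "\<sigma> \<inter> \<sigma>' face_of \<sigma>'"
    using fan_of_Int_face \<sigma> \<sigma>' by (metis Int_commute)+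
qed

lemma nonsingular_fan_of: "complete_rays G \<Longrightarrow> nonsingular_fan (fan_of G)"
  using fan_fan_of fan_of_cone_shape unfolding nonsingular_fan_def by blast

lemma complete_fan_of:
  assumes "complete_rays G" shows "complete_fan (fan_of G)"
proof -
  have "v \<in> \<Union> (fan_of G)" for v
  proof -
    obtain x y where "adj G x y" "0 \<le> wedge x v" "0 \<le> wedge v y"
      using complete_raysD(3) [OF assms] by blast
    then have "Cone {x, y} \<in> fan_of G" "v \<in> Cone {x, y}"
      using Cone_pair [of x y] adjD(3) [of G x y] by (auto simp: fan_of_explicit)
    then show ?thesis by blast
  qed
  then show ?thesis using fan_fan_of [OF assms] by (auto simp: complete_fan_def)
qed

lemma primitive_on_ray:
  assumes "primitive_vector u" "v \<in> lattice" "w \<in> lattice" "\<bar>wedge v w\<bar> = 1" "u \<in> Cone {v}"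
  shows "u = v"
proof -
  obtain c where c: "u = c *\<^sub>R v" "0 \<le> c" using assms(5) by (auto simp: Cone_single)
  have "wedge u w \<in> \<int>" using assms wedge_lattice by (auto simp: primitive_vector_def)
  then have "c \<in> \<int>" using assms(4) c(1)
    by (cases "wedge v w = 1") (auto simp: abs_if split: if_splits)
  then obtain k where "c = real k" using c(2)
    by (metis Ints_cases of_int_0_le_iff zero_le_imp_eq_int of_int_of_nat_eq)
  then show ?thesis using assms(1,2) c unfolding primitive_vector_def by auto
qed

lemma gens_fan_of:
  assumes G: "complete_rays G"
  shows "gens (fan_of G) = G"
proof
  show "G \<subseteq> gens (fan_of G)"
  proof
    fix g assume g: "g \<in> G"
    then obtain s where "adj G g s" using adj_exists [OF G] by blast
    then show "g \<in> gens (fan_of G)"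
      using adj_primitive [OF G g] by (auto simp: gens_def fan_of_explicit)
  qed
  show "gens (fan_of G) \<subseteq> G"
  proof
    fix g assume "g \<in> gens (fan_of G)"
    then obtain x y where g: "primitive_vector g" and xy: "adj G x y"
      and C: "Cone {g} \<in> {{0}, Cone {x}, Cone {y}, Cone {x, y}}"
      by (auto simp: gens_def fan_of_explicit)
    have g0: "g \<noteq> 0" using g by (simp add: primitive_vector_def)
    have "dim (Cone {g}) = 1" "dim (Cone {x, y}) = 2" "dim {0::real^2} = 0"
      using dim_Cone_single [OF g0] dim_Cone_pair [OF adjD(3) [OF xy]] by auto
    then have "Cone {g} = Cone {x} \<or> Cone {g} = Cone {y}" using C by force
    then have "g \<in> Cone {x} \<or> g \<in> Cone {y}" using hull_inc [of g "{g}"] by auto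
    then have "g = x \<or> g = y"
      using primitive_on_ray [OF g, of x y] primitive_on_ray [OF g, of y x]
        adjD [OF xy] complete_raysD(2) [OF G] by auto
    then show "g \<in> G" using adjD(1,2) [OF xy] by blast
  qed
qed

text \<open>
  Writing the standard basis in terms of \<open>B\<close> turns \<open>wedge (axis 1 1) (axis 2 1) = 1\<close> into an equation
  \<open>k n = 1\<close> between integers, where \<open>n\<close> is the determinant of \<open>B\<close>.
\<close>

lemma lattice_basis_unimodular:
  fixes B :: "(real ^ 2) set"
  assumes "lattice_basis B"
  shows "\<exists>x y. B = {x, y} \<and> x \<in> lattice \<and> y \<in> lattice \<and> wedge x y = 1"
proof -
  have ind: "independent B"
    and eq: "lattice = {\<Sum>b\<in>B. of_int (c b) *\<^sub>R b | c :: real ^ 2 \<Rightarrow> int. True}"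
    using assms by (auto simp: lattice_basis_def)
  have fin: "finite B" using ind by (rule finiteI_independent)
  have comb: "\<exists>c :: real ^ 2 \<Rightarrow> int. v = (\<Sum>b\<in>B. of_int (c b) *\<^sub>R b)" if "v \<in> lattice" for v
    using that unfolding eq by blast
  have BL: "b \<in> lattice" if "b \<in> B" for b
  proof -
    have "b = (\<Sum>b'\<in>B. of_int (if b' = b then 1 else 0) *\<^sub>R b')"
      using that fin by (simp add: if_distrib [of of_int] if_distrib [of "\<lambda>r. r *\<^sub>R _"] cong: if_cong)
    then have "\<exists>c :: real ^ 2 \<Rightarrow> int. b = (\<Sum>b'\<in>B. of_int (c b') *\<^sub>R b')"
      by (rule exI [of _ "\<lambda>b'. if b' = b then 1 else 0"])
    then show ?thesis unfolding eq by blast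
  qed
  have ax: "axis 1 1 \<in> lattice" "axis 2 1 \<in> (lattice :: (real ^ 2) set)"
    by (auto simp: lattice_def axis_def)
  obtain c1 c2 where
    c1: "(axis 1 1 :: real ^ 2) = (\<Sum>b\<in>B. of_int (c1 b :: int) *\<^sub>R b)" and
    c2: "(axis 2 1 :: real ^ 2) = (\<Sum>b\<in>B. of_int (c2 b :: int) *\<^sub>R b)"
    using comb [OF ax(1)] comb [OF ax(2)] by blast
  have "axis 1 1 \<in> span B" "axis 2 1 \<in> span B"
    unfolding c1 c2 by (auto intro: span_sum span_scale span_base)
  then have "v $ 1 *\<^sub>R axis 1 1 + v $ 2 *\<^sub>R axis 2 1 \<in> span B" for v
    by (intro span_add span_scale)
  moreover have "v $ 1 *\<^sub>R axis 1 1 + v $ 2 *\<^sub>R axis 2 1 = v" for v :: "real ^ 2"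
    by (simp add: vec_eq_iff forall_2 axis_def)
  ultimately have "span B = UNIV" by (metis UNIV_eq_I)
  then have "card B = 2" using dim_eq_card [OF _ ind, of UNIV] by simp
  then obtain b1 b2 where B: "B = {b1, b2}" "b1 \<noteq> b2" by (auto simp: card_2_iff)
  define k where "k = c1 b1 * c2 b2 - c1 b2 * c2 b1"
  obtain n where n: "wedge b1 b2 = of_int n"
    using wedge_lattice [OF BL BL] B by (auto elim!: Ints_cases)
  have "wedge (axis 1 1) (axis 2 1) = 1" by (simp add: wedge_def axis_def)
  then have "real_of_int (k * n) = of_int 1"
    unfolding c1 c2 using B wedge_swap [of b2 b1] n by (simp add: k_def algebra_simps)
  then have "k * n = 1" by (simp only: of_int_eq_iff)
  then have "n = 1 \<or> n = -1" by (metis zmult_eq_1_iff)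
  then show ?thesis
  proof
    assume "n = 1"
    then show ?thesis using n B BL by (intro exI [of _ b1] exI [of _ b2]) auto
  next
    assume "n = -1"
    then show ?thesis using n B BL wedge_swap [of b2 b1] by (intro exI [of _ b2] exI [of _ b1]) auto
  qed
qed

lemma nonsingular_cone_shape:
  fixes \<Delta> :: "(real ^ 2) set set"
  assumes "nonsingular_fan \<Delta>" "\<sigma> \<in> \<Delta>"
  shows "\<exists>x y. x \<in> lattice \<and> y \<in> lattice \<and> wedge x y = 1 \<and> \<sigma> \<in> {{0}, Cone {x}, Cone {y}, Cone {x, y}}"
proof -
  obtain B A where BA: "lattice_basis B" "A \<subseteq> B" "\<sigma> = Cone A"
    using assms by (auto simp: nonsingular_fan_def)
  obtain x y where xy: "B = {x, y}" "x \<in> lattice" "y \<in> lattice" "wedge x y = 1"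
    using lattice_basis_unimodular [OF BA(1)] by blast
  have "A = {} \<or> A = {x} \<or> A = {y} \<or> A = {x, y}" using BA(2) xy(1) by blast
  then have "\<sigma> \<in> {{0}, Cone {x}, Cone {y}, Cone {x, y}}" unfolding BA(3) by auto
  then show ?thesis using xy by blast
qed

text \<open>
  A ray of the fan that lies in \<open>Cone {x, y}\<close> is its own intersection with that cone and thus one of
  its faces.
\<close>

lemma adj_of_fan_cone:
  fixes \<Delta> :: "(real ^ 2) set set"
  assumes \<Delta>: "nonsingular_fan \<Delta>" and xy: "x \<in> lattice" "y \<in> lattice" "wedge x y = 1"
    and C: "Cone {x, y} \<in> \<Delta>"
  shows "adj (gens \<Delta>) x y"
proof -
  have fan: "fan \<Delta>" using \<Delta> by (simp add: nonsingular_fan_def)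
  have yx: "wedge y x = -1" using wedge_swap [of y x] xy(3) by simp
  have faces: "\<tau> \<in> \<Delta>" if "\<tau> \<in> {{0}, Cone {x}, Cone {y}, Cone {x, y}}" for \<tau>
    using that C fan face_of_Cone_pair [OF xy(3), of \<tau>] unfolding fan_def by blast
  have prim: "primitive_vector x" "primitive_vector y"
    using primitive_of_wedge_one xy yx by auto
  have "g = x \<or> g = y" if g: "g \<in> gens \<Delta>" "0 \<le> wedge x g" "0 \<le> wedge g y" for g
  proof -
    have gp: "primitive_vector g" "Cone {g} \<in> \<Delta>" using g by (auto simp: gens_def)
    have g0: "g \<noteq> 0" using gp by (simp add: primitive_vector_def)
    have "g \<in> Cone {x, y}" using g Cone_pair [OF xy(3)] by auto
    then have "Cone {g} \<subseteq> Cone {x, y}"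
      by (simp add: hull_minimal convex_cone_convex_cone_hull)
    then have "Cone {g} \<inter> Cone {x, y} = Cone {g}" by blast
    moreover have "Cone {g} \<inter> Cone {x, y} face_of Cone {x, y}"
      using fan gp(2) C unfolding fan_def by blast
    ultimately have "Cone {g} face_of Cone {x, y} \<and> Cone {g} \<noteq> {}"
      using convex_cone_hull_nonempty by metis
    then have "Cone {g} \<in> {{0}, Cone {x}, Cone {y}, Cone {x, y}}"
      unfolding face_of_Cone_pair [OF xy(3)] .
    moreover have "dim (Cone {g}) = 1" "dim (Cone {x, y}) = 2" "dim {0::real^2} = 0"
      using dim_Cone_single [OF g0] dim_Cone_pair [OF xy(3)] by auto
    ultimately have "Cone {g} = Cone {x} \<or> Cone {g} = Cone {y}" by force
    then have "g \<in> Cone {x} \<or> g \<in> Cone {y}" using hull_inc [of g "{g}"] by auto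
    then show ?thesis
      using primitive_on_ray [OF gp(1), of x y] primitive_on_ray [OF gp(1), of y x] xy yx by auto
  qed
  then show ?thesis using prim faces xy(3) by (auto simp: adj_def gens_def)
qed

text \<open>
  The complement of the union of the two-dimensional cones is open, and it is contained in finitely
  many cones of lower dimension, which form a null set; so it is empty.
\<close>

lemma fan_two_dim_cover:
  fixes \<Delta> :: "(real ^ 2) set set"
  assumes \<Delta>: "nonsingular_fan \<Delta>" "complete_fan \<Delta>"
  shows "\<exists>x y. x \<in> lattice \<and> y \<in> lattice \<and> wedge x y = 1 \<and> Cone {x, y} \<in> \<Delta> \<and> v \<in> Cone {x, y}"
proof -
  define T where "T = {\<sigma>\<in>\<Delta>. dim \<sigma> = 2}"
  define R where "R = {\<sigma>\<in>\<Delta>. dim \<sigma> \<noteq> 2}"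
  have fin: "finite \<Delta>" using \<Delta>(2) by (simp add: complete_fan_def fan_def)
  have shape: "\<exists>x y. x \<in> lattice \<and> y \<in> lattice \<and> wedge x y = 1 \<and>
      (\<sigma> = Cone {x, y} \<and> dim \<sigma> = 2 \<or> closed \<sigma> \<and> dim \<sigma> < 2)" if "\<sigma> \<in> \<Delta>" for \<sigma>
  proof -
    obtain x y where xy: "x \<in> lattice" "y \<in> lattice" "wedge x y = 1"
      "\<sigma> \<in> {{0}, Cone {x}, Cone {y}, Cone {x, y}}"
      using nonsingular_cone_shape [OF \<Delta>(1) \<open>\<sigma> \<in> \<Delta>\<close>] by blast
    then have "x \<noteq> 0" "y \<noteq> 0" by auto
    then have "dim (Cone {x}) = 1 \<and> dim (Cone {y}) = 1" by (intro conjI dim_Cone_single)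
    moreover have "closed (Cone {x})" "closed (Cone {y})"
      by (simp_all add: closed_convex_cone_hull)
    ultimately have "\<sigma> = Cone {x, y} \<and> dim \<sigma> = 2 \<or> closed \<sigma> \<and> dim \<sigma> < 2"
      using xy(4) dim_Cone_pair [OF xy(3)] by (elim insertE emptyE) simp_all
    then show ?thesis using xy by blast
  qed
  have closed: "closed (\<Union>T)"
  proof (rule closed_Union)
    show "finite T" using fin by (simp add: T_def)
    show "\<forall>\<sigma>\<in>T. closed \<sigma>"
    proof
      fix \<sigma> assume "\<sigma> \<in> T"
      then obtain x y where "\<sigma> = Cone {x, y}" using shape [of \<sigma>] by (auto simp: T_def)
      then show "closed \<sigma>" by (simp add: closed_convex_cone_hull)
    qed
  qed
  have negl: "negligible (\<Union>R)"
  proof (rule negligible_Union)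
    show "finite R" using fin by (simp add: R_def)
    fix \<sigma> assume "\<sigma> \<in> R"
    then have "dim \<sigma> < 2" using shape [of \<sigma>] by (auto simp: R_def)
    then show "negligible \<sigma>" by (intro negligible_lowdim) simp
  qed
  have "\<Union>\<Delta> = UNIV" "\<Delta> = T \<union> R"
    using \<Delta>(2) by (auto simp: T_def R_def complete_fan_def)
  then have "- \<Union>T \<subseteq> \<Union>R" by (metis Union_Un_distrib sup_shunt)
  then have "negligible (- \<Union>T)" using negl negligible_subset by blast
  then have "- \<Union>T = {}" using open_not_negligible closed by (metis open_Compl)
  then obtain \<sigma> where "\<sigma> \<in> \<Delta>" "dim \<sigma> = 2" "v \<in> \<sigma>"
    by (auto simp: T_def)
  then show ?thesis using shape [of \<sigma>] by auto
qed

theorem complete_nonsingular_fan_is_fan_of: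
  fixes \<Delta> :: "(real ^ 2) set set"
  assumes \<Delta>: "nonsingular_fan \<Delta>" "complete_fan \<Delta>"
  shows "complete_rays (gens \<Delta>)" "\<Delta> = fan_of (gens \<Delta>)"
proof -
  let ?G = "gens \<Delta>"
  have fan: "fan \<Delta>" using \<Delta> by (simp add: nonsingular_fan_def)
  have cover: "\<exists>x y. adj ?G x y \<and> Cone {x, y} \<in> \<Delta> \<and> 0 \<le> wedge x v \<and> 0 \<le> wedge v y" for v
  proof -
    obtain x y where xy: "x \<in> lattice" "y \<in> lattice" "wedge x y = 1" "Cone {x, y} \<in> \<Delta>" "v \<in> Cone {x, y}"
      using fan_two_dim_cover [OF \<Delta>] by blast
    have "adj ?G x y" by (rule adj_of_fan_cone [OF \<Delta>(1) xy(1-4)])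
    moreover have "0 \<le> wedge x v" "0 \<le> wedge v y"
      using xy(5) unfolding Cone_pair [OF xy(3)] by simp_all
    ultimately show ?thesis using xy(4) by blast
  qed
  have "inj_on (\<lambda>x. Cone {x}) ?G"
  proof (rule inj_onI)
    fix g h assume g: "g \<in> ?G" and h: "h \<in> ?G" and eq: "Cone {g} = Cone {h}"
    obtain x y where xy: "adj ?G x y" "0 \<le> wedge x g" "0 \<le> wedge g y" using cover [of g] by blast
    have L: "x \<in> lattice" "y \<in> lattice" using adjD(1,2) [OF xy(1)]
      by (auto simp: gens_def primitive_vector_def)
    have "g = x \<or> g = y" using adjD(5) [OF xy(1) g] xy by blast
    moreover have "h \<in> Cone {g}" using eq hull_inc [of h "{h}"] by auto
    moreover have "primitive_vector h" using h by (simp add: gens_def)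
    ultimately show "g = h"
      using primitive_on_ray [of h x y] primitive_on_ray [of h y x] L adjD(3,4) [OF xy(1)] by auto
  qed
  moreover have "(\<lambda>x. Cone {x}) ` ?G \<subseteq> \<Delta>" by (auto simp: gens_def)
  ultimately have fin: "finite ?G"
    using fan finite_imageD finite_subset unfolding fan_def by metis
  have sub: "?G \<subseteq> lattice" by (auto simp: gens_def primitive_vector_def)
  show G: "complete_rays ?G"
    unfolding complete_rays_def using cover fin sub by blast
  show "\<Delta> = fan_of ?G"
  proof
    show "\<Delta> \<subseteq> fan_of ?G"
    proof
      fix \<sigma> assume \<sigma>: "\<sigma> \<in> \<Delta>"
      obtain x y where xy: "x \<in> lattice" "y \<in> lattice" "wedge x y = 1"
        "\<sigma> \<in> {{0}, Cone {x}, Cone {y}, Cone {x, y}}"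
        using nonsingular_cone_shape [OF \<Delta>(1) \<sigma>] by blast
      have yx: "wedge y x = -1" using wedge_swap [of y x] xy(3) by simp
      have ray: "Cone {g} \<in> fan_of ?G" if "primitive_vector g" "Cone {g} \<in> \<Delta>" for g
      proof -
        have "g \<in> ?G" using that by (simp add: gens_def)
        then obtain s where "adj ?G g s" using adj_exists [OF G] by blast
        then show ?thesis by (auto simp: fan_of_explicit)
      qed
      have prim: "primitive_vector x" "primitive_vector y"
        using primitive_of_wedge_one xy yx by auto
      have "\<exists>x y. adj ?G x y" using cover [of 0] by blast
      then have zero: "{0} \<in> fan_of ?G" by (auto simp: fan_of_explicit)
      have two: "Cone {x, y} \<in> fan_of ?G" if "\<sigma> = Cone {x, y}"
        using adj_of_fan_cone [OF \<Delta>(1) xy(1-3)] \<sigma> that by (auto simp: fan_of_explicit)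
      from xy(4) show "\<sigma> \<in> fan_of ?G"
        using ray [OF prim(1)] ray [OF prim(2)] zero two \<sigma> by auto
    qed
    show "fan_of ?G \<subseteq> \<Delta>"
    proof
      fix \<tau> assume "\<tau> \<in> fan_of ?G"
      then obtain x y where xy: "adj ?G x y" and \<tau>: "\<tau> face_of Cone {x, y}" "\<tau> \<noteq> {}"
        by (auto simp: fan_of_def)
      obtain x' y' where xy': "adj ?G x' y'" "Cone {x', y'} \<in> \<Delta>"
        "0 \<le> wedge x' (x + y)" "0 \<le> wedge (x + y) y'"
        using cover [of "x + y"] by blast
      have "x' = x \<and> y' = y"
        using adj_unique [OF xy xy'(1), of "x + y"] xy'(3,4) adjD(3) [OF xy] by simp
      then show "\<tau> \<in> \<Delta>" using xy'(2) \<tau> fan unfolding fan_def by blast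
    qed
  qed
qed

section \<open>Contracting a ray\<close>

text \<open>
  These are the rays whose curves have self-intersection \<open>-1\<close>.
\<close>

definition contractible :: "(real ^ 2) set \<Rightarrow> real ^ 2 \<Rightarrow> bool" where
  "contractible G v \<longleftrightarrow> (\<exists>p s. adj G p v \<and> adj G v s \<and> wedge p s = 1)"

text \<open>
  For \<open>v = p + s\<close> the cones on \<open>p, v\<close> and on \<open>v, s\<close> merge into the unimodular cone on \<open>p, s\<close>.  No other
  new cone arises: it would contain \<open>v\<close>, an interior point of the merged one.
\<close>

lemma adj_remove:
  assumes pv: "adj G p v" and vs: "adj G v s" and ps: "wedge p s = 1"
  shows "adj (G - {v}) x y \<longleftrightarrow> (adj G x y \<and> x \<noteq> v \<and> y \<noteq> v) \<or> (x = p \<and> y = s)"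
proof -
  have sum: "p + s = v" using adj_sum [OF pv vs] ps by simp
  have v: "v = p + s" using sum by simp
  have new: "adj (G - {v}) p s"
  proof -
    have "p \<noteq> v" "s \<noteq> v" using adjD(3) [OF pv] adjD(3) [OF vs] by auto
    moreover have "g = p \<or> g = s" if g: "g \<in> G" "g \<noteq> v" "0 \<le> wedge p g" "0 \<le> wedge g s" for g
    proof (cases "0 \<le> wedge v g")
      case True
      then show ?thesis using adjD(5) [OF vs g(1)] g by auto
    next
      case False
      then have "0 \<le> wedge g v" using wedge_swap [of g v] by simp
      then show ?thesis using adjD(5) [OF pv g(1)] g by auto
    qed
    ultimately show ?thesis using adjD(1) [OF pv] adjD(2) [OF vs] ps by (auto simp: adj_def)
  qed
  show ?thesis
  proof
    assume xy: "adj (G - {v}) x y"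
    show "(adj G x y \<and> x \<noteq> v \<and> y \<noteq> v) \<or> (x = p \<and> y = s)"
    proof (cases "0 \<le> wedge x v \<and> 0 \<le> wedge v y")
      case True
      then have "x = p \<and> y = s"
        using adj_unique [OF new xy, of v] adjD(3) [OF pv] adjD(3) [OF vs] by simp
      then show ?thesis by blast
    next
      case False
      then show ?thesis using xy by (auto simp: adj_def)
    qed
  next
    assume "(adj G x y \<and> x \<noteq> v \<and> y \<noteq> v) \<or> (x = p \<and> y = s)"
    then show "adj (G - {v}) x y" using new by (auto simp: adj_def)
  qed
qed

lemma complete_rays_remove:
  assumes G: "complete_rays G" and pv: "adj G p v" and vs: "adj G v s" and ps: "wedge p s = 1"
  shows "complete_rays (G - {v})"
  unfolding complete_rays_def
proof (intro conjI allI)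
  show "finite (G - {v})" "G - {v} \<subseteq> lattice" using complete_raysD(1,2) [OF G] by auto
  fix w
  have sum: "p + s = v" using adj_sum [OF pv vs] ps by simp
  have v: "v = p + s" using sum by simp
  obtain x y where xy: "adj G x y" "0 \<le> wedge x w" "0 \<le> wedge w y"
    using complete_raysD(3) [OF G] by blast
  consider "x \<noteq> v" "y \<noteq> v" | "x = v" | "y = v" by blast
  then show "\<exists>x y. adj (G - {v}) x y \<and> 0 \<le> wedge x w \<and> 0 \<le> wedge w y"
  proof cases
    case 1
    then show ?thesis using xy adj_remove [OF pv vs ps] by blast
  next
    case 2
    then have y: "y = s" using xy(1) adj_succ_unique [OF vs] by simp
    have "w = wedge w s *\<^sub>R v + wedge v w *\<^sub>R s" by (rule wedge_expand [OF adjD(3) [OF vs]])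
    then have "wedge p w = wedge p (wedge w s *\<^sub>R v + wedge v w *\<^sub>R s)" by (simp only:)
    then have "wedge p w = wedge w s + wedge v w" using adjD(3) [OF pv] ps by simp
    then have "0 \<le> wedge p w" "0 \<le> wedge w s" using xy 2 y by auto
    then show ?thesis using adj_remove [OF pv vs ps] by blast
  next
    case 3
    then have x: "x = p" using xy(1) adj_pred_unique [OF pv] by simp
    have "w = wedge w v *\<^sub>R p + wedge p w *\<^sub>R v" by (rule wedge_expand [OF adjD(3) [OF pv]])
    then have "wedge w s = wedge (wedge w v *\<^sub>R p + wedge p w *\<^sub>R v) s" by (simp only:)
    then have "wedge w s = wedge w v + wedge p w" using adjD(3) [OF vs] ps by simp
    then have "0 \<le> wedge p w" "0 \<le> wedge w s" using xy 3 x by auto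
    then show ?thesis using adj_remove [OF pv vs ps] by blast
  qed
qed

lemma maximal_cone_in_fan_of:
  assumes xy: "adj G x y" and "\<sigma> \<in> fan_of G" "Cone {x, y} \<subseteq> \<sigma>"
  shows "\<sigma> = Cone {x, y}"
proof -
  obtain x' y' where xy': "adj G x' y'" "\<sigma> face_of Cone {x', y'}"
    using assms(2) by (auto simp: fan_of_def)
  then have "\<sigma> \<subseteq> Cone {x', y'}" by (simp add: face_of_imp_subset)
  moreover from this have "x' = x \<and> y' = y"
    using Cone_pair_inject [OF xy xy'(1)] assms(3) by blast
  ultimately show ?thesis using assms(3) by blast
qed

text \<open>
  The only cone of the smaller fan that contains \<open>Cone {p, s}\<close> is this cone itself, so the subdivision
  replaces it by the cones over its proper faces with apex ray \<open>v\<close>.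
\<close>

lemma star_subdivision_remove:
  assumes G: "complete_rays G" and pv: "adj G p v" and vs: "adj G v s" and ps: "wedge p s = 1"
  shows "star_subdivision (fan_of (G - {v})) (Cone {p, s}) = fan_of G"
proof -
  let ?H = "G - {v}"
  let ?C = "Cone {p, s}"
  have v: "v = p + s" using adj_sum [OF pv vs] ps by simp
  have H: "complete_rays ?H" by (rule complete_rays_remove [OF assms])
  have adjH: "adj ?H p s" using adj_remove [OF pv vs ps] by blast
  have CH: "?C \<in> fan_of ?H" using adjH by (auto simp: fan_of_explicit)
  have ne: "p \<noteq> s" using ps by auto
  have "g = p \<or> g = s" if "g \<in> ?H" "g \<in> ?C" for g
    using adjD(5) [OF adjH that(1)] that(2) unfolding Cone_pair [OF ps] by blast
  then have "?H \<inter> ?C = {p, s}"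
    using adjD(1,2) [OF adjH] hull_inc [of p "{p, s}"] hull_inc [of s "{p, s}"] by blast
  then have z: "\<Sum>(gens (fan_of ?H) \<inter> ?C) = v"
    unfolding gens_fan_of [OF H] using ne ps v by (simp only: sum.insert finite.intros) simp
  have max: "?C \<subseteq> \<sigma> \<longleftrightarrow> \<sigma> = ?C" if "\<sigma> \<in> fan_of ?H" for \<sigma>
    using maximal_cone_in_fan_of [OF adjH that] by blast
  have small: "\<rho> \<in> fan_of ?H \<and> \<rho> \<noteq> ?C \<and> \<rho> \<subseteq> ?C \<longleftrightarrow> \<rho> \<in> {{0}, Cone {p}, Cone {s}}" for \<rho>
  proof
    assume a: "\<rho> \<in> fan_of ?H \<and> \<rho> \<noteq> ?C \<and> \<rho> \<subseteq> ?C"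
    then have "?C \<inter> \<rho> face_of ?C" using fan_of_Int_face [OF CH] by blast
    moreover have "?C \<inter> \<rho> = \<rho>" using a by blast
    moreover have "\<rho> \<noteq> {}" using a by (auto simp: fan_of_def)
    ultimately have "\<rho> face_of ?C \<and> \<rho> \<noteq> {}" by simp
    then have "\<rho> \<in> {{0}, Cone {p}, Cone {s}, ?C}"
      by (rule face_of_Cone_pair [OF ps, THEN iffD1])
    then show "\<rho> \<in> {{0}, Cone {p}, Cone {s}}" using a by blast
  next
    assume a: "\<rho> \<in> {{0}, Cone {p}, Cone {s}}"
    then have "\<rho> \<in> {{0}, Cone {p}, Cone {s}, ?C}" by blast
    then have f: "\<rho> face_of ?C"
      by (rule face_of_Cone_pair [OF ps, THEN iffD2, THEN conjunct1])
    have "\<rho> \<in> fan_of ?H" using a by (intro fan_ofI [OF adjH]) blast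
    moreover have "p \<noteq> 0" "s \<noteq> 0" using ps by auto
    then have "dim (Cone {p}) = 1 \<and> dim (Cone {s}) = 1" by (intro conjI dim_Cone_single)
    then have "dim \<rho> \<noteq> dim ?C"
      using a dim_Cone_pair [OF ps] by (elim insertE emptyE) simp_all
    then have "\<rho> \<noteq> ?C" by blast
    ultimately show "\<rho> \<in> fan_of ?H \<and> \<rho> \<noteq> ?C \<and> \<rho> \<subseteq> ?C"
      using face_of_imp_subset [OF f] by blast
  qed
  have zero: "Cone (insert v {0}) = Cone {v}"
    using Cone_insert_Cone [of v "{}"] by (simp only: convex_cone_hull_empty)
  have old_cones: "{\<sigma> \<in> fan_of ?H. \<not> ?C \<subseteq> \<sigma>} = {\<sigma> \<in> fan_of ?H. \<sigma> \<noteq> ?C}"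
    using max by blast
  have near: "(\<exists>\<sigma>\<in>fan_of ?H. ?C \<subseteq> \<sigma> \<and> \<rho> \<subseteq> \<sigma>) \<longleftrightarrow> \<rho> \<subseteq> ?C" for \<rho>
    using max CH by blast
  have "\<rho> \<in> fan_of ?H \<and> \<not> ?C \<subseteq> \<rho> \<and> (\<exists>\<sigma>\<in>fan_of ?H. ?C \<subseteq> \<sigma> \<and> \<rho> \<subseteq> \<sigma>) \<longleftrightarrow>
      \<rho> \<in> {{0}, Cone {p}, Cone {s}}" for \<rho>
    unfolding near small [symmetric] using max [of \<rho>] by blast
  then have "{Cone (insert v \<rho>) | \<rho>. \<rho> \<in> fan_of ?H \<and> \<not> ?C \<subseteq> \<rho> \<and>
        (\<exists>\<sigma>\<in>fan_of ?H. ?C \<subseteq> \<sigma> \<and> \<rho> \<subseteq> \<sigma>)} = (\<lambda>\<rho>. Cone (insert v \<rho>)) ` {{0}, Cone {p}, Cone {s}}"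
    unfolding image_def by (intro Collect_cong) (simp only: bex_simps Bex_def conj_commute)
  also have "\<dots> = {Cone {v}, Cone {v, p}, Cone {v, s}}"
    by (simp only: image_insert image_empty zero Cone_insert_Cone)
  finally have "star_subdivision (fan_of ?H) ?C =
      {\<sigma> \<in> fan_of ?H. \<sigma> \<noteq> ?C} \<union> {Cone {v}, Cone {v, p}, Cone {v, s}}"
    unfolding star_subdivision_def Let_def z old_cones by (rule arg_cong)
  also have "{\<sigma> \<in> fan_of ?H. \<sigma> \<noteq> ?C} \<union> {Cone {v}, Cone {v, p}, Cone {v, s}} = fan_of G"
  proof
    show "{\<sigma> \<in> fan_of ?H. \<sigma> \<noteq> ?C} \<union> {Cone {v}, Cone {v, p}, Cone {v, s}} \<subseteq> fan_of G"
    proof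
      fix \<sigma> assume "\<sigma> \<in> {\<sigma> \<in> fan_of ?H. \<sigma> \<noteq> ?C} \<union> {Cone {v}, Cone {v, p}, Cone {v, s}}"
      then consider (old) "\<sigma> \<in> fan_of ?H" "\<sigma> \<noteq> ?C" | (new) "\<sigma> \<in> {Cone {v}, Cone {v, p}, Cone {v, s}}"
        by blast
      then show "\<sigma> \<in> fan_of G"
      proof cases
        case old
        then obtain x y where "adj ?H x y \<and> \<sigma> \<in> {{0}, Cone {x}, Cone {y}, Cone {x, y}}"
          unfolding fan_of_explicit by (elim exE)
        then have "adj ?H x y" and \<sigma>: "\<sigma> \<in> {{0}, Cone {x}, Cone {y}, Cone {x, y}}"
          by auto
        then consider "adj G x y" | "x = p" "y = s" unfolding adj_remove [OF pv vs ps] by blast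
        then show ?thesis
        proof cases
          case 1
          then show ?thesis using \<sigma> by (rule fan_ofI)
        next
          case 2
          then consider "\<sigma> \<in> {{0}, Cone {p}}" | "\<sigma> = Cone {s}" using \<sigma> old(2)
            by blast
          then show ?thesis using fan_ofI [OF pv, of \<sigma>] fan_ofI [OF vs, of \<sigma>]
            by cases blast+
        qed
      next
        case new
        then consider "\<sigma> = Cone {v}" | "\<sigma> = Cone {p, v}" | "\<sigma> = Cone {v, s}"
          by (auto simp: insert_commute)
        then show ?thesis using fan_ofI [OF pv, of \<sigma>] fan_ofI [OF vs, of \<sigma>] by cases blast+
      qed
    qed
    show "fan_of G \<subseteq> {\<sigma> \<in> fan_of ?H. \<sigma> \<noteq> ?C} \<union> {Cone {v}, Cone {v, p}, Cone {v, s}}"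
    proof
      fix \<sigma> assume "\<sigma> \<in> fan_of G"
      then obtain x y where "adj G x y \<and> \<sigma> \<in> {{0}, Cone {x}, Cone {y}, Cone {x, y}}"
        unfolding fan_of_explicit by (elim exE)
      then have xy: "adj G x y" "\<sigma> \<in> {{0}, Cone {x}, Cone {y}, Cone {x, y}}" by blast+
      have C0: "\<sigma> \<in> fan_of ?H \<and> \<sigma> \<noteq> ?C" if "\<sigma> \<in> {{0}, Cone {p}, Cone {s}}"
        using iffD2 [OF small that] by blast
      consider (old) "x \<noteq> v" "y \<noteq> v" | (l) "x = v" "y = s" | (r) "y = v" "x = p"
        using xy(1) adj_succ_unique [OF vs] adj_pred_unique [OF pv] by blast
      then show "\<sigma> \<in> {\<sigma> \<in> fan_of ?H. \<sigma> \<noteq> ?C} \<union> {Cone {v}, Cone {v, p}, Cone {v, s}}"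
      proof cases
        case old
        then have a: "adj ?H x y" using adj_remove [OF pv vs ps] xy(1) by blast
        then have "\<sigma> \<in> fan_of ?H" using xy(2) by (rule fan_ofI)
        moreover have "\<sigma> \<noteq> ?C"
        proof
          assume "\<sigma> = ?C"
          have "\<sigma> \<subseteq> Cone {x, y}"
            using xy(2) hull_mono [of "{x}" "{x,y}"] hull_mono [of "{y}" "{x,y}"] convex_cone_hull_contains_0
            by auto
          then have "x = p \<and> y = s" using Cone_pair_inject [OF adjH a] \<open>\<sigma> = ?C\<close>
            by blast
          then have "adj G p s" using xy(1) by simp
          then have "v = s" using adj_succ_unique [OF pv] by blast
          then show False using adjD(3) [OF vs] by simp
        qed
        ultimately show ?thesis by blast
      next
        case l
        then consider "\<sigma> \<in> {{0}, Cone {p}, Cone {s}}" | "\<sigma> \<in> {Cone {v}, Cone {v, s}}"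
          using xy(2) by blast
        then show ?thesis using C0 by cases blast+
      next
        case r
        then consider "\<sigma> \<in> {{0}, Cone {p}, Cone {s}}" | "\<sigma> \<in> {Cone {v}, Cone {v, p}}"
          using xy(2) by (auto simp: insert_commute)
        then show ?thesis using C0 by cases blast+
      qed
    qed
  qed
  finally show ?thesis .
qed

lemma fan_iso_refl: "fan_iso \<Delta> \<Delta>"
  unfolding fan_iso_def by (intro exI [of _ id]) (simp add: linear_id)

lemma contractible_blowup:
  assumes G: "complete_rays G" and v: "contractible G v"
  shows "equivariant_blowup (fan_of G) (fan_of (G - {v}))"
proof -
  obtain p s where ps: "adj G p v" "adj G v s" "wedge p s = 1" using v by (auto simp: contractible_def)
  have "adj (G - {v}) p s" using adj_remove [OF ps] by blast
  then have "Cone {p, s} \<in> fan_of (G - {v})" by (auto simp: fan_of_explicit)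
  moreover have "Cone {p, s} \<noteq> {0}"
    using dim_Cone_pair [OF ps(3)] by (metis dim_eq_0 order_refl zero_neq_numeral)
  ultimately show ?thesis
    unfolding equivariant_blowup_def star_subdivision_remove [OF G ps, symmetric]
    using fan_iso_refl by blast
qed

section \<open>Classification of ray systems without contractible rays\<close>

lemma abs_Ints_mult_ne_1: "c \<in> \<int> \<Longrightarrow> 2 \<le> M \<Longrightarrow> \<bar>c * M\<bar> \<noteq> (1::real)"
proof (cases "c = 0")
  case False
  assume "c \<in> \<int>" "2 \<le> M"
  then have "1 * 2 \<le> \<bar>c\<bar> * M" using False Ints_pos [of "\<bar>c\<bar>"]
    by (intro mult_mono) auto
  then show ?thesis using \<open>2 \<le> M\<close> by (simp add: abs_mult)
qed simp

text \<open>
  With \<open>M = wedge u g\<close> and \<open>a = wedge p s\<close>, the heights of the neighbours of \<open>g\<close> add up to \<open>a M\<close>.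
  A neighbour at the same height \<open>M\<close> would differ from \<open>g\<close> by a multiple of \<open>u\<close>, so that its determinant
  with \<open>g\<close> would be divisible by \<open>M\<close>; the same happens if both neighbours have height 0.  Hence
  \<open>0 < a M < 2 M\<close>.
\<close>

lemma peak_contractible:
  assumes G: "complete_rays G" and u: "u \<in> lattice" "h \<in> lattice" "wedge u h = 1"
    and pg: "adj G p g" and gs: "adj G g s" and M: "2 \<le> wedge u g"
    and p: "0 \<le> wedge u p" "wedge u p \<le> wedge u g" and s: "0 \<le> wedge u s" "wedge u s \<le> wedge u g"
  shows "wedge p s = 1"
proof -
  have lat: "p \<in> lattice" "g \<in> lattice" "s \<in> lattice"
    using complete_raysD(2) [OF G] adjD(1,2) [OF pg] adjD(2) [OF gs] by auto
  note parallel = parallel_primitive [OF u(1,2) _ u(3)]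
  have gu: "wedge g u = - wedge u g" "wedge p u = - wedge u p" by (rule wedge_swap)+
  have "wedge u p \<noteq> wedge u g"
  proof
    assume eq: "wedge u p = wedge u g"
    then obtain c where c: "c \<in> \<int>" "g - p = c *\<^sub>R u" using parallel [of "g - p"] lat
      by (auto intro: lattice_diff)
    then have "wedge p (g - p) = wedge p (c *\<^sub>R u)" by simp
    then have "\<bar>c * wedge u g\<bar> = 1" using adjD(3) [OF pg] eq gu by simp
    then show False using abs_Ints_mult_ne_1 [OF c(1) M] by simp
  qed
  moreover have "wedge u s \<noteq> wedge u g"
  proof
    assume eq: "wedge u s = wedge u g"
    then obtain c where c: "c \<in> \<int>" "s - g = c *\<^sub>R u" using parallel [of "s - g"] lat
      by (auto intro: lattice_diff)
    then have "wedge g (s - g) = wedge g (c *\<^sub>R u)" by simp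
    then have "\<bar>c * wedge u g\<bar> = 1" using adjD(3) [OF gs] gu by simp
    then show False using abs_Ints_mult_ne_1 [OF c(1) M] by simp
  qed
  moreover have "wedge u (p + s) = wedge u (wedge p s *\<^sub>R g)" using adj_sum [OF pg gs]
    by (rule arg_cong)
  then have sum: "wedge u p + wedge u s = wedge p s * wedge u g" by simp
  ultimately have "wedge p s * wedge u g < 2 * wedge u g" "0 \<le> wedge p s * wedge u g" using p s
    by linarith+
  then have lt: "wedge p s < 2" "0 \<le> wedge p s"
    using M by (simp_all add: zero_le_mult_iff mult_less_cancel_right)
  have "wedge p s \<noteq> 0"
  proof
    assume "wedge p s = 0"
    then have "wedge u p = 0" using sum p(1) s(1) by simp
    then obtain c where c: "c \<in> \<int>" "p = c *\<^sub>R u" using parallel [of p] lat by auto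
    then have "wedge p g = c * wedge u g" by simp
    then have "\<bar>c * wedge u g\<bar> = 1" using adjD(3) [OF pg] by simp
    then show False using abs_Ints_mult_ne_1 [OF c(1) M] by simp
  qed
  then have "1 \<le> wedge p s" using lt(2) Ints_pos [of "wedge p s"] wedge_lattice lat by simp
  moreover have "\<not> 0 < wedge p s - 1"
    using lt(1) Ints_pos [of "wedge p s - 1"] wedge_lattice [of p s] lat by auto
  ultimately show ?thesis by simp
qed

text \<open>
  Take a ray of maximal height above the line of \<open>x\<close>; its neighbours are not below this line, as
  \<open>x\<close> and \<open>-x\<close> are rays.  If the height is at least 2, the ray is contractible.  If all heights are 1,
  then the successor of \<open>x\<close> is contractible unless it is followed by \<open>-x\<close>.
\<close>

lemma half_plane_rays:
  assumes G: "complete_rays G" and x: "x \<in> G" "- x \<in> G"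
  shows "(\<exists>g. contractible G g) \<or> (\<exists>v. adj G x v \<and> {g\<in>G. 0 < wedge x g} = {v})"
proof -
  let ?U = "{g\<in>G. 0 < wedge x g}"
  obtain v where v: "adj G x v" using adj_exists [OF G x(1)] by blast
  have lat: "x \<in> lattice" "v \<in> lattice" using complete_raysD(2) [OF G] adjD(1,2) [OF v] by auto
  have above: "0 \<le> wedge x p" "0 \<le> wedge x s" if "0 < wedge x g" "adj G p g" "adj G g s" for p g s
  proof -
    show "0 \<le> wedge x p"
    proof (rule ccontr)
      assume a: "\<not> 0 \<le> wedge x p"
      then have "x = p \<or> x = g" using adjD(5) [OF that(2) x(1)] that(1) wedge_swap [of p x] by simp
      then show False using a that(1) by auto
    qed
    show "0 \<le> wedge x s"
    proof (rule ccontr)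
      assume a: "\<not> 0 \<le> wedge x s"
      then have "- x = g \<or> - x = s" using adjD(5) [OF that(3) x(2)] that(1) wedge_swap [of g x]
        by simp
      then have "wedge x g = 0 \<or> wedge x s = 0" by auto
      then show False using a that(1) by auto
    qed
  qed
  have U: "finite ?U" "v \<in> ?U" using complete_raysD(1) [OF G] adjD(2,3) [OF v] by auto
  then have "Max (wedge x ` ?U) \<in> wedge x ` ?U" by (intro Max_in) auto
  then obtain g where g: "g \<in> ?U" "Max (wedge x ` ?U) = wedge x g" by auto
  have max: "wedge x g' \<le> wedge x g" if "g' \<in> ?U" for g'
    unfolding g(2) [symmetric] using U(1) that by (intro Max_ge) auto
  have max0: "wedge x g' \<le> wedge x g" if "g' \<in> G" for g'
    using max [of g'] that g(1) by (cases "0 < wedge x g'") auto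
  show ?thesis
  proof (cases "2 \<le> wedge x g")
    case True
    obtain p s where ps: "adj G p g" "adj G g s" using adj_exists [OF G] g(1) by blast
    have "wedge p s = 1"
      by (rule peak_contractible [OF G lat adjD(3) [OF v] ps True])
         (use above [OF _ ps] g(1) max0 adjD(1) [OF ps(1)] adjD(2) [OF ps(2)] in auto)
    then show ?thesis using ps unfolding contractible_def by blast
  next
    case False
    have one: "wedge x g' = 1" if "g' \<in> G" "0 < wedge x g'" for g'
    proof -
      have int: "wedge x g' \<in> \<int>" using wedge_lattice lat(1) complete_raysD(2) [OF G that(1)]
        by blast
      have "wedge x g' < 2" using max0 [OF that(1)] False by simp
      then have "\<not> 0 < wedge x g' - 1" using Ints_pos [of "wedge x g' - 1"] int by auto
      then show ?thesis using Ints_pos [OF int that(2)] by simp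
    qed
    obtain t where t: "adj G v t" using adj_exists [OF G adjD(2) [OF v]] by blast
    have "0 \<le> wedge x t" using above(2) [OF _ v t] adjD(3) [OF v] by simp
    then consider "wedge x t = 1" | "wedge x t = 0" using one [OF adjD(2) [OF t]] by force
    then show ?thesis
    proof cases
      case 1
      then show ?thesis using v t unfolding contractible_def by blast
    next
      case 2
      then obtain c where c: "t = c *\<^sub>R x"
        using parallel_primitive [OF lat _ adjD(3) [OF v]] complete_raysD(2) [OF G adjD(2) [OF t]]
        by blast
      then have "c = -1" using adjD(3) [OF t] adjD(4) [OF v] by simp
      then have t': "adj G v (- x)" using t c by simp
      have "g' = v" if g': "g' \<in> ?U" for g'
      proof -
        have L: "g' \<in> lattice" and w1: "wedge x g' = 1" and gG: "g' \<in> G"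
          using g' one complete_raysD(2) [OF G] by auto
        have "wedge x (g' - v) = 0" using w1 adjD(3) [OF v] by simp
        then obtain c where c: "c \<in> \<int>" "g' - v = c *\<^sub>R x"
          using parallel_primitive [OF lat lattice_diff [OF L lat(2)] adjD(3) [OF v]] by blast
        then have gv: "g' = v + c *\<^sub>R x" by (simp add: algebra_simps)
        have "g' = x \<or> g' = v \<or> g' = - x"
        proof (cases "0 \<le> c")
          case True
          have "wedge g' v = c" unfolding gv using adjD(3) [OF v] by simp
          then have "g' = x \<or> g' = v" using w1 True by (intro adjD(5) [OF v gG]) simp_all
          then show ?thesis by blast
        next
          case False
          have "wedge v g' = - c" unfolding gv using adjD(4) [OF v] by simp
          moreover have "wedge g' (- x) = 1" using w1 wedge_swap [of g' x] by simp
          ultimately have "g' = v \<or> g' = - x" using False by (intro adjD(5) [OF t' gG]) simp_all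
          then show ?thesis by blast
        qed
        then show ?thesis using w1 by auto
      qed
      then have "?U = {v}" using U(2) by blast
      then show ?thesis using v by blast
    qed
  qed
qed

text \<open>
  By \<open>half_plane_rays\<close> each of the two open half-planes bounded by the line of \<open>x\<close> contains a single ray.
\<close>

lemma opposite_rays_quadrilateral:
  assumes G: "complete_rays G" and x: "x \<in> G" "- x \<in> G" and nc: "\<not> (\<exists>g. contractible G g)"
  shows "\<exists>x v k. k \<in> \<int> \<and> x \<in> lattice \<and> v \<in> lattice \<and> wedge x v = 1 \<and> G = {x, v, - x, k *\<^sub>R x - v}"
proof -
  obtain v where v: "adj G x v" "{g\<in>G. 0 < wedge x g} = {v}"
    using half_plane_rays [OF G x] nc by blast
  have "- x \<in> G" "- (- x) \<in> G" using x by auto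
  then obtain w where w: "adj G (- x) w" "{g\<in>G. 0 < wedge (- x) g} = {w}"
    using half_plane_rays [OF G] nc by blast
  have lat: "x \<in> lattice" "v \<in> lattice" "w \<in> lattice"
    using complete_raysD(2) [OF G] adjD(1,2) [OF v(1)] adjD(2) [OF w(1)] by auto
  have xw: "wedge x w = -1" using adjD(3) [OF w(1)] by simp
  have all: "g \<in> {x, v, - x, w}" if g: "g \<in> G" for g
  proof -
    consider "0 < wedge x g" | "wedge x g < 0" | "wedge x g = 0" by linarith
    then show ?thesis
    proof cases
      case 1
      then have "g \<in> {g\<in>G. 0 < wedge x g}" using g by blast
      then show ?thesis unfolding v(2) by blast
    next
      case 2
      then have "g \<in> {g\<in>G. 0 < wedge (- x) g}" using g by simp
      then show ?thesis unfolding w(2) by blast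
    next
      case 3
      then obtain c where c: "g = c *\<^sub>R x"
        using parallel_primitive [OF lat(1,2) complete_raysD(2) [OF G g] adjD(3) [OF v(1)]] by blast
      show ?thesis
      proof (cases "0 \<le> c")
        case True
        then show ?thesis using adjD(5) [OF v(1) g] adjD(3) [OF v(1)] c by auto
      next
        case False
        then show ?thesis using adjD(5) [OF w(1) g] xw c by auto
      qed
    qed
  qed
  have "wedge x (w + v) = 0" using xw adjD(3) [OF v(1)] by simp
  then obtain k where k: "k \<in> \<int>" "w + v = k *\<^sub>R x"
    using parallel_primitive [OF lat(1,2) lattice_add [OF lat(3,2)] adjD(3) [OF v(1)]] by blast
  then have "w = k *\<^sub>R x - v" by (simp add: algebra_simps)
  moreover have "G = {x, v, - x, w}"
    using all x adjD(2) [OF v(1)] adjD(2) [OF w(1)] by blast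
  ultimately show ?thesis using k(1) lat adjD(3) [OF v(1)] by blast
qed

text \<open>
  Here \<open>s = - p - v\<close>, and only the cone on \<open>s, p\<close> may contain further rays.  Among those, one that
  maximises \<open>wedge s g + wedge g p\<close>, that is, \<open>wedge (s - p) g\<close>, has height at least 2, while \<open>s\<close> and \<open>p\<close>
  have height 1; so \<open>peak_contractible\<close> applies to it.
\<close>

lemma triangle_or_contractible:
  assumes G: "complete_rays G" and pv: "adj G p v" and vs: "adj G v s" and ps: "wedge p s = -1"
    and nc: "\<not> (\<exists>g. contractible G g)"
  shows "G = {p, v, - p - v}"
proof -
  have s: "s = - p - v" using adj_sum [OF pv vs] ps by (simp add: algebra_simps eq_neg_iff_add_eq_0)
  have lat: "p \<in> lattice" "v \<in> lattice" "s \<in> lattice"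
    using complete_raysD(2) [OF G] adjD(1,2) [OF pv] adjD(2) [OF vs] by auto
  have sp: "wedge s p = 1" using ps wedge_swap [of s p] by simp
  let ?U = "{g\<in>G. 0 < wedge s g \<and> 0 < wedge g p}"
  have empty: "?U = {}"
  proof (rule ccontr)
    assume "?U \<noteq> {}"
    moreover have fin: "finite ?U" using complete_raysD(1) [OF G] by simp
    ultimately have "Max (wedge (s - p) ` ?U) \<in> wedge (s - p) ` ?U" by (intro Max_in) auto
    then obtain g where g: "g \<in> ?U" "Max (wedge (s - p) ` ?U) = wedge (s - p) g" by auto
    have max: "wedge (s - p) g' \<le> wedge (s - p) g" if "g' \<in> ?U" for g'
      unfolding g(2) [symmetric] using fin that by (intro Max_ge) auto
    have height: "wedge (s - p) a = wedge s a + wedge a p" for a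
      using wedge_swap [of p a] by simp
    have "1 \<le> wedge s g" "1 \<le> wedge g p"
      using g(1) Ints_pos wedge_lattice lat complete_raysD(2) [OF G] by auto
    then have M: "2 \<le> wedge (s - p) g" unfolding height by linarith
    have bound: "0 \<le> wedge (s - p) a \<and> wedge (s - p) a \<le> wedge (s - p) g"
      if a: "a \<in> G" "0 \<le> wedge s a" "0 \<le> wedge a p" for a
    proof -
      consider "a \<in> ?U" | "wedge s a = 0" | "wedge a p = 0" using a by force
      then show ?thesis
      proof cases
        case 1
        have "0 \<le> wedge (s - p) a" unfolding height using a by simp
        then show ?thesis using max [OF 1] by blast
      next
        case 2
        have "wedge v a = wedge a p" using 2 wedge_swap [of p a] unfolding s by simp
        moreover have "wedge a s = 0" using 2 wedge_swap [of a s] by simp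
        ultimately have "a = v \<or> a = s" using adjD(5) [OF vs a(1)] a(3) by simp
        then have "a = s" using 2 adjD(4) [OF vs] by auto
        then show ?thesis using M sp unfolding height by simp
      next
        case 3
        have "wedge a v = wedge s a" using 3 wedge_swap [of v a] wedge_swap [of p a] unfolding s by simp
        moreover have "wedge p a = 0" using 3 wedge_swap [of p a] by simp
        ultimately have "a = p \<or> a = v" using adjD(5) [OF pv a(1)] a(2) by simp
        then have "a = p" using 3 adjD(4) [OF pv] by auto
        then show ?thesis using M sp unfolding height by simp
      qed
    qed
    obtain a b where ab: "adj G a g" "adj G g b" using adj_exists [OF G] g(1) by blast
    have gpos: "0 < wedge s g" "0 < wedge g p" using g(1) by auto
    have sG: "s \<in> G" and pG: "p \<in> G" using adjD(2) [OF vs] adjD(1) [OF pv] by auto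
    have sa: "0 \<le> wedge s a"
    proof (rule ccontr)
      assume n: "\<not> 0 \<le> wedge s a"
      then have "s = a \<or> s = g" using adjD(5) [OF ab(1) sG] gpos wedge_swap [of a s] by simp
      then show False using n gpos by auto
    qed
    have ap: "0 \<le> wedge a p"
    proof (rule ccontr)
      assume n: "\<not> 0 \<le> wedge a p"
      have "1 = wedge a p * wedge s g + wedge s a * wedge p g"
        using wedge_plucker [of s p a g] sp adjD(3) [OF ab(1)] by simp
      moreover have "wedge a p * wedge s g < 0" using n gpos by (simp add: mult_neg_pos)
      moreover have "wedge s a * wedge p g \<le> 0"
        using sa gpos wedge_swap [of p g] by (simp add: mult_nonneg_nonneg)
      ultimately show False by linarith
    qed
    have bp: "0 \<le> wedge b p"
    proof (rule ccontr)
      assume n: "\<not> 0 \<le> wedge b p"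
      then have "p = g \<or> p = b" using adjD(5) [OF ab(2) pG] gpos wedge_swap [of p b] by simp
      then show False using n gpos by auto
    qed
    have sb: "0 \<le> wedge s b"
    proof (rule ccontr)
      assume n: "\<not> 0 \<le> wedge s b"
      have "1 = wedge g p * wedge s b + wedge s g * wedge p b"
        using wedge_plucker [of s p g b] sp adjD(3) [OF ab(2)] by simp
      moreover have "wedge g p * wedge s b < 0" using n gpos by (simp add: mult_pos_neg)
      moreover have "wedge s g * wedge p b \<le> 0"
        using bp gpos wedge_swap [of p b] by (simp add: mult_nonneg_nonneg)
      ultimately show False by linarith
    qed
    have "wedge a b = 1"
      by (rule peak_contractible [OF G lattice_diff [OF lat(3,1)] lat(1) _ ab M])
         (use bound [OF adjD(1) [OF ab(1)] sa ap] bound [OF adjD(2) [OF ab(2)] sb bp] sp in auto)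
    then show False using nc ab unfolding contractible_def by blast
  qed
  have "g \<in> {p, v, s}" if g: "g \<in> G" for g
  proof -
    have "wedge v g = - wedge g v" "wedge g p = - wedge p g" by (rule wedge_swap)+
    moreover have "wedge s g = wedge g v - wedge p g" "wedge g s = wedge p g - wedge g v"
      unfolding s using wedge_swap [of v g] wedge_swap [of p g] by simp_all
    moreover have "g \<notin> ?U" using empty by blast
    ultimately have "0 \<le> wedge p g \<and> 0 \<le> wedge g v \<or> 0 \<le> wedge v g \<and> 0 \<le> wedge g s"
      using g by auto
    then show ?thesis using adjD(5) [OF pv g] adjD(5) [OF vs g] by blast
  qed
  then show ?thesis using adjD(1,2) [OF pv] adjD(2) [OF vs] s by blast
qed

text \<open>
  A generator \<open>v\<close> of maximal norm satisfies \<open>\<bar>g \<bullet> v\<bar> < v \<bullet> v\<close> for every generator \<open>g\<close> not parallel to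
  it, so the inner product of \<open>p + s = a v\<close> with \<open>v\<close> gives \<open>\<bar>a\<bar> < 2\<close>.
\<close>

theorem ray_system_trichotomy:
  assumes G: "complete_rays G"
  shows "(\<exists>g. contractible G g) \<or>
    (\<exists>x y. x \<in> lattice \<and> y \<in> lattice \<and> wedge x y = 1 \<and> G = {x, y, - x - y}) \<or>
    (\<exists>x v k. k \<in> \<int> \<and> x \<in> lattice \<and> v \<in> lattice \<and> wedge x v = 1 \<and> G = {x, v, - x, k *\<^sub>R x - v})"
proof (cases "\<exists>g. contractible G g")
  case nc: False
  obtain x0 y0 where "adj G x0 y0" using complete_raysD(3) [OF G] by blast
  then have ne: "G \<noteq> {}" using adjD(1) by blast
  have fin: "finite G" by (rule complete_raysD(1) [OF G])
  then have "Max (norm ` G) \<in> norm ` G" using ne by (intro Max_in) auto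
  then obtain v where v: "v \<in> G" "Max (norm ` G) = norm v" by auto
  have max: "norm g \<le> norm v" if "g \<in> G" for g
    unfolding v(2) [symmetric] using fin that by (intro Max_ge) auto
  obtain p s where pv: "adj G p v" and vs: "adj G v s" using adj_exists [OF G v(1)] by blast
  have lat: "p \<in> lattice" "v \<in> lattice" "s \<in> lattice"
    using complete_raysD(2) [OF G] adjD(1,2) [OF pv] adjD(2) [OF vs] by auto
  have inner_less: "\<bar>g \<bullet> v\<bar> < v \<bullet> v" if "g \<in> G" "wedge g v \<noteq> 0" for g
  proof -
    have "g \<bullet> g \<le> v \<bullet> v" using max [OF that(1)] by (simp add: norm_le)
    moreover have "0 < (v - g) \<bullet> (v - g)" "0 < (v + g) \<bullet> (v + g)"
    proof -
      have "wedge (v - g) v \<noteq> 0" "wedge (v + g) v \<noteq> 0" using that(2) by simp_all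
      then have "v - g \<noteq> 0" "v + g \<noteq> 0" by (metis wedge_simps(9))+
      then show "0 < (v - g) \<bullet> (v - g)" "0 < (v + g) \<bullet> (v + g)" by simp_all
    qed
    ultimately show ?thesis
      by (simp add: inner_diff inner_add_left inner_add_right inner_commute [of v g] abs_less_iff algebra_simps)
  qed
  have "(p + s) \<bullet> v = (wedge p s *\<^sub>R v) \<bullet> v" using adj_sum [OF pv vs] by simp
  then have sum: "p \<bullet> v + s \<bullet> v = wedge p s * (v \<bullet> v)"
    by (simp add: inner_add_left)
  have "\<bar>p \<bullet> v\<bar> < v \<bullet> v" "\<bar>s \<bullet> v\<bar> < v \<bullet> v"
    using inner_less adjD(1,3) [OF pv] adjD(2,4) [OF vs] by auto
  then have "\<bar>wedge p s * (v \<bullet> v)\<bar> < 2 * (v \<bullet> v)" unfolding sum [symmetric]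
    by linarith
  then have "\<bar>wedge p s\<bar> < 2" by (simp add: abs_mult mult_less_cancel_right)
  moreover obtain n where n: "wedge p s = of_int n" using wedge_lattice [OF lat(1,3)]
    by (auto elim: Ints_cases)
  ultimately have "\<bar>n\<bar> < 2" by linarith
  then consider "n = -1" | "n = 0" | "n = 1" by linarith
  then show ?thesis
  proof cases
    case 1
    then have "G = {p, v, - p - v}" using triangle_or_contractible [OF G pv vs _ nc] n by simp
    then show ?thesis using lat adjD(3) [OF pv] by blast
  next
    case 2
    then have "s = - p" using adj_sum [OF pv vs] n by (simp add: eq_neg_iff_add_eq_0 add.commute)
    then show ?thesis
      using opposite_rays_quadrilateral [OF G adjD(1) [OF pv] _ nc] adjD(2) [OF vs] by blast
  next
    case 3
    then show ?thesis using nc pv vs n unfolding contractible_def by auto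
  qed
qed blast

section \<open>Strictly convex support functions\<close>

text \<open>
  Rotation by a right angle identifies linear forms with vectors: the inner product with \<open>covec w\<close> is
  \<open>wedge w\<close>.
\<close>

definition covec :: "real ^ 2 \<Rightarrow> real ^ 2" where
  "covec w = vector [- (w $ 2), w $ 1]"

lemma covec_inner [simp]: "covec w \<bullet> g = wedge w g"
  by (simp add: covec_def wedge_inner)

lemma covec_lattice: "w \<in> lattice \<Longrightarrow> covec w \<in> lattice"
  by (auto simp: covec_def lattice_def forall_2)

lemma covec_surj: "u \<in> lattice \<Longrightarrow> \<exists>w\<in>lattice. u = covec w"
  by (rule bexI [of _ "vector [u $ 2, - (u $ 1)]"])
     (auto simp: covec_def lattice_def forall_2 vec_eq_iff)

text \<open>
  The piecewise linear function with value \<open>- a g\<close> at each generator \<open>g\<close> is strictly concave across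
  every ray.
\<close>

definition strictly_convex :: "(real ^ 2) set \<Rightarrow> (real ^ 2 \<Rightarrow> real) \<Rightarrow> bool" where
  "strictly_convex G a \<longleftrightarrow> (\<forall>p v s. adj G p v \<and> adj G v s \<longrightarrow> wedge p s * a v < a p + a s)"

lemma strictly_convexD:
  "strictly_convex G a \<Longrightarrow> adj G p v \<Longrightarrow> adj G v s \<Longrightarrow> 0 < a p + a s - wedge p s * a v"
  by (simp add: strictly_convex_def)

text \<open>
  \<open>wedge (support_form a x y)\<close> is the linear form with values \<open>- a x\<close> at \<open>x\<close> and \<open>- a y\<close> at \<open>y\<close>,
  if \<open>wedge x y = 1\<close>.
\<close>

definition support_form :: "(real ^ 2 \<Rightarrow> real) \<Rightarrow> real ^ 2 \<Rightarrow> real ^ 2 \<Rightarrow> real ^ 2" where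
  "support_form a x y = a x *\<^sub>R y - a y *\<^sub>R x"

lemma wedge_support_form:
  "wedge (support_form a x y) g = - (a x * wedge g y + a y * wedge x g)"
  using wedge_swap [of y g] by (simp add: support_form_def)

text \<open>
  The forms on the two sides of the ray of \<open>y\<close> agree on it, hence differ by a multiple of
  \<open>\<lambda>g. wedge g y\<close>; the factor is positive exactly if \<open>a\<close> is strictly convex at \<open>y\<close>.
\<close>

lemma support_form_succ:
  assumes "adj G x y" "adj G y s"
  shows "wedge (support_form a y s) g =
    wedge (support_form a x y) g + (a x + a s - wedge x s * a y) * wedge g y"
proof -
  have s: "s = wedge x s *\<^sub>R y - x" using adj_sum [OF assms] by (simp add: algebra_simps)
  have "wedge g s = wedge g (wedge x s *\<^sub>R y - x)" using s by (rule arg_cong)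
  then have "wedge g s = wedge x s * wedge g y + wedge x g" using wedge_swap [of g x] by simp
  then show ?thesis using wedge_swap [of y g] by (simp add: wedge_support_form algebra_simps)
qed

lemma support_form_pred:
  assumes "adj G p x" "adj G x y"
  shows "wedge (support_form a p x) g =
    wedge (support_form a x y) g + (a p + a y - wedge p y * a x) * wedge x g"
proof -
  have p: "p = wedge p y *\<^sub>R x - y" using adj_sum [OF assms] by (simp add: algebra_simps)
  have "wedge p g = wedge (wedge p y *\<^sub>R x - y) g" using p by (rule arg_cong)
  then have "wedge p g = wedge p y * wedge x g + wedge g y" using wedge_swap [of y g] by simp
  then show ?thesis using wedge_swap [of g x] by (simp add: wedge_support_form algebra_simps)
qed

lemma finite_adj: "finite G \<Longrightarrow> finite {(x, y). adj G x y}"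
  by (rule finite_subset [of _ "G \<times> G"]) (auto dest: adjD)

text \<open>
  Among the forms of all maximal cones choose one that is minimal at \<open>g\<close>.  If \<open>g\<close> were outside the
  corresponding cone, then crossing the wall that separates them would make the value at \<open>g\<close> strictly
  smaller.  So \<open>g\<close> is in that cone, and the minimal value is \<open>- a g\<close>.
\<close>

lemma strictly_convex_global:
  assumes G: "complete_rays G" and a: "strictly_convex G a" and xy: "adj G x y" and g: "g \<in> G"
  shows "- a g \<le> wedge (support_form a x y) g"
proof -
  let ?E = "{(x, y). adj G x y}"
  let ?f = "\<lambda>(x, y). wedge (support_form a x y) g"
  have fin: "finite ?E" using finite_adj complete_raysD(1) [OF G] by blast
  then have "Min (?f ` ?E) \<in> ?f ` ?E" using xy by (intro Min_in) auto
  then obtain u v where uv: "adj G u v" and min: "Min (?f ` ?E) = wedge (support_form a u v) g" by auto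
  have le: "wedge (support_form a u v) g \<le> wedge (support_form a u' v') g" if "adj G u' v'" for u' v'
    unfolding min [symmetric] using that fin by (intro Min_le) auto
  obtain p s where p: "adj G p u" and s: "adj G v s"
    using adj_exists [OF G] adjD(1,2) [OF uv] by blast
  have "0 \<le> wedge g v"
  proof (rule ccontr)
    assume "\<not> 0 \<le> wedge g v"
    moreover have "0 < a u + a s - wedge u s * a v"
      by (rule strictly_convexD [OF a uv s])
    ultimately have "(a u + a s - wedge u s * a v) * wedge g v < 0" by (simp add: mult_pos_neg)
    then show False using le [OF s] unfolding support_form_succ [OF uv s] by linarith
  qed
  moreover have "0 \<le> wedge u g"
  proof (rule ccontr)
    assume "\<not> 0 \<le> wedge u g"
    moreover have "0 < a p + a v - wedge p v * a u"
      by (rule strictly_convexD [OF a p uv])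
    ultimately have "(a p + a v - wedge p v * a u) * wedge u g < 0" by (simp add: mult_pos_neg)
    then show False using le [OF p] unfolding support_form_pred [OF p uv] by linarith
  qed
  ultimately have "g = u \<or> g = v" using adjD(5) [OF uv g] by blast
  then have "wedge (support_form a u v) g = - a g"
    using adjD(3) [OF uv] by (auto simp: wedge_support_form)
  then show ?thesis using le [OF xy] by simp
qed

lemma sum_list_replicate_scaleR:
  "sum_list (replicate n x) = real n *\<^sub>R (x :: 'a :: real_vector)"
  by (induction n) (auto simp: algebra_simps)

lemma fan_of_two_dim:
  assumes "\<sigma> \<in> fan_of G" "dim \<sigma> = 2"
  shows "\<exists>x y. adj G x y \<and> \<sigma> = Cone {x, y}"
proof -
  obtain x y where "adj G x y \<and> \<sigma> \<in> {{0}, Cone {x}, Cone {y}, Cone {x, y}}"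
    using assms(1) unfolding fan_of_explicit by (elim exE)
  then have xy: "adj G x y" and \<sigma>: "\<sigma> \<in> {{0}, Cone {x}, Cone {y}, Cone {x, y}}"
    by blast+
  have "x \<noteq> 0" "y \<noteq> 0" using adjD(3) [OF xy] by auto
  then have "dim (Cone {x}) = 1 \<and> dim (Cone {y}) = 1" by (intro conjI dim_Cone_single)
  then have "\<sigma> = Cone {x, y}" using \<sigma> assms(2) by (elim insertE emptyE) simp_all
  then show ?thesis using xy by blast
qed

text \<open>
  The monoid dual to a maximal cone is generated by the dual basis.  The section \<open>m\<close> of the cone and
  that of the neighbouring cone across a wall differ by \<open>l\<close> times a dual basis vector \<open>e\<close>, where
  \<open>l \<ge> 1\<close> is an integer; as both are sections, so is \<open>m + e\<close>, by convexity.
\<close>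

lemma very_ample_fan_of:
  fixes a :: "real ^ 2 \<Rightarrow> int"
  assumes G: "complete_rays G" and a: "strictly_convex G (\<lambda>g. of_int (a g))"
  shows "very_ample (fan_of G) a"
  unfolding very_ample_def
proof (intro ballI impI)
  fix \<sigma> assume "\<sigma> \<in> fan_of G" "dim \<sigma> = CARD(2)"
  then obtain x y where xy: "adj G x y" and \<sigma>: "\<sigma> = Cone {x, y}"
    using fan_of_two_dim [of \<sigma> G] by auto
  have xy1: "wedge x y = 1" and yx: "wedge y x = -1" using adjD(3,4) [OF xy] by auto
  have L: "x \<in> lattice" "y \<in> lattice" using adjD(1,2) [OF xy] complete_raysD(2) [OF G] by auto
  obtain p s where p: "adj G p x" and s: "adj G y s"
    using adj_exists [OF G] adjD(1,2) [OF xy] by blast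
  let ?a = "\<lambda>g. real_of_int (a g)"
  define w where "w = support_form ?a x y"
  have wL: "w \<in> lattice" unfolding w_def support_form_def
    by (intro lattice_diff lattice_scale L) auto
  note global = strictly_convex_global [OF G a]
  have sec: "covec u \<in> sections (fan_of G) a \<longleftrightarrow> (\<forall>g\<in>G. - ?a g \<le> wedge u g)" if "u \<in> lattice" for u
    using covec_lattice [OF that] by (simp add: sections_def gens_fan_of [OF G])
  have m: "covec w \<in> sections (fan_of G) a"
  proof (rule sec [OF wL, THEN iffD2], rule ballI)
    show "- ?a g \<le> wedge w g" if "g \<in> G" for g
      unfolding w_def by (rule global [OF xy that])
  qed
  have step: "- ?a g \<le> wedge w g + t" if "g \<in> G" "- ?a g \<le> wedge w g + l * t" "1 \<le> l" for g t l
  proof (cases "0 \<le> t")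
    case True
    then show ?thesis using global [OF xy that(1)] by (simp add: w_def)
  next
    case False
    then have "l * t \<le> 1 * t" using that(3) by (intro mult_right_mono_neg) auto
    then show ?thesis using that(2) by linarith
  qed
  have m1: "covec w + covec (- y) \<in> sections (fan_of G) a"
  proof -
    let ?l = "?a x + ?a s - wedge x s * ?a y"
    have "0 < ?l" by (rule strictly_convexD [OF a xy s])
    moreover have "?l \<in> \<int>"
      using wedge_lattice [of x s] L complete_raysD(2) [OF G adjD(2) [OF s]] by simp
    ultimately have l: "1 \<le> ?l" by (rule Ints_pos [rotated])
    have "- ?a g \<le> wedge w g + wedge g y" if "g \<in> G" for g
      using global [OF s that] unfolding support_form_succ [OF xy s] w_def [symmetric]
      by (rule step [OF that _ l])
    then have "covec (w - y) \<in> sections (fan_of G) a"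
      unfolding sec [OF lattice_diff [OF wL L(2)]] using wedge_swap [of y] by simp
    moreover have "covec (w - y) = covec w + covec (- y)"
      by (simp add: covec_def vec_eq_iff forall_2)
    ultimately show ?thesis by simp
  qed
  have m2: "covec w + covec x \<in> sections (fan_of G) a"
  proof -
    let ?l = "?a p + ?a y - wedge p y * ?a x"
    have "0 < ?l" by (rule strictly_convexD [OF a p xy])
    moreover have "?l \<in> \<int>"
      using wedge_lattice [of p y] L complete_raysD(2) [OF G adjD(1) [OF p]] by simp
    ultimately have l: "1 \<le> ?l" by (rule Ints_pos [rotated])
    have "- ?a g \<le> wedge w g + wedge x g" if "g \<in> G" for g
      using global [OF p that] unfolding support_form_pred [OF p xy] w_def [symmetric]
      by (rule step [OF that _ l])
    then have "covec (w + x) \<in> sections (fan_of G) a"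
      unfolding sec [OF lattice_add [OF wL L(1)]] by simp
    moreover have "covec (w + x) = covec w + covec x"
      by (simp add: covec_def vec_eq_iff forall_2)
    ultimately show ?thesis by simp
  qed
  have wxy: "wedge w x = - ?a x" "wedge w y = - ?a y"
    using xy1 yx by (simp_all add: w_def support_form_def)
  show "\<exists>m\<in>sections (fan_of G) a. (\<forall>g\<in>gens (fan_of G) \<inter> \<sigma>. m \<bullet> g = - of_int (a g)) \<and>
      {sum_list us | us. set us \<subseteq> (\<lambda>u. u - m) ` sections (fan_of G) a} =
      {u \<in> lattice. \<forall>v\<in>\<sigma>. 0 \<le> u \<bullet> v}"
  proof (rule bexI [OF _ m], intro conjI)
    have "g = x \<or> g = y" if "g \<in> G" "g \<in> \<sigma>" for g
      using adjD(5) [OF xy that(1)] that(2) unfolding \<sigma> Cone_pair [OF xy1] by blast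
    then show "\<forall>g\<in>gens (fan_of G) \<inter> \<sigma>. covec w \<bullet> g = - of_int (a g)"
      unfolding gens_fan_of [OF G] using wxy by auto
    let ?S = "(\<lambda>u. u - covec w) ` sections (fan_of G) a"
    let ?D = "{u \<in> lattice. \<forall>v\<in>\<sigma>. 0 \<le> u \<bullet> v}"
    show "{sum_list us | us. set us \<subseteq> ?S} = ?D"
    proof
      have "u \<in> ?D" if u: "u \<in> ?S" for u
      proof -
        obtain u' where u': "u' \<in> sections (fan_of G) a" "u = u' - covec w" using u by blast
        have lat: "u \<in> lattice"
          using u' covec_lattice [OF wL] by (auto simp: sections_def intro: lattice_diff)
        have "- ?a x \<le> u' \<bullet> x" "- ?a y \<le> u' \<bullet> y"
          using u'(1) adjD(1,2) [OF xy] by (auto simp: sections_def gens_fan_of [OF G])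
        then have nn: "0 \<le> u \<bullet> x" "0 \<le> u \<bullet> y" using wxy
          by (auto simp: u'(2) inner_diff_left)
        have "0 \<le> u \<bullet> v" if "v \<in> \<sigma>" for v
        proof -
          have "u \<bullet> v = u \<bullet> (wedge v y *\<^sub>R x + wedge x v *\<^sub>R y)"
            using wedge_expand [OF xy1, of v] by (rule arg_cong)
          then show ?thesis using that nn unfolding \<sigma> Cone_pair [OF xy1]
            by (simp add: inner_add_right)
        qed
        then show ?thesis using lat by blast
      qed
      then have sub: "?S \<subseteq> ?D" by blast
      have "sum_list us \<in> ?D" if "set us \<subseteq> ?D" for us
        using that by (induction us) (auto simp: lattice_zero inner_add_left intro: lattice_add)
      then show "{sum_list us | us. set us \<subseteq> ?S} \<subseteq> ?D" using sub by blast
    next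
      show "?D \<subseteq> {sum_list us | us. set us \<subseteq> ?S}"
      proof
        fix u assume u: "u \<in> ?D"
        obtain z where z: "z \<in> lattice" "u = covec z" using covec_surj u by blast
        have "x \<in> \<sigma>" "y \<in> \<sigma>" unfolding \<sigma> by (auto intro: hull_inc)
        then have "0 \<le> wedge z x" "0 \<le> wedge z y" using u z(2) by auto
        then obtain i j where i: "wedge z x = real i" and j: "wedge z y = real j"
          using wedge_lattice [OF z(1)] L by (metis Nats_cases Nats_altdef2 mem_Collect_eq)
        let ?us = "replicate i (covec (- y)) @ replicate j (covec x)"
        have "z = wedge z y *\<^sub>R x + wedge x z *\<^sub>R y" by (rule wedge_expand [OF xy1])
        then have "z = real j *\<^sub>R x - real i *\<^sub>R y" using i j wedge_swap [of x z] by simp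
        then have "u = sum_list ?us"
          unfolding z(2) by (simp add: sum_list_replicate_scaleR covec_def vec_eq_iff forall_2)
        moreover have "covec (- y) \<in> ?S" "covec x \<in> ?S"
          using m1 m2 by (metis (no_types, lifting) add_diff_cancel_left' image_eqI)+
        then have "set ?us \<subseteq> ?S" by auto
        ultimately show "u \<in> {sum_list us | us. set us \<subseteq> ?S}" by blast
      qed
    qed
  qed
qed

text \<open>
  The triangle inequality for \<open>p + s = wedge p s *\<^sub>R v\<close> is strict, since \<open>p\<close> and \<open>s\<close> lie on different
  sides of the line of \<open>v\<close>.
\<close>

lemma norm_strictly_convex:
  assumes "adj G p v" "adj G v s"
  shows "wedge p s * norm v < norm p + norm s"
proof -
  have "wedge p s * norm v \<le> norm (wedge p s *\<^sub>R v)"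
    by (simp add: mult_right_mono)
  also have "\<dots> = norm (p + s)" using adj_sum [OF assms] by simp
  also have "\<dots> < norm p + norm s"
  proof (rule ccontr)
    assume "\<not> norm (p + s) < norm p + norm s"
    then have "norm (p + s) = norm p + norm s" using norm_triangle_ineq [of p s] by linarith
    then have "norm p *\<^sub>R s = norm s *\<^sub>R p" by (simp add: norm_triangle_eq)
    then have "wedge v (norm p *\<^sub>R s) = wedge v (norm s *\<^sub>R p)" by (rule arg_cong)
    then have "norm p = - norm s" using adjD(3) [OF assms(2)] adjD(4) [OF assms(1)] by simp
    then have "norm p = 0" using norm_ge_zero [of p] norm_ge_zero [of s] by linarith
    then show False using adjD(3) [OF assms(1)] by simp
  qed
  finally show ?thesis .
qed

text \<open>
  Rounding up a large multiple of the norm keeps it strictly convex, since there are only finitely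
  many rays.
\<close>

lemma projective_fan_of:
  assumes G: "complete_rays G"
  shows "projective_fan (fan_of G)"
proof -
  let ?T = "{(p, v, s). adj G p v \<and> adj G v s}"
  have "?T \<subseteq> G \<times> G \<times> G" by (auto dest: adjD)
  then have fin: "finite ?T" using complete_raysD(1) [OF G] finite_subset by blast
  have "\<forall>t\<in>?T. eventually (\<lambda>M. case t of (p, v, s) \<Rightarrow>
      \<bar>wedge p s\<bar> < M * (norm p + norm s - wedge p s * norm v)) at_top"
  proof (clarify)
    fix p v s assume "adj G p v" "adj G v s"
    then have "0 < norm p + norm s - wedge p s * norm v" using norm_strictly_convex
      by (simp add: algebra_simps)
    then show "eventually (\<lambda>M. \<bar>wedge p s\<bar> < M * (norm p + norm s - wedge p s * norm v)) at_top"
      using eventually_gt_at_top [of "\<bar>wedge p s\<bar> / (norm p + norm s - wedge p s * norm v)"]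
      by (simp add: pos_divide_less_eq)
  qed
  then have "eventually (\<lambda>M. \<forall>t\<in>?T. case t of (p, v, s) \<Rightarrow>
      \<bar>wedge p s\<bar> < M * (norm p + norm s - wedge p s * norm v)) at_top"
    by (rule eventually_ball_finite [OF fin])
  then obtain M :: real where M: "\<And>p v s. adj G p v \<Longrightarrow> adj G v s \<Longrightarrow>
      \<bar>wedge p s\<bar> < M * (norm p + norm s - wedge p s * norm v)"
    by (force dest: eventually_happens)
  define a where "a g = \<lceil>M * norm g\<rceil>" for g :: "real ^ 2"
  have "strictly_convex G (\<lambda>g. of_int (a g))"
    unfolding strictly_convex_def
  proof (intro allI impI)
    fix p v s assume "adj G p v \<and> adj G v s"
    then have M': "\<bar>wedge p s\<bar> < M * (norm p + norm s - wedge p s * norm v)" using M by blast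
    \<comment> \<open>The rounding error at \<open>v\<close>, whose effect \<open>M\<close> was chosen to outweigh.\<close>
    define e where "e = of_int (a v) - M * norm v"
    have "0 \<le> e" "e \<le> 1" unfolding e_def a_def by linarith+
    then have "wedge p s * e \<le> \<bar>wedge p s\<bar> * 1"
      by (metis abs_ge_self abs_mult abs_of_nonneg mult_left_mono abs_ge_zero order_trans)
    moreover have "wedge p s * of_int (a v) = wedge p s * e + M * (wedge p s * norm v)"
      by (simp add: e_def algebra_simps)
    moreover have "M * norm p \<le> of_int (a p)" "M * norm s \<le> of_int (a s)" unfolding a_def
      by linarith+
    ultimately show "wedge p s * of_int (a v) < of_int (a p) + of_int (a s)"
      using M' by (simp add: algebra_simps)
  qed
  then have "very_ample (fan_of G) a" by (rule very_ample_fan_of [OF G])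
  then have "ample (fan_of G) a" unfolding ample_def by (intro exI [of _ 1]) simp
  then show ?thesis unfolding projective_fan_def using complete_fan_of [OF G] by blast
qed

section \<open>Fano and weak Fano conditions as bounds on the wall relations\<close>

text \<open>
  The curve of the ray of \<open>v\<close> has anticanonical degree \<open>2 - wedge p s\<close>.
\<close>

definition wall_bound :: "real \<Rightarrow> (real ^ 2) set \<Rightarrow> bool" where
  "wall_bound c G \<longleftrightarrow> (\<forall>p v s. adj G p v \<longrightarrow> adj G v s \<longrightarrow> wedge p s \<le> c)"

text \<open>
  For the converse direction let \<open>m\<close> be the section of a multiple \<open>- k K\<close> attached to the cone on
  \<open>p, v\<close>.  If \<open>wedge p s \<ge> 2\<close>, then \<open>m \<bullet> s \<le> - k\<close>, so every difference \<open>u - m\<close> with a section \<open>u\<close> is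
  nonnegative on \<open>s\<close>.  But the dual basis vector that vanishes on \<open>v\<close> is negative on \<open>s\<close> and cannot
  be a sum of such differences.
\<close>

lemma ample_anticanonical_iff:
  assumes G: "complete_rays G"
  shows "ample (fan_of G) anticanonical \<longleftrightarrow> wall_bound 1 G"
proof
  assume "wall_bound 1 G"
  then have "strictly_convex G (\<lambda>g. of_int (anticanonical g))"
    by (fastforce simp: strictly_convex_def wall_bound_def anticanonical_def)
  then have "very_ample (fan_of G) anticanonical" by (rule very_ample_fan_of [OF G])
  then show "ample (fan_of G) anticanonical" unfolding ample_def by (intro exI [of _ 1]) simp
next
  assume "ample (fan_of G) anticanonical"
  then obtain k :: nat where k: "very_ample (fan_of G) (\<lambda>g. int k)"
    by (auto simp: ample_def anticanonical_def)
  show "wall_bound 1 G"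
    unfolding wall_bound_def
  proof (intro allI impI, rule ccontr)
    fix p v s assume pv: "adj G p v" and vs: "adj G v s" and "\<not> wedge p s \<le> 1"
    have lat: "p \<in> lattice" "v \<in> lattice" "s \<in> lattice"
      using complete_raysD(2) [OF G] adjD(1,2) [OF pv] adjD(2) [OF vs] by auto
    then have ps: "2 \<le> wedge p s"
      using Ints_pos [of "wedge p s - 1"] wedge_lattice [of p s] \<open>\<not> wedge p s \<le> 1\<close>
      by simp
    have "Cone {p, v} \<in> fan_of G" by (rule fan_ofI [OF pv]) simp
    moreover have "dim (Cone {p, v}) = CARD(2)" using dim_Cone_pair [OF adjD(3) [OF pv]] by simp
    ultimately obtain m where
      mg: "\<forall>g\<in>gens (fan_of G) \<inter> Cone {p, v}. m \<bullet> g = - of_int (int k)" and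
      gen: "{sum_list us | us. set us \<subseteq> (\<lambda>u. u - m) ` sections (fan_of G) (\<lambda>g. int k)} =
        {u \<in> lattice. \<forall>x\<in>Cone {p, v}. 0 \<le> u \<bullet> x}"
      using k unfolding very_ample_def by blast
    have "p \<in> Cone {p, v}" "v \<in> Cone {p, v}" by (auto intro: hull_inc)
    then have m: "m \<bullet> p = - real k" "m \<bullet> v = - real k"
      using mg adjD(1,2) [OF pv] unfolding gens_fan_of [OF G] by auto
    have s: "s = wedge p s *\<^sub>R v - p" using adj_sum [OF pv vs] by (simp add: algebra_simps)
    have "m \<bullet> s = m \<bullet> (wedge p s *\<^sub>R v - p)" using s by (rule arg_cong)
    then have "m \<bullet> s = real k * (1 - wedge p s)" using m
      by (simp add: inner_diff_right algebra_simps)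
    moreover have "real k * (1 - wedge p s) \<le> real k * -1" using ps by (intro mult_left_mono) auto
    ultimately have ms: "m \<bullet> s \<le> - real k" by simp
    have nonneg: "0 \<le> u \<bullet> s" if "u \<in> (\<lambda>u. u - m) ` sections (fan_of G) (\<lambda>g. int k)" for u
      using that ms adjD(2) [OF vs] by (auto simp: sections_def gens_fan_of [OF G] inner_diff_left)
    have "covec (- v) \<in> {u \<in> lattice. \<forall>x\<in>Cone {p, v}. 0 \<le> u \<bullet> x}"
      using covec_lattice [OF lattice_minus [OF lat(2)]] wedge_swap [of v]
      unfolding Cone_pair [OF adjD(3) [OF pv]] by simp
    then obtain us where us: "covec (- v) = sum_list us"
      "set us \<subseteq> (\<lambda>u. u - m) ` sections (fan_of G) (\<lambda>g. int k)"
      unfolding gen [symmetric] by blast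
    have "0 \<le> sum_list us \<bullet> s" using us(2) nonneg
      by (induction us) (auto simp: inner_add_left)
    then show False using us(1) [symmetric] adjD(3) [OF vs] by simp
  qed
qed

text \<open>
  The two cones that contain the ray \<open>\<tau>\<close> of an invariant curve are those of its neighbours in the
  ray system, and the relation \<open>p + s = wedge p s *\<^sub>R v\<close> fixes the remaining intersection number.
\<close>

lemma invariant_curve_class_degree:
  assumes G: "complete_rays G" and c: "invariant_curve_class (fan_of G) c"
  shows "\<exists>p v s. adj G p v \<and> adj G v s \<and> (\<Sum>g\<in>G. c g) = 2 - wedge p s"
proof -
  note gG = gens_fan_of [OF G]
  obtain \<tau> x x' where \<tau>: "\<tau> \<in> fan_of G" "dim \<tau> = 1" and x: "x \<in> G" "x \<notin> \<tau>" "x' \<in> G" "x' \<notin> \<tau>" "x \<noteq> x'"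
    and C: "Cone (insert x \<tau>) \<in> fan_of G" "Cone (insert x' \<tau>) \<in> fan_of G"
    and cx: "c x = 1" "c x' = 1" and c0: "\<And>g. g \<notin> (G \<inter> \<tau>) \<union> {x, x'} \<Longrightarrow> c g = 0"
    and rel: "(\<Sum>g\<in>G. c g *\<^sub>R g) = 0"
    using c unfolding invariant_curve_class_def gG by auto
  obtain u w where "adj G u w \<and> \<tau> \<in> {{0}, Cone {u}, Cone {w}, Cone {u, w}}"
    using \<tau>(1) unfolding fan_of_explicit by (elim exE)
  then have uw: "adj G u w" and \<tau>': "\<tau> \<in> {{0}, Cone {u}, Cone {w}, Cone {u, w}}" by blast+
  have "dim (Cone {u, w}) = 2" by (rule dim_Cone_pair [OF adjD(3) [OF uw]])
  then have "\<tau> \<in> {Cone {u}, Cone {w}}" using \<tau>' \<tau>(2) by (elim insertE emptyE) simp_all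
  then obtain v where v: "v \<in> G" "\<tau> = Cone {v}" using adjD(1,2) [OF uw] by blast
  have vt: "v \<in> \<tau>" unfolding v(2) by (rule hull_inc) simp
  have nb: "adj G y v \<or> adj G v y" if y: "y \<in> G" "y \<notin> \<tau>" "Cone (insert y \<tau>) \<in> fan_of G" for y
  proof -
    obtain a b where "adj G a b \<and> Cone (insert y \<tau>) \<in> {{0}, Cone {a}, Cone {b}, Cone {a, b}}"
      using y(3) unfolding fan_of_explicit by (elim exE)
    then have ab: "adj G a b" and D: "Cone (insert y \<tau>) \<in> {{0}, Cone {a}, Cone {b}, Cone {a, b}}" by blast+
    have "Cone {a} \<subseteq> Cone {a, b}" "Cone {b} \<subseteq> Cone {a, b}" "{0} \<subseteq> Cone {a, b}"
      by (auto intro: hull_mono [THEN subsetD] convex_cone_hull_contains_0)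
    then have "Cone (insert y \<tau>) \<subseteq> Cone {a, b}" using D by (elim insertE emptyE) simp_all
    moreover have "y \<in> Cone (insert y \<tau>)" "v \<in> Cone (insert y \<tau>)"
      using vt by (auto intro: hull_inc)
    ultimately have in_ab: "y \<in> Cone {a, b}" "v \<in> Cone {a, b}" by blast+
    then have "y = a \<or> y = b" "v = a \<or> v = b"
      using adjD(5) [OF ab y(1)] adjD(5) [OF ab v(1)] unfolding Cone_pair [OF adjD(3) [OF ab]] by auto
    moreover have "y \<noteq> v" using y(2) vt by auto
    ultimately show ?thesis using ab by blast
  qed
  have nx: "adj G x v \<or> adj G v x" by (rule nb) fact+
  have nx': "adj G x' v \<or> adj G v x'" by (rule nb) fact+
  have nxx: "\<not> (adj G x v \<and> adj G x' v)" "\<not> (adj G v x \<and> adj G v x')"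
    using adj_pred_unique adj_succ_unique x(5) by blast+
  then obtain p s where ps: "adj G p v" "adj G v s" "{p, s} = {x, x'}"
    using nx nx' by (metis insert_commute)
  have Gt: "g = v" if "g \<in> G" "g \<in> \<tau>" for g
  proof -
    have "g \<in> Cone {v}" using that v by simp
    then have "wedge v g = 0 \<and> 0 \<le> wedge g s" unfolding Cone_left [OF adjD(3) [OF ps(2)]]
      by blast
    then have "g = v \<or> g = s" using adjD(5) [OF ps(2) that(1)] by simp
    moreover have "wedge v s = 1" using adjD(3) [OF ps(2)] .
    ultimately show ?thesis using \<open>wedge v g = 0 \<and> 0 \<le> wedge g s\<close> by auto
  qed
  have ne: "p \<noteq> s" "p \<noteq> v" "s \<noteq> v"
    using ps(3) x(2,4,5) vt unfolding doubleton_eq_iff by blast+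
  have inG: "{p, v, s} \<subseteq> G" using ps(1,2) by (auto dest: adjD)
  have cps: "c p = 1" "c s = 1" using ps(3) cx unfolding doubleton_eq_iff by blast+
  have zero: "c g = 0" if "g \<in> G - {p, v, s}" for g
    using c0 [of g] Gt [of g] that ps(3) by blast
  note restrict = sum.mono_neutral_right [OF complete_raysD(1) [OF G] inG]
  have "(\<Sum>g\<in>G. c g *\<^sub>R g) = (\<Sum>g\<in>{p, v, s}. c g *\<^sub>R g)" using zero
    by (intro restrict) auto
  then have "c v *\<^sub>R v + (p + s) = 0" using rel ne cps by (simp add: algebra_simps)
  then have "wedge (c v *\<^sub>R v + (p + s)) s = wedge 0 s" by (rule arg_cong)
  then have "c v = - wedge p s" using adjD(3) [OF ps(2)] by simp
  moreover have "(\<Sum>g\<in>G. c g) = (\<Sum>g\<in>{p, v, s}. c g)" using zero by (intro restrict) auto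
  ultimately have "(\<Sum>g\<in>G. c g) = 2 - wedge p s" using ne cps by simp
  then show ?thesis using ps(1,2) by blast
qed

lemma invariant_curve_class_exists:
  assumes G: "complete_rays G" and pv: "adj G p v" and vs: "adj G v s"
  shows "\<exists>c. invariant_curve_class (fan_of G) c \<and> (\<Sum>g\<in>G. c g) = 2 - wedge p s"
proof -
  have ne: "p \<noteq> v" "s \<noteq> v" "p \<noteq> s"
    using adjD(3) [OF pv] adjD(3) [OF vs] adjD(4) [OF pv] by auto
  define c where "c = (\<lambda>g. if g = p \<or> g = s then 1 else if g = v then - wedge p s else 0)"
  have inG: "{p, v, s} \<subseteq> G" using pv vs by (auto dest: adjD)
  note restrict = sum.mono_neutral_right [OF complete_raysD(1) [OF G] inG]
  have "(\<Sum>g\<in>G. c g *\<^sub>R g) = (\<Sum>g\<in>{p, v, s}. c g *\<^sub>R g)"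
    by (intro restrict) (auto simp: c_def)
  also have "\<dots> = p + s - wedge p s *\<^sub>R v" using ne by (simp add: c_def algebra_simps)
  also have "\<dots> = 0" using adj_sum [OF pv vs] by simp
  finally have rel: "(\<Sum>g\<in>G. c g *\<^sub>R g) = 0" .
  have "(\<Sum>g\<in>G. c g) = (\<Sum>g\<in>{p, v, s}. c g)" by (intro restrict) (auto simp: c_def)
  then have deg: "(\<Sum>g\<in>G. c g) = 2 - wedge p s" using ne by (simp add: c_def)
  have p: "p \<notin> Cone {v}" unfolding Cone_right [OF adjD(3) [OF pv]] using adjD(3) [OF pv] by simp
  have s: "s \<notin> Cone {v}" unfolding Cone_left [OF adjD(3) [OF vs]] using adjD(3) [OF vs] by simp
  have t: "Cone {v} \<in> fan_of G" by (rule fan_ofI [OF pv]) simp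
  have "v \<noteq> 0" using adjD(3) [OF pv] by auto
  then have d: "dim (Cone {v}) = CARD(2) - 1" using dim_Cone_single by simp
  have C: "Cone (insert p (Cone {v})) \<in> fan_of G" "Cone (insert s (Cone {v})) \<in> fan_of G"
    unfolding Cone_insert_Cone using fan_ofI [OF pv, of "Cone {p, v}"] fan_ofI [OF vs, of "Cone {v, s}"]
    by (simp_all add: insert_commute)
  have "v \<in> G \<inter> Cone {v}" using inG by (auto intro: hull_inc)
  then have c0: "\<forall>g. g \<notin> G \<inter> Cone {v} \<union> {p, s} \<longrightarrow> c g = 0"
    by (auto simp: c_def)
  have "invariant_curve_class (fan_of G) c"
    unfolding invariant_curve_class_def gens_fan_of [OF G]
    by (rule bexI [OF _ t], rule bexI [of _ p], rule bexI [of _ s])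
       (use d ne C c0 rel p s inG in \<open>simp_all add: c_def\<close>)
  then show ?thesis using deg by blast
qed

lemma nef_anticanonical_iff:
  assumes G: "complete_rays G"
  shows "nef (fan_of G) anticanonical \<longleftrightarrow> wall_bound 2 G"
proof
  assume nef: "nef (fan_of G) anticanonical"
  show "wall_bound 2 G"
    unfolding wall_bound_def
  proof (intro allI impI)
    fix p v s assume "adj G p v" "adj G v s"
    then obtain c where c: "invariant_curve_class (fan_of G) c" "(\<Sum>g\<in>G. c g) = 2 - wedge p s"
      using invariant_curve_class_exists [OF G] by blast
    have "c \<in> NE (fan_of G)"
      unfolding NE_def using c(1) by (intro CollectI exI [of _ "{c}"] exI [of _ "\<lambda>_. 1"]) auto
    then have "0 \<le> (\<Sum>g\<in>G. c g)"
      using nef by (simp add: nef_def anticanonical_def gens_fan_of [OF G])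
    then show "wedge p s \<le> 2" using c(2) by simp
  qed
next
  assume deg: "wall_bound 2 G"
  have pos: "0 \<le> (\<Sum>g\<in>G. c g)" if c: "invariant_curve_class (fan_of G) c" for c
  proof -
    obtain p v s where "adj G p v" "adj G v s" "(\<Sum>g\<in>G. c g) = 2 - wedge p s"
      using invariant_curve_class_degree [OF G c] by blast
    moreover from this have "wedge p s \<le> 2" using deg unfolding wall_bound_def by blast
    ultimately show ?thesis by simp
  qed
  show "nef (fan_of G) anticanonical"
    unfolding nef_def
  proof
    fix c assume "c \<in> NE (fan_of G)"
    then obtain F w where c: "c = (\<lambda>g. \<Sum>d\<in>F. w d * d g)"
      and F: "\<forall>d\<in>F. invariant_curve_class (fan_of G) d \<and> 0 \<le> w d"
      by (auto simp: NE_def)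
    have "0 \<le> (\<Sum>d\<in>F. w d * (\<Sum>g\<in>G. d g))"
    proof (rule sum_nonneg)
      show "0 \<le> w d * (\<Sum>g\<in>G. d g)" if "d \<in> F" for d using that F pos by simp
    qed
    also have "\<dots> = (\<Sum>g\<in>G. c g)"
      unfolding c by (simp add: sum.swap [of _ F] sum_distrib_left)
    finally show "0 \<le> (\<Sum>g\<in>gens (fan_of G). of_int (anticanonical g) * c g)"
      by (simp add: anticanonical_def gens_fan_of [OF G])
  qed
qed

text \<open>
  Every vector is a nonnegative combination of two generators, so on each vector the sections are
  bounded below; applied to \<open>\<plusminus>\<close> the standard basis this bounds their coordinates.
\<close>

lemma finite_sections:
  assumes G: "complete_rays G"
  shows "finite (sections (fan_of G) a)"
proof -
  let ?S = "sections (fan_of G) a"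
  have low: "\<exists>K. \<forall>m\<in>?S. - K \<le> m \<bullet> w" for w
  proof -
    obtain x y where xy: "adj G x y" "0 \<le> wedge x w" "0 \<le> wedge w y"
      using complete_raysD(3) [OF G] by blast
    have "- (wedge w y * of_int (a x) + wedge x w * of_int (a y)) \<le> m \<bullet> w" if "m \<in> ?S" for m
    proof -
      have "m \<bullet> w = m \<bullet> (wedge w y *\<^sub>R x + wedge x w *\<^sub>R y)"
        using wedge_expand [OF adjD(3) [OF xy(1)], of w] by (rule arg_cong)
      moreover have "- of_int (a x) \<le> m \<bullet> x" "- of_int (a y) \<le> m \<bullet> y"
        using that adjD(1,2) [OF xy(1)] by (auto simp: sections_def gens_fan_of [OF G])
      then have "wedge w y * - of_int (a x) \<le> wedge w y * (m \<bullet> x)"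
        "wedge x w * - of_int (a y) \<le> wedge x w * (m \<bullet> y)"
        using xy(2,3) by (intro mult_left_mono; simp)+
      ultimately show ?thesis by (simp add: inner_add_right)
    qed
    then show ?thesis by blast
  qed
  have bd: "\<exists>K. \<forall>m\<in>?S. \<bar>m $ i\<bar> \<le> K" for i
  proof -
    obtain K where "\<forall>m\<in>?S. - K \<le> m \<bullet> axis i 1" using low [of "axis i 1"] by blast
    moreover obtain K' where "\<forall>m\<in>?S. - K' \<le> m \<bullet> (- axis i 1)"
      using low [of "- axis i 1"] by blast
    ultimately have "\<bar>m $ i\<bar> \<le> max K K'" if "m \<in> ?S" for m
      using that by (force simp: inner_axis)
    then show ?thesis by blast
  qed
  obtain K K' where K: "\<forall>m\<in>?S. \<bar>m $ 1\<bar> \<le> K" "\<forall>m\<in>?S. \<bar>m $ 2\<bar> \<le> K'"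
    using bd [of 1] bd [of 2] by blast
  let ?I = "{-\<lceil>K\<rceil>..\<lceil>K\<rceil>} \<times> {-\<lceil>K'\<rceil>..\<lceil>K'\<rceil>}"
  have "?S \<subseteq> (\<lambda>(i, j). vector [of_int i, of_int j]) ` ?I"
  proof
    fix m assume m: "m \<in> ?S"
    then have "m $ 1 \<in> \<int>" "m $ 2 \<in> \<int>" by (simp_all add: sections_def lattice_def)
    then obtain i j where ij: "m $ 1 = of_int i" "m $ 2 = of_int j" by (elim Ints_cases)
    have "m = vector [of_int i, of_int j]" using ij by (simp add: vec_eq_iff forall_2)
    moreover have "\<bar>real_of_int i\<bar> \<le> K" "\<bar>real_of_int j\<bar> \<le> K'" using K m ij
      by auto
    then have "(i, j) \<in> ?I" unfolding mem_Sigma_iff atLeastAtMost_iff by linarith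
    ultimately show "m \<in> (\<lambda>(i, j). vector [of_int i, of_int j]) ` ?I"
      by (intro image_eqI [of _ _ "(i, j)"]) simp_all
  qed
  then show ?thesis by (rule finite_subset) auto
qed

text \<open>
  If \<open>B\<close> bounds the \<open>l\<^sup>1\<close>-norm of the generators, then all lattice points with coordinates in
  \<open>[0, k / B]\<close> are sections of \<open>- k K\<close>.
\<close>

lemma big_anticanonical:
  assumes G: "complete_rays G"
  shows "big (fan_of G) anticanonical"
proof -
  define B where "B = (\<Sum>g\<in>G. \<bar>g $ 1\<bar> + \<bar>g $ 2\<bar>) + 1"
  have B: "\<bar>g $ 1\<bar> + \<bar>g $ 2\<bar> \<le> B" if "g \<in> G" for g
    using member_le_sum [OF that, of "\<lambda>g. \<bar>g $ 1\<bar> + \<bar>g $ 2\<bar>"] complete_raysD(1) [OF G] by (simp add: B_def)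
  have B0: "0 < B" unfolding B_def by (intro add_nonneg_pos sum_nonneg) auto
  have count: "(1 / B\<^sup>2) * real k ^ 2 \<le> real (card (sections (fan_of G) (\<lambda>g. int k * anticanonical g)))" for k
  proof -
    define r where "r = nat \<lfloor>real k / B\<rfloor>"
    have r: "real r \<le> real k / B" "real k / B \<le> real r + 1"
      using B0 by (simp_all add: r_def) 
    let ?f = "\<lambda>(i, j). vector [real i, real j] :: real ^ 2"
    let ?S = "sections (fan_of G) (\<lambda>g. int k * anticanonical g)"
    have inj: "inj_on ?f ({0..r} \<times> {0..r})"
      by (auto simp: inj_on_def vec_eq_iff forall_2)
    have "?f ` ({0..r} \<times> {0..r}) \<subseteq> ?S"
    proof clarify
      fix i j assume ij: "i \<in> {0..r}" "j \<in> {0..r}"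
      have "- real k \<le> real i * g $ 1 + real j * g $ 2" if "g \<in> G" for g
      proof -
        have "\<bar>real i * g $ 1\<bar> \<le> real r * \<bar>g $ 1\<bar>" "\<bar>real j * g $ 2\<bar> \<le> real r * \<bar>g $ 2\<bar>"
          using ij by (auto simp: abs_mult intro: mult_right_mono)
        moreover have "real r * (\<bar>g $ 1\<bar> + \<bar>g $ 2\<bar>) \<le> (real k / B) * B"
          using r(1) B [OF that] B0 by (intro mult_mono) auto
        then have "real r * \<bar>g $ 1\<bar> + real r * \<bar>g $ 2\<bar> \<le> real k"
          using B0 by (simp add: distrib_left)
        ultimately show ?thesis by linarith
      qed
      then show "vector [real i, real j] \<in> ?S"
        by (simp add: sections_def lattice_def forall_2 anticanonical_def gens_fan_of [OF G] inner_vec_def sum_2)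
    qed
    then have "card ({0..r} \<times> {0..r}) \<le> card ?S"
      using card_inj_on_le [OF inj _ finite_sections [OF G]] by blast
    then have "Suc r * Suc r \<le> card ?S" by (simp add: card_cartesian_product)
    then have "real (Suc r * Suc r) \<le> real (card ?S)" by (simp only: of_nat_le_iff)
    then have "(real r + 1) * (real r + 1) \<le> real (card ?S)" by (simp add: algebra_simps)
    moreover have "(real k / B) * (real k / B) \<le> (real r + 1) * (real r + 1)"
      using r B0 by (intro mult_mono) auto
    ultimately show ?thesis by (simp add: power2_eq_square)
  qed
  show ?thesis
    unfolding big_def using B0 count
    by (intro exI [of _ "1 / B\<^sup>2"] conjI always_eventually allI) auto
qed

theorem toric_Fano_iff:
  "complete_rays G \<Longrightarrow> toric_Fano (fan_of G) \<longleftrightarrow> wall_bound 1 G"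
  by (simp add: toric_Fano_def ample_anticanonical_iff nonsingular_fan_of complete_fan_of)

theorem toric_weak_Fano_iff:
  "complete_rays G \<Longrightarrow> toric_weak_Fano (fan_of G) \<longleftrightarrow> wall_bound 2 G"
  by (simp add: toric_weak_Fano_def nef_anticanonical_iff nonsingular_fan_of projective_fan_of
      big_anticanonical)

section \<open>Contraction to a minimal model\<close>

text \<open>
  At the neighbour \<open>s\<close> of \<open>v\<close> with successor \<open>d\<close> the coefficient drops from \<open>wedge v d\<close> to
  \<open>wedge p d = wedge v d - 1\<close>, and similarly at \<open>p\<close>.
\<close>

lemma wall_bound_remove:
  assumes pv: "adj G p v" and vs: "adj G v s" and ps: "wedge p s = 1" and deg: "wall_bound c G"
  shows "wall_bound c (G - {v})"
  unfolding wall_bound_def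
proof (intro allI impI)
  fix a b d assume ab: "adj (G - {v}) a b" and bd: "adj (G - {v}) b d"
  have v: "v = p + s" using adj_sum [OF pv vs] ps by simp
  have deg': "wedge x z \<le> c" if "adj G x y" "adj G y z" for x y z
    using deg that unfolding wall_bound_def by blast
  consider "adj G a b" "adj G b d" | "a = p" "b = s" "adj G s d" | "adj G a p" "b = p" "d = s" | "s = p"
    using ab bd unfolding adj_remove [OF pv vs ps] by blast
  then show "wedge a d \<le> c"
  proof cases
    case 1
    then show ?thesis by (rule deg')
  next
    case 2
    have "wedge p d + 1 \<le> c" using deg' [OF vs 2(3)] adjD(3) [OF 2(3)] unfolding v by simp
    then show ?thesis using 2 by simp
  next
    case 3
    have "1 + wedge a s \<le> c" using deg' [OF 3(1) pv] adjD(3) [OF 3(1)] unfolding v by simp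
    then show ?thesis using 3 by simp
  next
    case 4
    then show ?thesis using ps by simp
  qed
qed

text \<open>
  One equivariant blow-down inside the class of surfaces given by the bound \<open>c\<close>.
\<close>

definition contracts :: "real \<Rightarrow> (real ^ 2) set \<Rightarrow> (real ^ 2) set \<Rightarrow> bool" where
  "contracts c G H \<longleftrightarrow> complete_rays G \<and> wall_bound c G \<and> (\<exists>v. contractible G v \<and> H = G - {v})"

lemma contracts_preserves:
  assumes "contracts c G H"
  shows "complete_rays H" "wall_bound c H" "card H < card G"
proof -
  obtain p v s where ps: "adj G p v" "adj G v s" "wedge p s = 1" and H: "H = G - {v}"
    using assms unfolding contracts_def contractible_def by blast
  have G: "complete_rays G" "wall_bound c G" using assms unfolding contracts_def by blast+
  show "complete_rays H" unfolding H by (rule complete_rays_remove [OF G(1) ps])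
  show "wall_bound c H" unfolding H by (rule wall_bound_remove [OF ps G(2)])
  show "card H < card G"
    unfolding H using adjD(2) [OF ps(1)] complete_raysD(1) [OF G(1)] by (intro card_Diff1_less)
qed

text \<open>
  Used with \<open>K\<close> the Fano surfaces for \<open>c = 1\<close> and the weak Fano surfaces for \<open>c = 2\<close>.
\<close>

lemma contracts_blowups:
  assumes K: "\<And>G. complete_rays G \<Longrightarrow> K (fan_of G) \<longleftrightarrow> wall_bound c G"
    and "(contracts c)\<^sup>*\<^sup>* G H"
  shows "blowups K (fan_of G) (fan_of H)"
  using assms(2)
proof (induction rule: rtranclp_induct)
  case base
  show ?case by (simp add: blowups_def)
next
  case (step H H')
  have "K (fan_of H)" "K (fan_of H')"
    using step(2) K contracts_preserves [OF step(2)] by (auto simp: contracts_def)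
  moreover have "equivariant_blowup (fan_of H) (fan_of H')"
    using step(2) contractible_blowup unfolding contracts_def by blast
  ultimately show ?case
    using step(3) unfolding blowups_def by (auto intro: rtranclp.rtrancl_into_rtrancl)
qed

lemma contracts_rtranclp_preserves:
  assumes "(contracts c)\<^sup>*\<^sup>* G H" "complete_rays G" "wall_bound c G"
  shows "complete_rays H \<and> wall_bound c H"
  using assms by (induction rule: rtranclp_induct) (auto dest: contracts_preserves)

lemma contracts_to_noncontractible:
  assumes "complete_rays G" "wall_bound c G"
  shows "\<exists>H. (contracts c)\<^sup>*\<^sup>* G H \<and> \<not> (\<exists>v. contractible H v)"
  using assms
proof (induction "card G" arbitrary: G rule: less_induct)
  case less
  show ?case
  proof (cases "\<exists>v. contractible G v")
    case True
    then obtain H where H: "contracts c G H" using less.prems unfolding contracts_def by blast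
    then obtain H' where "(contracts c)\<^sup>*\<^sup>* H H'" "\<not> (\<exists>v. contractible H' v)"
      using less.hyps [of H] contracts_preserves [OF H] by blast
    then show ?thesis using H converse_rtranclp_into_rtranclp by metis
  next
    case False
    then show ?thesis by blast
  qed
qed

text \<open>
  If \<open>wedge x v = 1\<close>, these are the rays of the Hirzebruch surface with parameter \<open>\<bar>k\<bar>\<close>; the rays \<open>v\<close> and
  \<open>k x - v\<close> belong to fibres of the ruling.
\<close>

definition hirzebruch :: "real ^ 2 \<Rightarrow> real ^ 2 \<Rightarrow> real \<Rightarrow> (real ^ 2) set" where
  "hirzebruch x v k = {x, v, - x, k *\<^sub>R x - v}"

lemma hirzebruch_swap: "hirzebruch (- x) (k *\<^sub>R x - v) (- k) = hirzebruch x v k"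
  by (auto simp: hirzebruch_def)

lemma hirzebruch_adj:
  assumes xv: "wedge x v = 1"
  shows "adj (hirzebruch x v k) x v" "adj (hirzebruch x v k) v (- x)"
    "adj (hirzebruch x v k) (- x) (k *\<^sub>R x - v)" "adj (hirzebruch x v k) (k *\<^sub>R x - v) x"
  using xv wedge_swap [of v x] by (auto simp: adj_def hirzebruch_def)

text \<open>
  The curve of the ray of \<open>x\<close> is the exceptional section, since \<open>v + (x - v) = x\<close>.
\<close>

lemma hirzebruch_contracts_to_triangle:
  assumes xv: "wedge x v = 1" and H: "complete_rays (hirzebruch x v 1)" "wall_bound c (hirzebruch x v 1)"
  shows "contracts c (hirzebruch x v 1) {v, - x, - v - (- x)}"
proof -
  have w: "wedge (1 *\<^sub>R x - v) v = 1" using xv by simp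
  have "contractible (hirzebruch x v 1) x"
    unfolding contractible_def using hirzebruch_adj(4,1) [OF xv, of 1] w by blast
  moreover have "wedge x x \<noteq> wedge x v" "wedge x v \<noteq> wedge x x" "wedge (- x) v \<noteq> wedge x v" "wedge x (x - v) \<noteq> wedge x x"
    using xv by simp_all
  then have "x \<noteq> v" "- x \<noteq> x" "x - v \<noteq> x" by metis+
  then have "hirzebruch x v 1 - {x} = {v, - x, - v - (- x)}" by (auto simp: hirzebruch_def)
  ultimately show ?thesis unfolding contracts_def using H by metis
qed

text \<open>
  \<open>B\<close> adds to the rays for \<open>k\<close> the vector \<open>z = w - x\<close>, where \<open>w = k x - v\<close>.  Then \<open>z\<close> is the sum of its
  neighbours \<open>-x\<close> and \<open>w\<close>, and \<open>w\<close> is the sum of its neighbours \<open>z\<close> and \<open>x\<close>.  The coefficients at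
  \<open>x, v, -x, z, w\<close> are \<open>k, 0, 1 - k, 1, 1\<close>.
\<close>

lemma elementary_transformation:
  fixes k :: real
  assumes lat: "x \<in> lattice" "v \<in> lattice" "k \<in> \<int>" and xv: "wedge x v = 1"
    and c: "1 \<le> c" "k \<le> c" "1 - k \<le> c"
  shows "\<exists>B. contracts c B (hirzebruch x v k) \<and> contracts c B (hirzebruch x v (k - 1))"
proof -
  define w where "w = k *\<^sub>R x - v"
  define z where "z = (k - 1) *\<^sub>R x - v"
  define B where "B = {x, v, - x, z, w}"
  have vx: "wedge v x = -1" using xv wedge_swap [of v x] by simp
  have xw: "wedge x w = -1" "wedge w x = 1" "wedge v w = - k" "wedge w v = k" using xv vx
    by (simp_all add: w_def)
  have xz: "wedge x z = -1" "wedge z x = 1" "wedge v z = 1 - k" "wedge z v = k - 1"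
    using xv vx by (simp_all add: z_def algebra_simps)
  have zw: "wedge z w = 1" "wedge w z = -1" using xv vx by (simp_all add: w_def z_def algebra_simps)
  note vals = xv vx xw xz zw
  have adjB: "adj B x v" "adj B v (- x)" "adj B (- x) z" "adj B z w" "adj B w x"
    using vals by (auto simp: adj_def B_def)
  have BL: "B \<subseteq> lattice" using lat
    by (auto simp: B_def w_def z_def intro!: lattice_diff lattice_scale lattice_minus)
  have B: "complete_rays B"
    unfolding complete_rays_def
  proof (intro conjI allI)
    show "finite B" by (simp add: B_def)
    show "B \<subseteq> lattice" by (rule BL)
    fix u
    have ux: "wedge u x = - wedge x u" by (rule wedge_swap)
    have vu: "wedge v u = - wedge u v" by (rule wedge_swap)
    have wu: "wedge w u = k * wedge x u + wedge u v" "wedge u w = - (k * wedge x u + wedge u v)"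
      using ux vu by (simp_all add: w_def)
    have zu: "wedge z u = k * wedge x u - wedge x u + wedge u v" "wedge u z = - (k * wedge x u - wedge x u + wedge u v)"
      using ux vu by (simp_all add: z_def algebra_simps)
    consider "0 \<le> wedge x u" "0 \<le> wedge u v" | "0 \<le> wedge v u" "0 \<le> wedge u (- x)"
      | "0 \<le> wedge (- x) u" "0 \<le> wedge u z" | "0 \<le> wedge z u" "0 \<le> wedge u w" | "0 \<le> wedge w u" "0 \<le> wedge u x"
      unfolding wedge_simps wu zu vu ux by linarith
    then show "\<exists>a b. adj B a b \<and> 0 \<le> wedge a u \<and> 0 \<le> wedge u b"
      by cases (use adjB in blast)+
  qed
  have deg: "wall_bound c B"
    unfolding wall_bound_def
  proof (intro allI impI)
    fix p g s assume p: "adj B p g" and s: "adj B g s"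
    consider "g = x" | "g = v" | "g = - x" | "g = z" | "g = w" using adjD(2) [OF p] by (auto simp: B_def)
    then show "wedge p s \<le> c"
    proof cases
      case 1
      then have "p = w" "s = v" using p s adj_pred_unique [OF adjB(5)] adj_succ_unique [OF adjB(1)]
        by auto
      then show ?thesis using vals c by simp
    next
      case 2
      then have "p = x" "s = - x" using p s adj_pred_unique [OF adjB(1)] adj_succ_unique [OF adjB(2)]
        by auto
      then show ?thesis using vals c by simp
    next
      case 3
      then have "p = v" "s = z" using p s adj_pred_unique [OF adjB(2)] adj_succ_unique [OF adjB(3)]
        by auto
      then show ?thesis using vals c by simp
    next
      case 4
      then have "p = - x" "s = w" using p s adj_pred_unique [OF adjB(3)] adj_succ_unique [OF adjB(4)]
        by auto
      then show ?thesis using vals c by simp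
    next
      case 5
      then have "p = z" "s = x" using p s adj_pred_unique [OF adjB(4)] adj_succ_unique [OF adjB(5)]
        by auto
      then show ?thesis using vals c by simp
    qed
  qed
  have ne: "z \<noteq> x" "z \<noteq> v" "z \<noteq> - x" "z \<noteq> w" "w \<noteq> x" "w \<noteq> v" "w \<noteq> - x"
  proof -
    show "z \<noteq> x" "z \<noteq> v" "w \<noteq> x" "w \<noteq> v" using vals
      by (metis one_neq_neg_one wedge_simps(11) zero_neq_neg_one)+
    show "z \<noteq> - x" "w \<noteq> - x" using vals
      by (metis wedge_simps(8,11) add.inverse_neutral zero_neq_neg_one)+
    show "z \<noteq> w" using vals by (metis wedge_simps(11) zero_neq_one)
  qed
  have "contractible B z"
    unfolding contractible_def using adjB(3,4) vals by (intro exI [of _ "- x"] exI [of _ w]) simp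
  moreover have "B - {z} = hirzebruch x v k" using ne by (auto simp: B_def hirzebruch_def w_def)
  ultimately have 1: "contracts c B (hirzebruch x v k)" unfolding contracts_def using B deg by metis
  have "contractible B w"
    unfolding contractible_def using adjB(4,5) vals by (intro exI [of _ z] exI [of _ x]) simp
  moreover have "B - {w} = hirzebruch x v (k - 1)" using ne by (auto simp: B_def hirzebruch_def z_def)
  ultimately have 2: "contracts c B (hirzebruch x v (k - 1))" unfolding contracts_def using B deg
    by metis
  show ?thesis using 1 2 by blast
qed

text \<open>
  For \<open>k = 2\<close> the elementary transformation leads to parameter 1, for \<open>k = 0\<close> to parameter -1, which
  is parameter 1 after exchanging \<open>x\<close> with \<open>-x\<close> and \<open>v\<close> with the opposite fibre.
\<close>

lemma hirzebruch_linked_to_triangle: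
  fixes k :: real
  assumes lat: "x \<in> lattice" "v \<in> lattice" and xv: "wedge x v = 1"
    and k: "k = 0 \<or> k = 2" and c: "1 \<le> c" "k \<le> c"
  shows "\<exists>B a b. (contracts c)\<^sup>*\<^sup>* B (hirzebruch x v k) \<and>
    (contracts c)\<^sup>*\<^sup>* B {a, b, - a - b} \<and> a \<in> lattice \<and> b \<in> lattice \<and> wedge a b = 1"
proof -
  obtain B where B: "contracts c B (hirzebruch x v k)" "contracts c B (hirzebruch x v (k - 1))"
    using elementary_transformation [OF lat _ xv c] c k by auto
  obtain y u where yu: "hirzebruch x v (k - 1) = hirzebruch y u 1" "y \<in> lattice" "u \<in> lattice" "wedge y u = 1"
  proof (cases "k = 2")
    case True
    then show ?thesis using that [of x v] lat xv by simp
  next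
    case False
    then have "k - 1 = -1" using k by simp
    moreover have "hirzebruch x v (- 1) = hirzebruch (- x) (- 1 *\<^sub>R x - v) 1"
      using hirzebruch_swap [of x "-1" v] by simp
    moreover have "wedge (- x) (- 1 *\<^sub>R x - v) = 1" using xv by simp
    moreover have "- x \<in> lattice" "- 1 *\<^sub>R x - v \<in> lattice"
      using lat by (auto intro!: lattice_minus lattice_diff)
    ultimately show ?thesis using that [of "- x" "- 1 *\<^sub>R x - v"] by simp
  qed
  have "contracts c (hirzebruch y u 1) {u, - y, - u - (- y)}"
    using hirzebruch_contracts_to_triangle [OF yu(4)] contracts_preserves(1,2) [OF B(2)] unfolding yu(1)
    by blast
  then have "(contracts c)\<^sup>*\<^sup>* B {u, - y, - u - (- y)}"
    using B(2) unfolding yu(1) by (meson converse_rtranclp_into_rtranclp r_into_rtranclp)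
  moreover have "wedge u (- y) = 1" using yu(4) wedge_swap [of u y] by simp
  ultimately show ?thesis
    using B(1) yu(2,3) lattice_minus [OF yu(2)]
    by (intro exI [of _ B] exI [of _ u] exI [of _ "- y"]) blast
qed

theorem linked_to_triangle:
  assumes G: "complete_rays G" and deg: "wall_bound c G" and c: "1 \<le> c" "c \<le> 2"
  shows "\<exists>A B a b. (contracts c)\<^sup>*\<^sup>* G A \<and> (contracts c)\<^sup>*\<^sup>* B A \<and>
    (contracts c)\<^sup>*\<^sup>* B {a, b, - a - b} \<and> a \<in> lattice \<and> b \<in> lattice \<and> wedge a b = 1"
proof -
  obtain A where A: "(contracts c)\<^sup>*\<^sup>* G A" and nc: "\<not> (\<exists>v. contractible A v)"
    using contracts_to_noncontractible [OF G deg] by blast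
  have cA: "complete_rays A" "wall_bound c A" using contracts_rtranclp_preserves [OF A G deg] by auto
  from ray_system_trichotomy [OF cA(1)] nc
  consider (tri) a b where "a \<in> lattice" "b \<in> lattice" "wedge a b = 1" "A = {a, b, - a - b}"
    | (quad) x v k where "k \<in> \<int>" "x \<in> lattice" "v \<in> lattice" "wedge x v = 1" "A = hirzebruch x v k"
    unfolding hirzebruch_def by blast
  then show ?thesis
  proof cases
    case tri
    then show ?thesis using A by (intro exI [of _ A] exI [of _ a] exI [of _ b]) auto
  next
    case quad
    note adjs = hirzebruch_adj [OF quad(4), of k, folded quad(5)]
    have w: "wedge (k *\<^sub>R x - v) v = k" "wedge v (k *\<^sub>R x - v) = - k"
      using quad(4) wedge_swap [of v x] by simp_all
    have "k \<noteq> 1" "- k \<noteq> 1" using nc adjs w unfolding contractible_def by metis+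
    moreover have "k \<le> c" "- k \<le> c"
      using cA(2) adjs w unfolding wall_bound_def by metis+
    moreover obtain n where n: "k = of_int n" using quad(1) by (auto elim: Ints_cases)
    ultimately have "n = 0 \<or> n = 2 \<or> n = -2" using c by linarith
    then have k: "k = 0 \<or> k = 2 \<or> k = -2" using n by auto
    obtain y u j where yu: "A = hirzebruch y u j" "y \<in> lattice" "u \<in> lattice" "wedge y u = 1"
      "j = 0 \<or> j = 2" "j \<le> c"
    proof (cases "k = -2")
      case True
      have "k *\<^sub>R x - v \<in> lattice" using quad by (intro lattice_diff lattice_scale) auto
      moreover have "wedge (- x) (k *\<^sub>R x - v) = 1" using quad(4) by simp
      ultimately show ?thesis
        using that [of "- x" "k *\<^sub>R x - v" "- k"] hirzebruch_swap [of x k v] True quad \<open>- k \<le> c\<close>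
        by (simp add: lattice_minus)
    next
      case False
      then show ?thesis using that [of x v k] quad k \<open>k \<le> c\<close> by blast
    qed
    show ?thesis
      using hirzebruch_linked_to_triangle [OF yu(2-5) c(1) yu(6)] A unfolding yu(1) by blast
  qed
qed

section \<open>The fan of the projective plane\<close>

text \<open>
  Every proper subset of the triangle is contained in one of its three sides.
\<close>

lemma fan_of_triangle:
  assumes xy: "wedge x y = 1"
  shows "fan_of {x, y, - x - y} = {Cone A | A. A \<subset> {x, y, - x - y}}"
proof -
  let ?w = "- x - y"
  let ?T = "{x, y, ?w}"
  have yx: "wedge y x = -1" using xy wedge_swap [of y x] by simp
  have adjT: "adj ?T x y" "adj ?T y ?w" "adj ?T ?w x" using xy yx by (auto simp: adj_def)
  have "?w \<noteq> x" "?w \<noteq> y" "x \<noteq> y"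
  proof -
    have "wedge x ?w \<noteq> wedge x x" "wedge ?w y \<noteq> wedge y y" "wedge x x \<noteq> wedge x y"
      using xy by simp_all
    then show "?w \<noteq> x" "?w \<noteq> y" "x \<noteq> y" by metis+
  qed
  then have card: "card ?T = 3" by simp
  show ?thesis
  proof
    show "fan_of ?T \<subseteq> {Cone A | A. A \<subset> ?T}"
    proof
      fix \<tau> assume "\<tau> \<in> fan_of ?T"
      then obtain a b where "adj ?T a b \<and> \<tau> \<in> {{0}, Cone {a}, Cone {b}, Cone {a, b}}"
        unfolding fan_of_explicit by (elim exE)
      then have ab: "{a, b} \<subseteq> ?T" and \<tau>: "\<tau> \<in> {{0}, Cone {a}, Cone {b}, Cone {a, b}}" by (auto dest: adjD)
      have "card {a, b} < card ?T" unfolding card by (simp add: card_insert_if)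
      then have "{a, b} \<noteq> ?T" by (metis less_irrefl)
      with ab have ps: "{a, b} \<subset> ?T" by (rule psubsetI)
      have "\<tau> \<in> (\<lambda>A. Cone A) ` {{}, {a}, {b}, {a, b}}"
        using \<tau> unfolding image_insert image_empty convex_cone_hull_empty .
      then obtain A where "\<tau> = Cone A" "A \<in> {{}, {a}, {b}, {a, b}}" by (rule imageE)
      moreover from this have "A \<subset> ?T" using ps by blast
      ultimately show "\<tau> \<in> {Cone A | A. A \<subset> ?T}" by (intro CollectI exI conjI)
    qed
    show "{Cone A | A. A \<subset> ?T} \<subseteq> fan_of ?T"
    proof
      fix \<tau> assume "\<tau> \<in> {Cone A | A. A \<subset> ?T}"
      then obtain A where \<tau>: "\<tau> = Cone A" and A: "A \<subset> ?T" by (elim CollectE exE conjE)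
      obtain t where "t \<in> ?T" "A \<subseteq> ?T - {t}" using A by blast
      then obtain a b where ab: "adj ?T a b" "A \<subseteq> {a, b}" using adjT by blast
      then have "A \<in> {{}, {a}, {b}, {a, b}}" by blast
      then have "Cone A \<in> (\<lambda>A. Cone A) ` {{}, {a}, {b}, {a, b}}" by (rule imageI)
      then show "\<tau> \<in> fan_of ?T" unfolding \<tau> image_insert image_empty convex_cone_hull_empty
        by (rule fan_ofI [OF ab(1)])
    qed
  qed
qed

lemma triangle_iso_projective_plane:
  assumes lat: "x \<in> lattice" "y \<in> lattice" and xy: "wedge x y = 1"
  shows "fan_iso (fan_of {x, y, - x - y}) projective_space_fan"
proof -
  let ?T = "{x, y, - x - y}"
  define f :: "real ^ 2 \<Rightarrow> real ^ 2" where "f v = vector [wedge v y, wedge x v]" for v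
  have lin: "linear f"
    by (rule linearI) (simp_all add: f_def vec_eq_iff forall_2)
  have inj: "inj f"
    by (rule injI, rule wedge_eqI [OF xy]) (simp_all add: f_def vec_eq_iff forall_2)
  have fL: "f ` lattice = lattice"
  proof
    show "f ` lattice \<subseteq> lattice"
    proof clarify
      fix v :: "real ^ 2" assume "v \<in> lattice"
      then have "wedge v y \<in> \<int>" "wedge x v \<in> \<int>" using lat wedge_lattice by blast+
      then show "f v \<in> lattice" by (simp add: f_def lattice_def forall_2)
    qed
    show "lattice \<subseteq> f ` lattice"
    proof
      fix u :: "real ^ 2" assume "u \<in> lattice"
      then have "u $ 1 *\<^sub>R x + u $ 2 *\<^sub>R y \<in> lattice"
        using lat by (intro lattice_add lattice_scale) (auto simp: lattice_def)
      moreover have "f (u $ 1 *\<^sub>R x + u $ 2 *\<^sub>R y) = u"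
        using xy by (simp add: f_def vec_eq_iff forall_2)
      ultimately show "u \<in> f ` lattice" by (metis image_eqI)
    qed
  qed
  have ax: "(axis 1 1 :: real ^ 2) = vector [1, 0]" "(axis 2 1 :: real ^ 2) = vector [0, 1]"
    by (simp_all add: vec_eq_iff forall_2 axis_def)
  have "f x = vector [1, 0]" "f y = vector [0, 1]" using xy by (simp_all add: f_def)
  moreover from this have "f (- x - y) = - (vector [1, 0] + vector [0, 1])"
    using lin by (simp add: linear_diff linear_neg)
  moreover have "range (\<lambda>i::2. axis i (1::real)) = {axis 1 1, axis 2 1}"
    unfolding UNIV_2 by blast
  ultimately have fT: "insert (- (\<Sum>i\<in>UNIV. axis i 1)) (range (\<lambda>i. axis i 1)) = f ` ?T"
    unfolding sum_2 by (auto simp: ax)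
  have sub: "{f ` A | A. A \<subset> ?T} = {A. A \<subset> f ` ?T}"
  proof
    show "{f ` A | A. A \<subset> ?T} \<subseteq> {A. A \<subset> f ` ?T}"
      using image_strict_mono [OF inj_on_subset [OF inj subset_UNIV]] by blast
    show "{A. A \<subset> f ` ?T} \<subseteq> {f ` A | A. A \<subset> ?T}"
    proof
      fix A assume "A \<in> {A. A \<subset> f ` ?T}"
      then have A: "A \<subset> f ` ?T" by (rule CollectD)
      then obtain A' where A': "A' \<subseteq> ?T" "A = f ` A'"
        by (meson psubset_imp_subset subset_image_iff)
      then have "A' \<subset> ?T" using A by (metis psubsetI psubset_eq)
      then show "A \<in> {f ` A | A. A \<subset> ?T}" using A'(2) by (intro CollectI exI conjI)
    qed
  qed
  have "projective_space_fan = {Cone A | A. A \<in> {f ` A | A. A \<subset> ?T}}"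
    unfolding projective_space_fan_def fT sub by blast
  also have "\<dots> = (\<lambda>\<sigma>. f ` \<sigma>) ` {Cone A | A. A \<subset> ?T}"
    using convex_cone_hull_linear_image [OF lin] by blast
  finally show ?thesis
    unfolding fan_iso_def fan_of_triangle [OF xy] using lin fL by blast
qed

section \<open>Toric Fano and weak Fano surfaces\<close>

lemma surface_linked_to_projective_plane:
  fixes \<Delta> :: "(real ^ 2) set set"
  assumes K: "\<And>G. complete_rays G \<Longrightarrow> K (fan_of G) \<longleftrightarrow> wall_bound c G" and c: "1 \<le> c" "c \<le> 2"
    and \<Delta>: "nonsingular_fan \<Delta>" "complete_fan \<Delta>" "K \<Delta>"
  shows "\<exists>A B C. K A \<and> K B \<and> K C \<and> blowups K \<Delta> A \<and> blowups K B A \<and> blowups K B C \<and>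
    fan_iso C projective_space_fan"
proof -
  define G where "G = gens \<Delta>"
  have G: "complete_rays G" and eq: "\<Delta> = fan_of G"
    using complete_nonsingular_fan_is_fan_of [OF \<Delta>(1,2)] unfolding G_def by blast+
  have deg: "wall_bound c G" using \<Delta>(3) K [OF G] unfolding eq by blast
  obtain A B a b where
    GA: "(contracts c)\<^sup>*\<^sup>* G A" and BA: "(contracts c)\<^sup>*\<^sup>* B A" and
    BT: "(contracts c)\<^sup>*\<^sup>* B {a, b, - a - b}" and ab: "a \<in> lattice" "b \<in> lattice" "wedge a b = 1"
    using linked_to_triangle [OF G deg c] by blast
  define T where "T = {a, b, - a - b}"
  have A: "complete_rays A" "wall_bound c A" using contracts_rtranclp_preserves [OF GA G deg] by blast+
  have "B = A \<or> (complete_rays B \<and> wall_bound c B)"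
    using BA by (metis contracts_def converse_rtranclpE)
  then have B: "complete_rays B" "wall_bound c B" using A by blast+
  have T: "complete_rays T" "wall_bound c T"
    using contracts_rtranclp_preserves [OF BT B] unfolding T_def by blast+
  note blow = contracts_blowups [of K c, OF K]
  have "K (fan_of A)" "K (fan_of B)" "K (fan_of T)" using A B T K by blast+
  moreover have "blowups K \<Delta> (fan_of A)" "blowups K (fan_of B) (fan_of A)" "blowups K (fan_of B) (fan_of T)"
    using blow [OF _ GA] blow [OF _ BA] blow [OF _ BT] unfolding eq T_def by blast+
  moreover have "fan_iso (fan_of T) projective_space_fan"
    unfolding T_def by (rule triangle_iso_projective_plane [OF ab])
  ultimately show ?thesis by blast
qed

lemma toric_Fano_surface_F_equivalent:
  fixes \<Delta> :: "(real ^ 2) set set"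
  assumes \<Delta>: "toric_Fano \<Delta>"
  shows "F_equivalent \<Delta> projective_space_fan"
proof -
  have sm: "nonsingular_fan \<Delta>" "complete_fan \<Delta>" using \<Delta>
    by (auto simp: toric_Fano_def)
  obtain A B C where K: "toric_Fano A" "toric_Fano B" "toric_Fano C"
    and b: "blowups toric_Fano \<Delta> A" "blowups toric_Fano B A" "blowups toric_Fano B C"
    and iso: "fan_iso C projective_space_fan"
    using surface_linked_to_projective_plane [OF toric_Fano_iff _ _ sm \<Delta>] by auto
  \<comment> \<open>The first blow-up \<open>Y 1 \<rightarrow> Y 0\<close> is the empty succession.\<close>
  define Y where "Y j = (if j \<le> 1 then \<Delta> else if j = 2 then A else if j = 3 then B else C)" for j :: nat
  have "blowups toric_Fano (Y j) (Y (j - 1)) \<and> blowups toric_Fano (Y j) (Y (j + 1))"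
    if "j < 2 * 2" "odd j" for j
  proof -
    have "j = 1 \<or> j = 3" using that by presburger
    then show ?thesis using b by (auto simp: Y_def blowups_def)
  qed
  moreover have "toric_Fano (Y j)" for j using \<Delta> K by (simp add: Y_def)
  moreover have "fan_iso \<Delta> (Y 0)" "fan_iso (Y (2 * 2)) projective_space_fan"
    using iso fan_iso_refl by (auto simp: Y_def)
  ultimately show ?thesis unfolding F_equivalent_def by blast
qed

lemma toric_weak_Fano_surface_weakly_F_equivalent:
  fixes \<Delta> :: "(real ^ 2) set set"
  assumes \<Delta>: "toric_weak_Fano \<Delta>"
  shows "weakly_F_equivalent \<Delta> projective_space_fan"
proof -
  have sm: "nonsingular_fan \<Delta>" "complete_fan \<Delta>"
    using \<Delta> by (auto simp: toric_weak_Fano_def projective_fan_def)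
  obtain A B C where K: "toric_weak_Fano A" "toric_weak_Fano B" "toric_weak_Fano C"
    and b: "blowups toric_weak_Fano \<Delta> A" "blowups toric_weak_Fano B A" "blowups toric_weak_Fano B C"
    and iso: "fan_iso C projective_space_fan"
    using surface_linked_to_projective_plane [OF toric_weak_Fano_iff _ _ sm \<Delta>] by auto
  \<comment> \<open>The succession \<open>Y 1 \<rightarrow> Y 0\<close> and both successions of flops are empty.\<close>
  define Y where "Y j = (if j \<le> 1 then \<Delta> else if j \<le> 3 then A else if j = 4 then B else C)" for j :: nat
  have "blowups toric_weak_Fano (Y (3 * j - 2)) (Y (3 * j - 3)) \<and>
      blowups toric_weak_Fano (Y (3 * j - 2)) (Y (3 * j - 1)) \<and>
      flops toric_weak_Fano (Y (3 * j - 1)) (Y (3 * j))" if "j \<in> {1..2}" for j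
  proof -
    have "j = 1 \<or> j = 2" using that by auto
    then show ?thesis using b by (auto simp: Y_def blowups_def flops_def)
  qed
  moreover have "toric_weak_Fano (Y j)" for j using \<Delta> K by (simp add: Y_def)
  moreover have "fan_iso \<Delta> (Y 0)" "fan_iso (Y (3 * 2)) projective_space_fan"
    using iso fan_iso_refl by (auto simp: Y_def)
  ultimately show ?thesis unfolding weakly_F_equivalent_def by blast
qed

theorem theorem6p22:
  shows "(\<forall>\<Delta> :: (real ^ 2) set set. toric_Fano \<Delta> \<longrightarrow> F_equivalent \<Delta> projective_space_fan) \<and>
         (\<forall>\<Delta> :: (real ^ 2) set set. toric_weak_Fano \<Delta> \<longrightarrow> weakly_F_equivalent \<Delta> projective_space_fan) \<and>
         (\<forall>\<Delta> :: (real ^ 2) set set. toric_Fano \<Delta> \<longrightarrow>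
            pseudo_symmetric \<Delta> \<or> F_equivalent \<Delta> projective_space_fan)"
  using toric_Fano_surface_F_equivalent toric_weak_Fano_surface_weakly_F_equivalent by blast

end
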